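(* Let $n\ge 1$ and let $M_n=F_n/F_n''$ be the free metabelian group of rank $n$. If an endomorphism $\varphi\colon M_n\to M_n$ maps every primitive element of $M_n$ to a primitive element of $M_n$, then $\varphi$ is an automorphism of $M_n$.
   Context: $F_n$ is the free group of rank $n$; $G'=[G,G]$ is the commutator subgroup and $G''=(G')'$. A free basis of $M_n$ is a generating $n$-tuple such that every map from it to a metabelian group extends to a homomorphism (equivalently, the image of the standard basis under an automorphism of $M_n$). An element of $M_n$ is called primitive if it belongs to a free basis of $M_n$. *)

theory Defs
  imports "HOL-Algebra.Algebra"
begin

section \<open>Free groups of finite rank\<close>

text \<open>The letter \<^term>\<open>(i, False)\<close> stands for the generator with index \<^term>\<open>i\<close>,
  and \<^term>\<open>(i, True)\<close> for its inverse.\<close>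

type_synonym letter = "nat \<times> bool"

definition inv_letter :: "letter \<Rightarrow> letter" where
  "inv_letter a = (fst a, \<not> snd a)"

definition reduced :: "letter list \<Rightarrow> bool" where
  "reduced w \<longleftrightarrow> successively (\<lambda>a b. b \<noteq> inv_letter a) w"

fun red_cons :: "letter \<Rightarrow> letter list \<Rightarrow> letter list" where
  "red_cons a [] = [a]"
| "red_cons a (b # w) = (if b = inv_letter a then w else a # b # w)"

definition free_group :: "nat \<Rightarrow> letter list monoid" where
  "free_group n =
     \<lparr>carrier = {w. reduced w \<and> fst ` set w \<subseteq> {..<n}},
      monoid.mult = (\<lambda>u v. foldr red_cons u v),
      one = []\<rparr>"


section \<open>Free metabelian groups and primitive elements\<close>

definition metabelian :: "('a, 'b) monoid_scheme \<Rightarrow> bool" where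
  "metabelian G \<longleftrightarrow> group G \<and> derived G (derived G (carrier G)) = {\<one>\<^bsub>G\<^esub>}"

definition free_metabelian :: "nat \<Rightarrow> letter list set monoid" where
  "free_metabelian n =
     free_group n Mod derived (free_group n) (derived (free_group n) (carrier (free_group n)))"

text \<open>The metabelian groups \<^term>\<open>H\<close> below range over a fixed carrier type; by
  \<open>free_basis_extends\<close> and \<open>free_basis_iff_automorphism\<close> at the end of this theory
  this restriction is immaterial.\<close>

definition free_basis :: "nat \<Rightarrow> (nat \<Rightarrow> letter list set) \<Rightarrow> bool" where
  "free_basis n x \<longleftrightarrow>
     x \<in> {..<n} \<rightarrow> carrier (free_metabelian n) \<and>
     generate (free_metabelian n) (x ` {..<n}) = carrier (free_metabelian n) \<and>
     (\<forall>H :: letter list set monoid. metabelian H \<longrightarrow>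
        (\<forall>h \<in> {..<n} \<rightarrow> carrier H.
           \<exists>f \<in> hom (free_metabelian n) H. \<forall>i<n. f (x i) = h i))"

definition primitive :: "nat \<Rightarrow> letter list set \<Rightarrow> bool" where
  "primitive n g \<longleftrightarrow> (\<exists>x. free_basis n x \<and> g \<in> x ` {..<n})"

definition std_gen :: "nat \<Rightarrow> nat \<Rightarrow> letter list set" where
  "std_gen n i =
     derived (free_group n) (derived (free_group n) (carrier (free_group n)))
       #>\<^bsub>free_group n\<^esub> [(i, False)]"


section \<open>Basic properties\<close>

lemma inv_letter_simps [simp]:
  "inv_letter (inv_letter a) = a" "fst (inv_letter a) = fst a"
  "inv_letter a \<noteq> a" "a \<noteq> inv_letter a"
  by (auto simp: inv_letter_def prod_eq_iff)

lemma inv_letter_eq_iff [simp]: "inv_letter a = inv_letter b \<longleftrightarrow> a = b"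
  by (auto simp: inv_letter_def prod_eq_iff)

lemma reduced_simps [simp]:
  "reduced []" "reduced [a]"
  "reduced (a # b # w) \<longleftrightarrow> b \<noteq> inv_letter a \<and> reduced (b # w)"
  by (auto simp: reduced_def)

lemma reduced_ConsD: "reduced (a # w) \<Longrightarrow> reduced w"
  by (cases w) auto

lemma reduced_red_cons: "reduced w \<Longrightarrow> reduced (red_cons a w)"
  by (cases w) (auto dest: reduced_ConsD)

lemma set_red_cons: "set (red_cons a w) \<subseteq> insert a (set w)"
  by (cases w) auto

lemma red_cons_reduced: "reduced (a # w) \<Longrightarrow> red_cons a w = a # w"
  by (cases w) auto

lemma red_cons_inv: "reduced w \<Longrightarrow> red_cons a (red_cons (inv_letter a) w) = w"
  by (cases w) (auto simp: red_cons_reduced)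

lemma reduced_foldr: "reduced v \<Longrightarrow> reduced (foldr red_cons u v)"
  by (induction u) (auto simp: reduced_red_cons)

lemma set_foldr: "set (foldr red_cons u v) \<subseteq> set u \<union> set v"
  by (induction u) (use set_red_cons in fastforce)+

lemma foldr_red_cons_Nil: "reduced u \<Longrightarrow> foldr red_cons u [] = u"
proof (induction u)
  case (Cons a u)
  then show ?case
    using reduced_ConsD[OF Cons.prems] by (simp add: red_cons_reduced)
qed simp

lemma foldr_red_cons:
  assumes "reduced v"
  shows "foldr red_cons (red_cons a w) v = red_cons a (foldr red_cons w v)"
proof (cases w)
  case (Cons b w')
  show ?thesis
    using red_cons_inv[OF reduced_foldr[OF assms, of w'], of a] by (simp add: Cons)
qed simp

lemma foldr_assoc:
  assumes "reduced w"
  shows "foldr red_cons (foldr red_cons u v) w = foldr red_cons u (foldr red_cons v w)"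
  by (induction u) (simp_all add: foldr_red_cons assms)

lemma foldr_inverse:
  assumes "reduced v"
  shows "foldr red_cons (map inv_letter (rev w)) (foldr red_cons w v) = v"
proof (induction w)
  case (Cons a w)
  then show ?case
    using red_cons_inv[OF reduced_foldr[OF assms, of w], of "inv_letter a"] by simp
qed simp

lemma carrier_free_group:
  "carrier (free_group n) = {w. reduced w \<and> fst ` set w \<subseteq> {..<n}}"
  by (simp add: free_group_def)

lemma one_free_group: "\<one>\<^bsub>free_group n\<^esub> = []"
  by (simp add: free_group_def)

lemma mult_free_group: "u \<otimes>\<^bsub>free_group n\<^esub> v = foldr red_cons u v"
  by (simp add: free_group_def)

lemma group_free_group: "group (free_group n)"
proof (rule groupI)
  fix u v w
  assume u: "u \<in> carrier (free_group n)" and v: "v \<in> carrier (free_group n)"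
    and w: "w \<in> carrier (free_group n)"
  show "u \<otimes>\<^bsub>free_group n\<^esub> v \<in> carrier (free_group n)"
    using u v set_foldr[of u v]
    by (fastforce simp: carrier_free_group mult_free_group reduced_foldr)
  show "u \<otimes>\<^bsub>free_group n\<^esub> v \<otimes>\<^bsub>free_group n\<^esub> w =
        u \<otimes>\<^bsub>free_group n\<^esub> (v \<otimes>\<^bsub>free_group n\<^esub> w)"
    using w by (simp add: carrier_free_group mult_free_group foldr_assoc)
next
  fix u assume u: "u \<in> carrier (free_group n)"
  let ?v = "foldr red_cons (map inv_letter (rev u)) []"
  have "?v \<in> carrier (free_group n)"
    using u set_foldr[of "map inv_letter (rev u)" "[]"]
    by (fastforce simp: carrier_free_group reduced_foldr)
  moreover have "?v \<otimes>\<^bsub>free_group n\<^esub> u = \<one>\<^bsub>free_group n\<^esub>"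
    using u foldr_assoc[of u "map inv_letter (rev u)" "[]"] foldr_inverse[of "[]" u]
    by (simp add: carrier_free_group mult_free_group one_free_group foldr_red_cons_Nil)
  ultimately show "\<exists>v\<in>carrier (free_group n). v \<otimes>\<^bsub>free_group n\<^esub> u = \<one>\<^bsub>free_group n\<^esub>"
    by blast
qed (auto simp: carrier_free_group mult_free_group one_free_group)

definition letter_val :: "('a, 'b) monoid_scheme \<Rightarrow> (nat \<Rightarrow> 'a) \<Rightarrow> letter \<Rightarrow> 'a" where
  "letter_val H h a = (if snd a then inv\<^bsub>H\<^esub> (h (fst a)) else h (fst a))"

definition word_val :: "('a, 'b) monoid_scheme \<Rightarrow> (nat \<Rightarrow> 'a) \<Rightarrow> letter list \<Rightarrow> 'a" where
  "word_val H h w = foldr (\<lambda>a y. letter_val H h a \<otimes>\<^bsub>H\<^esub> y) w \<one>\<^bsub>H\<^esub>"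

lemma word_val_simps [simp]:
  "word_val H h [] = \<one>\<^bsub>H\<^esub>"
  "word_val H h (a # w) = letter_val H h a \<otimes>\<^bsub>H\<^esub> word_val H h w"
  by (simp_all add: word_val_def)

lemma free_group_universal:
  assumes "group H" and h: "h \<in> {..<n} \<rightarrow> carrier H"
  shows "word_val H h \<in> hom (free_group n) H"
    and "i < n \<Longrightarrow> word_val H h [(i, False)] = h i"
proof -
  interpret H: group H by fact
  have lv: "letter_val H h a \<in> carrier H" if "fst a < n" for a
    using h that by (auto simp: letter_val_def)
  have wv: "word_val H h w \<in> carrier H" if "fst ` set w \<subseteq> {..<n}" for w
    using that by (induction w) (auto simp: lv)
  have li: "letter_val H h (inv_letter a) = inv\<^bsub>H\<^esub> letter_val H h a" if "fst a < n" for a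
    using h that by (cases a) (auto simp: letter_val_def inv_letter_def Pi_iff)
  have rc: "word_val H h (red_cons a w) = letter_val H h a \<otimes>\<^bsub>H\<^esub> word_val H h w"
    if "fst a < n" "fst ` set w \<subseteq> {..<n}" for a w
  proof (cases w)
    case (Cons b w')
    show ?thesis
    proof (cases "b = inv_letter a")
      case True
      then show ?thesis using that lv[of a] wv[of w']
        by (simp add: Cons li flip: H.m_assoc)
    qed (simp add: Cons)
  qed simp
  have fr: "word_val H h (foldr red_cons u v) = word_val H h u \<otimes>\<^bsub>H\<^esub> word_val H h v"
    if "fst ` set u \<subseteq> {..<n}" "fst ` set v \<subseteq> {..<n}" for u v
    using that
  proof (induction u)
    case (Cons a u)
    have "fst ` set (foldr red_cons u v) \<subseteq> {..<n}"
      using Cons.prems set_foldr[of u v] by fastforce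
    then show ?case
      using Cons lv[of a] wv[of u] wv[of v] by (simp add: rc H.m_assoc)
  qed (simp add: wv)
  show "word_val H h \<in> hom (free_group n) H"
    by (rule homI) (auto simp: carrier_free_group mult_free_group wv fr)
  show "word_val H h [(i, False)] = h i" if "i < n"
    using h that by (auto simp: letter_val_def Pi_iff)
qed

lemma free_group_generated:
  "generate (free_group n) ((\<lambda>i. [(i, False)]) ` {..<n}) = carrier (free_group n)"
    (is "generate ?F ?S = _")
proof
  interpret F: group ?F by (rule group_free_group)
  show "generate ?F ?S \<subseteq> carrier ?F"
    by (rule F.generate_incl) (auto simp: carrier_free_group)
  have gl: "[a] \<in> generate ?F ?S" if "fst a < n" for a
  proof (cases "snd a")
    case False
    then show ?thesis using that by (intro generate.incl) (auto simp: prod_eq_iff image_iff)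
  next
    case True
    have "inv\<^bsub>?F\<^esub> [(fst a, False)] = [a]"
      by (rule F.inv_equality)
         (use that True in \<open>auto simp: carrier_free_group mult_free_group one_free_group
            inv_letter_def prod_eq_iff\<close>)
    then show ?thesis using that generate.inv[of "[(fst a, False)]" ?S ?F] by auto
  qed
  have "w \<in> generate ?F ?S" if "reduced w" "fst ` set w \<subseteq> {..<n}" for w
    using that
  proof (induction w)
    case Nil
    show ?case using generate.one[of ?F ?S] by (simp add: one_free_group)
  next
    case (Cons a w)
    have "[a] \<otimes>\<^bsub>?F\<^esub> w \<in> generate ?F ?S"
      using Cons gl[of a] by (intro generate.eng) (auto dest: reduced_ConsD)
    then show ?case using Cons by (simp add: mult_free_group red_cons_reduced)
  qed
  then show "carrier ?F \<subseteq> generate ?F ?S" by (auto simp: carrier_free_group)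
qed

lemma second_derived_normal:
  assumes "group G"
  shows "derived G (derived G (carrier G)) \<lhd> G"
  using assms group.derived_is_normal group.derived_self_is_normal by blast

lemma group_free_metabelian: "group (free_metabelian n)"
  unfolding free_metabelian_def
  by (intro normal.factorgroup_is_group second_derived_normal group_free_group)

lemma free_metabelian_proj:
  fixes n
  defines "F \<equiv> free_group n"
  defines "p \<equiv> (\<lambda>w. derived F (derived F (carrier F)) #>\<^bsub>F\<^esub> w)"
  shows "group_hom F (free_metabelian n) p"
    and "p ` carrier F = carrier (free_metabelian n)"
proof -
  interpret F: group F unfolding F_def by (rule group_free_group)
  interpret N: normal "derived F (derived F (carrier F))" F
    by (rule second_derived_normal) (rule F.is_group)
  show "group_hom F (free_metabelian n) p"
    using N.r_coset_hom_Mod group_free_metabelian[of n]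
    unfolding p_def by (intro group_hom.intro group_hom_axioms.intro F.is_group)
      (auto simp: free_metabelian_def F_def)
  show "p ` carrier F = carrier (free_metabelian n)"
    by (simp add: free_metabelian_def carrier_FactGroup p_def F_def)
qed

lemma metabelian_free_metabelian: "metabelian (free_metabelian n)"
proof -
  let ?F = "free_group n" and ?M = "free_metabelian n"
  let ?N = "derived ?F (derived ?F (carrier ?F))"
  let ?p = "\<lambda>w. ?N #>\<^bsub>?F\<^esub> w"
  interpret group_hom ?F ?M ?p by (rule free_metabelian_proj)
  interpret N: normal ?N ?F by (rule second_derived_normal) (rule group_free_group)
  have "derived ?M (derived ?M (carrier ?M)) = ?p ` ?N"
    by (simp add: derived_img G.derived_in_carrier flip: free_metabelian_proj(2))
  also have "\<dots> = (\<lambda>_. ?N) ` ?N"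
    using N.rcos_const[OF group_free_group] by (intro image_cong) auto
  also have "\<dots> = {?N}"
    using N.one_closed by blast
  also have "?N = \<one>\<^bsub>?M\<^esub>"
    by (simp add: free_metabelian_def)
  finally show ?thesis
    by (simp add: metabelian_def group_free_metabelian)
qed

lemma std_gen_closed: "i < n \<Longrightarrow> std_gen n i \<in> carrier (free_metabelian n)"
  by (auto simp: std_gen_def carrier_free_group simp flip: free_metabelian_proj(2))

lemma std_gen_generates:
  "generate (free_metabelian n) (std_gen n ` {..<n}) = carrier (free_metabelian n)"
proof -
  let ?F = "free_group n" and ?M = "free_metabelian n"
  let ?p = "\<lambda>w. derived ?F (derived ?F (carrier ?F)) #>\<^bsub>?F\<^esub> w"
  interpret group_hom ?F ?M ?p by (rule free_metabelian_proj)
  have "std_gen n ` {..<n} = ?p ` (\<lambda>i. [(i, False)]) ` {..<n}"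
    by (simp add: image_image std_gen_def)
  also have "generate ?M \<dots> = ?p ` generate ?F ((\<lambda>i. [(i, False)]) ` {..<n})"
    by (rule generate_img) (auto simp: carrier_free_group)
  finally show ?thesis
    by (simp add: free_group_generated free_metabelian_proj(2))
qed

lemma std_gen_extends:
  assumes H: "metabelian H" and h: "h \<in> {..<n} \<rightarrow> carrier H"
  shows "\<exists>f \<in> hom (free_metabelian n) H. \<forall>i<n. f (std_gen n i) = h i"
proof -
  let ?F = "free_group n" and ?v = "word_val H h"
  let ?N = "derived ?F (derived ?F (carrier ?F))"
  have "group H" using H by (simp add: metabelian_def)
  then interpret group_hom ?F H ?v
    by (intro group_hom.intro group_hom_axioms.intro group_free_group free_group_universal h)
  have NF: "?N \<subseteq> carrier ?F"
    by (simp add: G.derived_in_carrier)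
  have "?v ` ?N = derived H (derived H (?v ` carrier ?F))"
    by (simp add: derived_img G.derived_in_carrier)
  also have "\<dots> \<subseteq> derived H (derived H (carrier H))"
    by (intro H.mono_derived) auto
  finally have "?N \<subseteq> kernel ?F H ?v"
    using H NF by (auto simp: metabelian_def kernel_def)
  with FactGroup_universal_kernel[OF second_derived_normal[OF group_free_group]]
  obtain g where g: "g \<in> hom (free_metabelian n) H"
    "\<And>w. w \<in> carrier ?F \<Longrightarrow> g (?N #>\<^bsub>?F\<^esub> w) = ?v w"
    unfolding free_metabelian_def by blast
  have gen: "[(i, False)] \<in> carrier ?F" if "i < n" for i
    using that by (simp add: carrier_free_group)
  have "g (std_gen n i) = h i" if "i < n" for i
    using free_group_universal(2)[OF \<open>group H\<close> h that] g(2)[of "[(i, False)]"] that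
    by (simp add: std_gen_def gen del: word_val_simps)
  with g(1) show ?thesis by blast
qed

lemma free_basis_std_gen: "free_basis n (std_gen n)"
  unfolding free_basis_def
  by (intro conjI allI impI ballI std_gen_extends) (simp_all add: std_gen_closed std_gen_generates)

lemma hom_eq_on_generate:
  assumes "group G" "group H" "f \<in> hom G H" "g \<in> hom G H" "S \<subseteq> carrier G"
    and "\<And>s. s \<in> S \<Longrightarrow> f s = g s" and "x \<in> generate G S"
  shows "f x = g x"
proof -
  interpret f: group_hom G H f by (simp add: assms group_hom.intro group_hom_axioms.intro)
  interpret g: group_hom G H g by (simp add: assms group_hom.intro group_hom_axioms.intro)
  show ?thesis
    using assms(7)
  proof induction
    case (eng a b)
    then show ?case using f.G.generate_in_carrier[OF assms(5)] by simp
  qed (use assms(5,6) in auto)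
qed

text \<open>A free basis has the extension property for metabelian groups of an arbitrary
  carrier type.\<close>

theorem free_basis_extends:
  fixes H :: "('a, 'b) monoid_scheme"
  assumes x: "free_basis n x" and H: "metabelian H" and h: "h \<in> {..<n} \<rightarrow> carrier H"
  shows "\<exists>f \<in> hom (free_metabelian n) H. \<forall>i<n. f (x i) = h i"
proof -
  obtain f where f: "f \<in> hom (free_metabelian n) (free_metabelian n)"
    "\<forall>i<n. f (x i) = std_gen n i"
  proof -
    have "std_gen n \<in> {..<n} \<rightarrow> carrier (free_metabelian n)"
      using std_gen_closed by auto
    with x metabelian_free_metabelian[of n]
    have "\<exists>f \<in> hom (free_metabelian n) (free_metabelian n). \<forall>i<n. f (x i) = std_gen n i"
      by (simp add: free_basis_def)
    then show thesis using that by blast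
  qed
  obtain g where g: "g \<in> hom (free_metabelian n) H" "\<forall>i<n. g (std_gen n i) = h i"
    using std_gen_extends[OF H h] by blast
  have "g \<circ> f \<in> hom (free_metabelian n) H"
    using f(1) g(1) by (rule hom_compose)
  then show ?thesis using f(2) g(2) by (intro bexI[of _ "g \<circ> f"]) auto
qed

theorem free_basis_iff_automorphism:
  "free_basis n x \<longleftrightarrow>
     (\<exists>f \<in> iso (free_metabelian n) (free_metabelian n). \<forall>i<n. x i = f (std_gen n i))"
    (is "_ \<longleftrightarrow> ?R")
proof
  let ?M = "free_metabelian n"
  note grp = group_free_metabelian[of n]
  assume x: "free_basis n x"
  have xM: "x \<in> {..<n} \<rightarrow> carrier ?M" and xg: "generate ?M (x ` {..<n}) = carrier ?M"
    using x by (simp_all add: free_basis_def)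
  obtain f where f: "f \<in> hom ?M ?M" "\<forall>i<n. f (std_gen n i) = x i"
    using std_gen_extends[OF metabelian_free_metabelian xM] by blast
  obtain g where g: "g \<in> hom ?M ?M" "\<forall>i<n. g (x i) = std_gen n i"
  proof -
    have "std_gen n \<in> {..<n} \<rightarrow> carrier ?M"
      using std_gen_closed by auto
    from free_basis_extends[OF x metabelian_free_metabelian this] show thesis
      using that by blast
  qed
  have idM: "id \<in> hom ?M ?M"
    by (simp add: hom_def)
  have gf: "(g \<circ> f) y = id y" if "y \<in> carrier ?M" for y
    by (rule hom_eq_on_generate[OF grp grp Group.hom_compose[OF f(1) g(1)] idM,
          of "std_gen n ` {..<n}"])
       (use that f(2) g(2) std_gen_closed in \<open>auto simp: std_gen_generates\<close>)
  have fg: "(f \<circ> g) y = id y" if "y \<in> carrier ?M" for y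
    by (rule hom_eq_on_generate[OF grp grp Group.hom_compose[OF g(1) f(1)] idM,
          of "x ` {..<n}"])
       (use that f(2) g(2) xM in \<open>auto simp: xg\<close>)
  have "bij_betw f (carrier ?M) (carrier ?M)"
    by (rule bij_betw_byWitness[where f' = g])
       (use gf fg hom_in_carrier[OF f(1)] hom_in_carrier[OF g(1)] in auto)
  then have "f \<in> iso ?M ?M"
    using f(1) by (simp add: iso_def)
  then show ?R using f(2) by (intro bexI[of _ f]) auto
next
  let ?M = "free_metabelian n"
  note grp = group_free_metabelian[of n]
  assume ?R
  then obtain f where f: "f \<in> iso ?M ?M" "\<forall>i<n. x i = f (std_gen n i)" by blast
  interpret group_hom ?M ?M f
    using f grp by (simp add: group_hom.intro group_hom_axioms.intro iso_def)
  let ?g = "inv_into (carrier ?M) f"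
  have g: "?g \<in> hom ?M ?M"
    using G.iso_set_sym[OF f(1)] by (simp add: iso_def)
  have gx: "?g (x i) = std_gen n i" if "i < n" for i
    using f that std_gen_closed[OF that] by (simp add: iso_def bij_betw_def)
  have xi: "x ` {..<n} = f ` std_gen n ` {..<n}"
    using f(2) by (auto simp: image_image)
  have "generate ?M (x ` {..<n}) = f ` carrier ?M"
    unfolding xi using std_gen_closed by (subst generate_img) (auto simp: std_gen_generates)
  also have "\<dots> = carrier ?M"
    using f(1) by (simp add: iso_def bij_betw_def)
  finally have "generate ?M (x ` {..<n}) = carrier ?M" .
  moreover have "\<exists>k \<in> hom ?M K. \<forall>i<n. k (x i) = h i"
    if K: "metabelian K" "h \<in> {..<n} \<rightarrow> carrier K" for K :: "letter list set monoid" and h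
  proof -
    obtain k where k: "k \<in> hom ?M K" "\<forall>i<n. k (std_gen n i) = h i"
      using std_gen_extends[OF K] by blast
    then show ?thesis
      using Group.hom_compose[OF g k(1)] gx by (intro bexI[of _ "k \<circ> ?g"]) auto
  qed
  moreover have "x \<in> {..<n} \<rightarrow> carrier ?M"
    using f(2) std_gen_closed by auto
  ultimately show "free_basis n x"
    by (simp add: free_basis_def)
qed

end

theory Submission
  imports Defs "HOL-Library.Poly_Mapping" "HOL-Number_Theory.Residues" "Jordan_Normal_Form.Determinant"
begin

text \<open>
  Let \<open>J\<close> be the Jacobian of \<open>\<phi>\<close>: its entries are the Fox derivatives of the images of the standard
  generators, in the Laurent polynomial ring of the abelianisation.  By the chain rule, \<open>\<phi>\<close> sends an
  element with Fox row \<open>u\<close> to one with row \<open>\<phi>(u) J\<close>, and the Fox row of a primitive element is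
  unimodular.  Specialise the variables to powers of \<open>N\<close> modulo a prime \<open>p\<close> not dividing \<open>N\<close>.  If
  \<open>det J\<close> vanished there, take a left kernel vector \<open>u\<close>.  Euclid's algorithm gives a free basis \<open>y\<close> all
  of whose members but one act trivially; by the fundamental formula \<open>u\<close> is supported on members acting
  trivially, so up to a scalar it is the Fox row of a primitive element \<open>y\<^sub>k \<Prod> y\<^sub>i ^ u\<^sub>i\<close>, whose
  image has zero Fox row modulo \<open>p\<close>, a contradiction.  A Laurent polynomial without zeros under all these
  specialisations is \<open>\<plusminus>\<close> a monomial, so \<open>J\<close> is invertible.

  An endomorphism with invertible Jacobian is surjective: choose an endomorphism \<open>\<rho>\<close> inverting \<open>\<phi>\<close> on
  the abelianisation and apply the chain rule to the crossed homomorphism \<open>w \<mapsto> w (\<phi> (\<rho> w))\<inverse>\<close> into the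
  commutator subgroup.  A right inverse of \<open>\<phi>\<close> again has invertible Jacobian, hence is also surjective.
\<close>

text \<open>A prime modulus is what makes a kernel vector usable: its coefficients are residues of
  integers, and an integer can serve as an exponent in a product of group elements. Sending all
  variables to powers of a single \<open>N\<close> makes the action factor through a homomorphism to
  the integers, and for such a homomorphism Euclid's algorithm can push the whole action into one
  basis element. Fox rows add up only along elements that act trivially, so this one element is the
  obstacle; the fundamental formula shows that it acts trivially after all or has coefficient zero.
  The one-parameter specialisations suffice because, for suitable \<open>B\<close>, the weights
  built from \<open>B ^ i\<close> keep the finitely many monomials of the determinant apart
  (Kronecker substitution), which leaves a question on integer polynomials in one variable.

  For surjectivity, the augmented inverse of the Jacobian supplies \<open>\<rho>\<close>. The
  discrepancy between the identity and \<open>\<phi> \<circ> \<rho>\<close> then lies in an abelian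
  normal subgroup, a module over the Laurent ring on which matrices can act.\<close>

type_synonym expo = "nat \<Rightarrow>\<^sub>0 int"
text \<open>The integral group ring of a free abelian group of countable rank, with convolution as
  product. All \<open>n\<close> share this type; maps such as \<open>linear_ext n\<close> ignore the
  variables from \<open>n\<close> on.\<close>

type_synonym laurent = "expo \<Rightarrow>\<^sub>0 int"

abbreviation lmonom :: "expo \<Rightarrow> laurent" where
  "lmonom \<alpha> \<equiv> Poly_Mapping.single \<alpha> 1"

abbreviation unit_expo :: "nat \<Rightarrow> expo" where
  "unit_expo i \<equiv> Poly_Mapping.single i 1"

text \<open>Exponents form a convolution ring as well, so \<open>of_int c * \<alpha>\<close> is
  available as notation for integer multiples of an exponent.\<close>

lemma lookup_of_int_mult [simp]:
  fixes \<alpha> :: expo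
  shows "Poly_Mapping.lookup (of_int c * \<alpha>) i = c * Poly_Mapping.lookup \<alpha> i"
proof (induction c rule: int_induct[where k = 0])
  case (step1 c) then show ?case by (simp add: algebra_simps lookup_add)
next
  case (step2 c) then show ?case by (simp add: algebra_simps lookup_minus)
qed simp

lemma poly_mapping_single_induct [case_names zero add]:
  fixes r :: "'a \<Rightarrow>\<^sub>0 int"
  assumes "P 0" "\<And>\<alpha> c r. P r \<Longrightarrow> P (Poly_Mapping.single \<alpha> c + r)"
  shows "P r"
proof (induction r rule: update_induct)
  case const then show ?case by (simp add: assms)
next
  case (update r a b)
  have "Poly_Mapping.update a b r = Poly_Mapping.single a b + r"
    using update(1) by (intro poly_mapping_eqI)
      (auto simp: lookup_update lookup_add lookup_single in_keys_iff)
  then show ?case using assms(2) update by simp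
qed

section \<open>Evaluation of Laurent polynomials\<close>

text \<open>Linear extension of a function on the basis. \<open>\<chi>\<close> may be arbitrary, so
  that functions multiplicative only modulo a prime are covered, and so are the weights of
  exponents.\<close>

definition lin :: "('a \<Rightarrow> 'b) \<Rightarrow> ('a \<Rightarrow>\<^sub>0 int) \<Rightarrow> 'b :: comm_ring_1" where
  "lin \<chi> r = (\<Sum>\<alpha>\<in>Poly_Mapping.keys r. of_int (Poly_Mapping.lookup r \<alpha>) * \<chi> \<alpha>)"

lemma lin_superset:
  "finite S \<Longrightarrow> Poly_Mapping.keys r \<subseteq> S \<Longrightarrow> lin \<chi> r = (\<Sum>\<alpha>\<in>S. of_int (Poly_Mapping.lookup r \<alpha>) * \<chi> \<alpha>)"
  unfolding lin_def by (rule sum.mono_neutral_left) (auto simp: in_keys_iff)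

lemma lin_add: "lin \<chi> (r + s) = lin \<chi> r + lin \<chi> s"
proof -
  let ?S = "Poly_Mapping.keys r \<union> Poly_Mapping.keys s"
  have "Poly_Mapping.keys (r + s) \<subseteq> ?S" by (rule keys_add)
  then show ?thesis
    using lin_superset[of ?S r \<chi>] lin_superset[of ?S s \<chi>] lin_superset[of ?S "r + s" \<chi>]
    by (simp add: lookup_add algebra_simps sum.distrib)
qed

lemma lin_zero [simp]: "lin \<chi> 0 = 0"
  by (simp add: lin_def)

lemma lin_single [simp]: "lin \<chi> (Poly_Mapping.single \<alpha> c) = of_int c * \<chi> \<alpha>"
  by (cases "c = 0") (simp_all add: lin_def)

lemma lin_one [simp]: "lin \<chi> 1 = \<chi> 0"
  by (metis lin_single mult_1 of_int_1 single_one)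

lemma lin_uminus: "lin \<chi> (- r) = - lin \<chi> r"
  by (metis add.right_inverse add_eq_0_iff lin_add lin_zero)

lemma lin_diff: "lin \<chi> (r - s) = lin \<chi> r - lin \<chi> s"
  by (metis add_uminus_conv_diff lin_add lin_uminus)

lemma lin_sum: "lin \<chi> (\<Sum>i\<in>S. f i) = (\<Sum>i\<in>S. lin \<chi> (f i))"
  by (induction S rule: infinite_finite_induct) (simp_all add: lin_add)

text \<open>Stated up to multiples of \<open>d\<close> because specialisation modulo a prime
  respects products only in this sense; \<open>d = 0\<close> gives the exact version. Bilinearity
  reduces the claim to monomials.\<close>

lemma lin_mult_dvd:
  assumes "\<And>\<alpha> \<beta>. d dvd \<chi> (\<alpha> + \<beta>) - \<chi> \<alpha> * \<chi> \<beta>"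
  shows "d dvd lin \<chi> (r * s) - lin \<chi> r * lin \<chi> s"
proof (induction r rule: poly_mapping_single_induct)
  case (add \<alpha> c r)
  have "d dvd lin \<chi> (Poly_Mapping.single \<alpha> c * s) - of_int c * \<chi> \<alpha> * lin \<chi> s"
  proof (induction s rule: poly_mapping_single_induct)
    case (add \<beta> c' s)
    have "lin \<chi> (Poly_Mapping.single \<alpha> c * (Poly_Mapping.single \<beta> c' + s))
        - of_int c * \<chi> \<alpha> * lin \<chi> (Poly_Mapping.single \<beta> c' + s)
        = of_int c * of_int c' * (\<chi> (\<alpha> + \<beta>) - \<chi> \<alpha> * \<chi> \<beta>)
          + (lin \<chi> (Poly_Mapping.single \<alpha> c * s) - of_int c * \<chi> \<alpha> * lin \<chi> s)"
      by (simp add: distrib_left lin_add mult_single algebra_simps)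
    then show ?case
      using add assms[of \<alpha> \<beta>] by (metis dvd_add dvd_mult)
  qed simp
  from dvd_add[OF this add] show ?case
    by (simp add: distrib_right lin_add algebra_simps)
qed simp

lemma lin_mult:
  assumes "\<And>\<alpha> \<beta>. \<chi> (\<alpha> + \<beta>) = \<chi> \<alpha> * \<chi> \<beta>"
  shows "lin \<chi> (r * s) = lin \<chi> r * lin \<chi> s"
  using lin_mult_dvd[of 0 \<chi> r s] assms by simp

text \<open>For additive \<open>\<beta>\<close> this is the induced endomorphism of the group ring;
  it is applied to the maps that endomorphisms of the group induce on the abelianisation.\<close>

definition push :: "(expo \<Rightarrow> expo) \<Rightarrow> laurent \<Rightarrow> laurent" where
  "push \<beta> = lin (\<lambda>\<alpha>. lmonom (\<beta> \<alpha>))"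

lemma push_single [simp]: "push \<beta> (Poly_Mapping.single \<alpha> c) = Poly_Mapping.single (\<beta> \<alpha>) c"
proof -
  have "of_int c * lmonom (\<beta> \<alpha>) = Poly_Mapping.single 0 c * lmonom (\<beta> \<alpha>)"
    by (simp flip: single_of_int)
  then show ?thesis by (simp add: push_def mult_single)
qed

lemma push_add: "push \<beta> (r + s) = push \<beta> r + push \<beta> s"
  and push_zero [simp]: "push \<beta> 0 = 0"
  and push_sum: "push \<beta> (\<Sum>i\<in>S. f i) = (\<Sum>i\<in>S. push \<beta> (f i))"
  by (simp_all add: push_def lin_add lin_sum)

lemma push_mult:
  assumes "\<And>\<alpha> \<gamma>. \<beta> (\<alpha> + \<gamma>) = \<beta> \<alpha> + \<beta> \<gamma>"
  shows "push \<beta> (r * s) = push \<beta> r * push \<beta> s"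
  unfolding push_def by (rule lin_mult) (simp add: assms mult_single)

lemma push_push: "push \<beta> (push \<gamma> r) = push (\<lambda>\<alpha>. \<beta> (\<gamma> \<alpha>)) r"
  by (induction r rule: poly_mapping_single_induct) (simp_all add: push_add)

lemma push_id [simp]: "push (\<lambda>\<alpha>. \<alpha>) r = r"
  by (induction r rule: poly_mapping_single_induct) (simp_all add: push_add)

lemma push_one:
  assumes "\<And>\<alpha> \<gamma>. \<beta> (\<alpha> + \<gamma>) = \<beta> \<alpha> + \<beta> \<gamma>"
  shows "push \<beta> 1 = 1"
proof -
  have "\<beta> 0 = 0" using assms[of 0 0] by simp
  then show ?thesis by (metis push_single single_one)
qed

section \<open>Crossed homomorphisms of free metabelian groups\<close>

text \<open>A homomorphism \<open>w \<mapsto> (L w, \<delta> w)\<close> into this group is a homomorphism \<open>L\<close>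
  together with a map \<open>\<delta>\<close> that is crossed over \<open>L\<close>, so the universal property of a free basis
  produces crossed homomorphisms with prescribed values.\<close>

definition magnus :: "(expo \<times> laurent) monoid" where
  "magnus = \<lparr>carrier = UNIV,
     monoid.mult = (\<lambda>(a, r) (b, s). (a + b, r + lmonom a * s)),
     one = (0, 0)\<rparr>"

lemma group_magnus: "group magnus"
proof (rule groupI)
  fix x :: "expo \<times> laurent"
  obtain a r where x: "x = (a, r)" by force
  show "\<exists>y\<in>carrier magnus. y \<otimes>\<^bsub>magnus\<^esub> x = \<one>\<^bsub>magnus\<^esub>"
    by (intro bexI[of _ "(- a, - (lmonom (- a) * r))"]) (simp_all add: magnus_def x)
qed (auto simp: magnus_def mult_single algebra_simps simp flip: mult.assoc)

lemma derived_least: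
  assumes "group G" "subgroup N G" "H \<subseteq> carrier G"
    and "\<And>a b. a \<in> H \<Longrightarrow> b \<in> H \<Longrightarrow> a \<otimes>\<^bsub>G\<^esub> b \<otimes>\<^bsub>G\<^esub> inv\<^bsub>G\<^esub> a \<otimes>\<^bsub>G\<^esub> inv\<^bsub>G\<^esub> b \<in> N"
  shows "derived G H \<subseteq> N"
  unfolding derived_def
  using assms by (intro group.generate_subgroup_incl) auto

text \<open>Commutators have exponent part zero, and on pairs with exponent part zero the product is
  addition of the second components, hence commutative.\<close>

lemma metabelian_magnus: "metabelian magnus"
proof -
  interpret group magnus by (rule group_magnus)
  have inv: "inv\<^bsub>magnus\<^esub> (a, r) = (- a, - (lmonom (- a) * r))" for a r
    by (rule inv_equality) (simp_all add: magnus_def)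
  let ?N = "{x. fst x = (0 :: expo)} :: (expo \<times> laurent) set"
  have N: "subgroup ?N magnus"
    by (rule subgroupI) (auto simp: inv, auto simp: magnus_def)
  have 1: "derived magnus (carrier magnus) \<subseteq> ?N"
    by (rule derived_least[OF group_magnus N]) (auto simp: inv, auto simp: magnus_def)
  have "derived magnus ?N \<subseteq> {\<one>\<^bsub>magnus\<^esub>}"
    by (rule derived_least[OF group_magnus triv_subgroup])
       (auto simp: inv, auto simp: magnus_def)
  with mono_derived[OF 1] have "derived magnus (derived magnus (carrier magnus)) \<subseteq> {\<one>\<^bsub>magnus\<^esub>}"
    by auto
  moreover have "\<one>\<^bsub>magnus\<^esub> \<in> derived magnus (derived magnus (carrier magnus))"
    unfolding derived_def by (rule generate.one)
  ultimately show ?thesis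
    by (auto simp: metabelian_def group_magnus)
qed

abbreviation crossed :: "nat \<Rightarrow> (letter list set \<Rightarrow> expo) \<Rightarrow> (letter list set \<Rightarrow> laurent) \<Rightarrow> bool" where
  "crossed n L \<delta> \<equiv> (\<lambda>w. (L w, \<delta> w)) \<in> hom (free_metabelian n) magnus"

lemma crossed_iff:
  "crossed n L \<delta> \<longleftrightarrow> (\<forall>u \<in> carrier (free_metabelian n). \<forall>v \<in> carrier (free_metabelian n).
     L (u \<otimes>\<^bsub>free_metabelian n\<^esub> v) = L u + L v \<and>
     \<delta> (u \<otimes>\<^bsub>free_metabelian n\<^esub> v) = \<delta> u + lmonom (L u) * \<delta> v)"
  by (auto simp: hom_def magnus_def)

lemma crossed_ext:
  assumes "crossed n L \<delta>" "crossed n L' \<delta>'" "free_basis n y"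
    and "\<And>i. i < n \<Longrightarrow> L (y i) = L' (y i) \<and> \<delta> (y i) = \<delta>' (y i)"
    and "w \<in> carrier (free_metabelian n)"
  shows "L w = L' w" "\<delta> w = \<delta>' w"
proof -
  have "(L w, \<delta> w) = (L' w, \<delta>' w)"
    by (rule hom_eq_on_generate[OF group_free_metabelian group_magnus assms(1,2),
          of "y ` {..<n}"])
       (use assms(3-5) in \<open>auto simp: free_basis_def\<close>)
  then show "L w = L' w" "\<delta> w = \<delta>' w" by simp_all
qed

lemma crossed_exists:
  assumes "free_basis n y"
  shows "\<exists>L \<delta>. crossed n L \<delta> \<and> (\<forall>i<n. L (y i) = a i \<and> \<delta> (y i) = r i)"
proof -
  have "(\<lambda>i. (a i, r i)) \<in> {..<n} \<rightarrow> carrier magnus"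
    by (simp add: magnus_def)
  from free_basis_extends[OF assms metabelian_magnus this]
  obtain f where f: "f \<in> hom (free_metabelian n) magnus" "\<forall>i<n. f (y i) = (a i, r i)"
    by blast
  then show ?thesis
    by (intro exI[of _ "fst \<circ> f"] exI[of _ "snd \<circ> f"]) simp
qed

section \<open>Abelianisation and Fox derivatives\<close>

definition ab :: "nat \<Rightarrow> letter list set \<Rightarrow> expo" where
  "ab n = (SOME L. crossed n L (\<lambda>_. 0) \<and> (\<forall>i<n. L (std_gen n i) = unit_expo i))"

text \<open>With zero as second component, \<open>crossed\<close> says only that \<open>L\<close> is
  additive, so the abelianisation comes from the same universal property as the Fox
  derivatives.\<close>

lemma ab_crossed: "crossed n (ab n) (\<lambda>_. 0)"
  and ab_std_gen [simp]: "i < n \<Longrightarrow> ab n (std_gen n i) = unit_expo i"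
proof -
  obtain L \<delta> where "crossed n L \<delta>" "\<forall>i<n. L (std_gen n i) = unit_expo i"
    using crossed_exists[OF free_basis_std_gen, of n unit_expo "\<lambda>_. 0"] by auto
  then have "\<exists>L. crossed n L (\<lambda>_. 0) \<and> (\<forall>i<n. L (std_gen n i) = unit_expo i)"
    by (intro exI[of _ L]) (simp add: crossed_iff)
  from someI_ex[OF this]
  show "crossed n (ab n) (\<lambda>_. 0)" "i < n \<Longrightarrow> ab n (std_gen n i) = unit_expo i"
    by (simp_all add: ab_def)
qed

lemma ab_mult [simp]:
  "u \<in> carrier (free_metabelian n) \<Longrightarrow> v \<in> carrier (free_metabelian n) \<Longrightarrow>
    ab n (u \<otimes>\<^bsub>free_metabelian n\<^esub> v) = ab n u + ab n v"
  using ab_crossed[of n] by (simp add: crossed_iff)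

text \<open>Any free basis is allowed here, so that values can be prescribed on a given primitive
  element and not only on the standard generators.\<close>

lemma crossed_ab_exists:
  assumes "free_basis n y"
  shows "\<exists>\<delta>. crossed n (ab n) \<delta> \<and> (\<forall>i<n. \<delta> (y i) = r i)"
proof -
  obtain L \<delta> where L: "crossed n L \<delta>" "\<forall>i<n. L (y i) = ab n (y i) \<and> \<delta> (y i) = r i"
    using crossed_exists[OF assms, of "\<lambda>i. ab n (y i)" r] by blast
  have L0: "crossed n L (\<lambda>_. 0)"
    using L(1) unfolding crossed_iff by simp
  have Lab: "L w = ab n w" if "w \<in> carrier (free_metabelian n)" for w
    by (rule crossed_ext(1)[OF L0 ab_crossed assms _ that]) (use L(2) in simp)
  have "crossed n (ab n) \<delta>"
    unfolding crossed_iff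
  proof (intro ballI conjI)
    fix u v
    assume "u \<in> carrier (free_metabelian n)" "v \<in> carrier (free_metabelian n)"
    then show "ab n (u \<otimes>\<^bsub>free_metabelian n\<^esub> v) = ab n u + ab n v"
      "\<delta> (u \<otimes>\<^bsub>free_metabelian n\<^esub> v) = \<delta> u + lmonom (ab n u) * \<delta> v"
      using L(1) Lab[of u] unfolding crossed_iff by auto
  qed
  with L(2) show ?thesis by blast
qed

definition fox :: "nat \<Rightarrow> nat \<Rightarrow> letter list set \<Rightarrow> laurent" where
  "fox n j = (SOME \<delta>. crossed n (ab n) \<delta> \<and> (\<forall>i<n. \<delta> (std_gen n i) = (if i = j then 1 else 0)))"

lemma fox_crossed: "crossed n (ab n) (fox n j)"
  and fox_std_gen [simp]: "i < n \<Longrightarrow> fox n j (std_gen n i) = (if i = j then 1 else 0)"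
  using someI_ex[OF crossed_ab_exists[OF free_basis_std_gen, of n "\<lambda>i. if i = j then 1 else 0"]]
  by (auto simp: fox_def)

lemma fox_mult:
  "u \<in> carrier (free_metabelian n) \<Longrightarrow> v \<in> carrier (free_metabelian n) \<Longrightarrow>
    fox n j (u \<otimes>\<^bsub>free_metabelian n\<^esub> v) = fox n j u + lmonom (ab n u) * fox n j v"
  using fox_crossed[of n j] by (simp add: crossed_iff)

text \<open>Both sides are crossed over \<open>L\<close> and agree on the standard generators. The
  identity as \<open>\<beta>\<close> expresses crossed maps through Fox derivatives; the
  abelianisation of an endomorphism as \<open>\<beta>\<close> gives the multiplication rule for
  Jacobians.\<close>

lemma fox_chain_rule:
  assumes \<beta>: "\<And>\<alpha> \<gamma>. \<beta> (\<alpha> + \<gamma>) = \<beta> \<alpha> + \<beta> \<gamma>"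
    and L: "\<And>w. w \<in> carrier (free_metabelian n) \<Longrightarrow> L w = \<beta> (ab n w)"
    and \<delta>: "crossed n L \<delta>" and w: "w \<in> carrier (free_metabelian n)"
  shows "\<delta> w = (\<Sum>k<n. push \<beta> (fox n k w) * \<delta> (std_gen n k))"
proof (rule crossed_ext(2)[OF \<delta> _ free_basis_std_gen _ w])
  show "crossed n L (\<lambda>w. \<Sum>k<n. push \<beta> (fox n k w) * \<delta> (std_gen n k))"
    unfolding crossed_iff
  proof (intro ballI conjI)
    fix u v
    assume uv: "u \<in> carrier (free_metabelian n)" "v \<in> carrier (free_metabelian n)"
    show Luv: "L (u \<otimes>\<^bsub>free_metabelian n\<^esub> v) = L u + L v"
      using \<delta> uv unfolding crossed_iff by blast
    have "push \<beta> (fox n k (u \<otimes>\<^bsub>free_metabelian n\<^esub> v))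
        = push \<beta> (fox n k u) + lmonom (L u) * push \<beta> (fox n k v)" for k
      using uv by (simp add: fox_mult push_add push_mult[OF \<beta>] L)
    then show "(\<Sum>k<n. push \<beta> (fox n k (u \<otimes>\<^bsub>free_metabelian n\<^esub> v)) * \<delta> (std_gen n k)) =
        (\<Sum>k<n. push \<beta> (fox n k u) * \<delta> (std_gen n k)) +
        lmonom (L u) * (\<Sum>k<n. push \<beta> (fox n k v) * \<delta> (std_gen n k))"
      by (simp add: distrib_right sum.distrib sum_distrib_left mult.assoc)
  qed
next
  fix i assume "i < n"
  then have "(\<Sum>k<n. push \<beta> (fox n k (std_gen n i)) * \<delta> (std_gen n k))
      = (\<Sum>k<n. if k = i then \<delta> (std_gen n k) else 0)"
    by (intro sum.cong) (auto simp: push_one[OF \<beta>])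
  then show "L (std_gen n i) = L (std_gen n i) \<and>
      \<delta> (std_gen n i) = (\<Sum>k<n. push \<beta> (fox n k (std_gen n i)) * \<delta> (std_gen n k))"
    using \<open>i < n\<close> by simp
qed

lemma fox_chain_rule_ab:
  assumes "crossed n (ab n) \<delta>" "w \<in> carrier (free_metabelian n)"
  shows "\<delta> w = (\<Sum>k<n. fox n k w * \<delta> (std_gen n k))"
  using fox_chain_rule[of "\<lambda>\<alpha>. \<alpha>" n "ab n" \<delta> w] assms by simp

text \<open>The map \<open>w \<mapsto> lmonom (ab n w) - 1\<close> is itself crossed, so the chain
  rule applies to it.\<close>

lemma fox_fundamental_formula:
  assumes "w \<in> carrier (free_metabelian n)"
  shows "(\<Sum>k<n. fox n k w * (lmonom (unit_expo k) - 1)) = lmonom (ab n w) - 1"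
proof -
  have "crossed n (ab n) (\<lambda>w. lmonom (ab n w) - 1)"
    by (simp add: crossed_iff mult_single algebra_simps)
  from fox_chain_rule_ab[OF this assms] show ?thesis by simp
qed

text \<open>Entries at positions from \<open>n\<close> on are dropped. Hence
  \<open>linear_ext n unit_expo\<close> is a truncation; it is the identity only on exponents
  supported below \<open>n\<close>, such as the values of \<open>ab n\<close>.\<close>

definition linear_ext :: "nat \<Rightarrow> (nat \<Rightarrow> expo) \<Rightarrow> expo \<Rightarrow> expo" where
  "linear_ext n b \<alpha> = (\<Sum>i<n. of_int (Poly_Mapping.lookup \<alpha> i) * b i)"

lemma linear_ext_add: "linear_ext n b (\<alpha> + \<gamma>) = linear_ext n b \<alpha> + linear_ext n b \<gamma>"
  by (simp add: linear_ext_def lookup_add algebra_simps sum.distrib)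

lemma linear_ext_unit [simp]: "i < n \<Longrightarrow> linear_ext n b (unit_expo i) = b i"
proof -
  assume "i < n"
  have "linear_ext n b (unit_expo i) = (\<Sum>k<n. if k = i then b k else 0)"
    unfolding linear_ext_def by (intro sum.cong) (auto simp: lookup_single)
  then show ?thesis using \<open>i < n\<close> by simp
qed

lemma ab_hom:
  assumes \<phi>: "\<phi> \<in> hom (free_metabelian n) (free_metabelian n)" and w: "w \<in> carrier (free_metabelian n)"
  shows "ab n (\<phi> w) = linear_ext n (\<lambda>i. ab n (\<phi> (std_gen n i))) (ab n w)"
proof -
  let ?b = "\<lambda>i. ab n (\<phi> (std_gen n i))"
  have 1: "crossed n (\<lambda>w. ab n (\<phi> w)) (\<lambda>_. 0)"
    using \<phi> by (auto simp: crossed_iff hom_mult hom_in_carrier)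
  have 2: "crossed n (\<lambda>w. linear_ext n ?b (ab n w)) (\<lambda>_. 0)"
    by (auto simp: crossed_iff linear_ext_add)
  show ?thesis
    by (rule crossed_ext(1)[OF 1 2 free_basis_std_gen]) (simp_all add: w)
qed

lemma fox_hom:
  assumes \<phi>: "\<phi> \<in> hom (free_metabelian n) (free_metabelian n)" and w: "w \<in> carrier (free_metabelian n)"
  shows "fox n j (\<phi> w) =
    (\<Sum>k<n. push (linear_ext n (\<lambda>i. ab n (\<phi> (std_gen n i)))) (fox n k w) * fox n j (\<phi> (std_gen n k)))"
proof (rule fox_chain_rule[where L = "\<lambda>w. ab n (\<phi> w)"])
  show "crossed n (\<lambda>w. ab n (\<phi> w)) (\<lambda>w. fox n j (\<phi> w))"
    using \<phi> by (auto simp: crossed_iff hom_mult hom_in_carrier fox_mult)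
qed (simp_all add: assms ab_hom linear_ext_add)

lemma free_basis_closed:
  assumes "free_basis n y" "i < n"
  shows "y i \<in> carrier (free_metabelian n)"
proof -
  have "y \<in> {..<n} \<rightarrow> carrier (free_metabelian n)"
    using assms(1) unfolding free_basis_def by (rule conjunct1)
  then show ?thesis using assms(2) by blast
qed

text \<open>Some crossed map takes the value 1 at a member of a free basis, and by the chain rule
  this value is a combination of the Fox derivatives.\<close>

lemma primitive_fox_unimodular:
  assumes "primitive n h"
  obtains r where "(\<Sum>j<n. fox n j h * r j) = 1"
proof -
  obtain z m where z: "free_basis n z" "m < n" "h = z m"
    using assms unfolding primitive_def by blast
  then have h: "h \<in> carrier (free_metabelian n)"
    using free_basis_closed[OF z(1,2)] by simp
  obtain \<delta> where \<delta>: "crossed n (ab n) \<delta>" "\<forall>i<n. \<delta> (z i) = 1"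
    using crossed_ab_exists[OF z(1), of "\<lambda>_. 1"] by blast
  have "(\<Sum>j<n. fox n j h * \<delta> (std_gen n j)) = 1"
    using fox_chain_rule_ab[OF \<delta>(1) h] \<delta>(2) z(2,3) by simp
  then show thesis by (rule that)
qed

section \<open>Elementary transformations of free bases\<close>

lemma free_basis_generates:
  "free_basis n y \<Longrightarrow> generate (free_metabelian n) (y ` {..<n}) = carrier (free_metabelian n)"
  unfolding free_basis_def by (elim conjE)

text \<open>The Nielsen move is invertible: the old member is recovered inside the generated
  subgroup, and undoing the move in the target group transfers the extension property.\<close>

lemma free_basis_transvection:
  fixes c :: int
  assumes y: "free_basis n y" and ij: "i < n" "j < n" "i \<noteq> j"
  shows "free_basis n (y(i := y i \<otimes>\<^bsub>free_metabelian n\<^esub> y j [^]\<^bsub>free_metabelian n\<^esub> c))"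
proof -
  let ?M = "free_metabelian n"
  define z where "z = y(i := y i \<otimes>\<^bsub>?M\<^esub> y j [^]\<^bsub>?M\<^esub> c)"
  interpret M: group ?M by (rule group_free_metabelian)
  have yM: "y k \<in> carrier ?M" if "k < n" for k
    using y that by (rule free_basis_closed)
  have zi: "z i = y i \<otimes>\<^bsub>?M\<^esub> y j [^]\<^bsub>?M\<^esub> c" and zk: "\<And>k. k \<noteq> i \<Longrightarrow> z k = y k"
    by (simp_all add: z_def)
  have zM: "z k \<in> carrier ?M" if "k < n" for k
    using yM[OF that] yM[OF ij(1)] yM[OF ij(2)] zi zk by (cases "k = i") simp_all
  have sub: "subgroup (generate ?M (z ` {..<n})) ?M"
    using zM by (intro M.generate_is_subgroup) auto
  have gen: "z k \<in> generate ?M (z ` {..<n})" if "k < n" for k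
    using that by (intro generate.incl) auto
  have "y k \<in> generate ?M (z ` {..<n})" if "k < n" for k
  proof (cases "k = i")
    case True
    have "y j \<in> generate ?M (z ` {..<n})"
      using gen[OF ij(2)] zk[of j] ij(3) by simp
    then have "z i \<otimes>\<^bsub>?M\<^esub> inv\<^bsub>?M\<^esub> (y j [^]\<^bsub>?M\<^esub> c) \<in> generate ?M (z ` {..<n})"
      by (intro subgroup.m_closed[OF sub] gen[OF ij(1)] subgroup.m_inv_closed[OF sub]
            M.subgroup_int_pow_closed[OF sub])
    then show ?thesis
      using True yM[OF ij(1)] yM[OF ij(2)] by (simp add: zi M.m_assoc)
  next
    case False
    then show ?thesis using gen[OF that] zk by simp
  qed
  then have "y ` {..<n} \<subseteq> generate ?M (z ` {..<n})"
    by blast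
  from M.generate_subgroup_incl[OF this sub] have "carrier ?M \<subseteq> generate ?M (z ` {..<n})"
    using free_basis_generates[OF y] by simp
  then have 1: "generate ?M (z ` {..<n}) = carrier ?M"
    using subgroup.subset[OF sub] by (rule equalityI[rotated])
  have 2: "\<exists>f\<in>hom ?M H. \<forall>k<n. f (z k) = h k"
    if H: "metabelian H" and h: "h \<in> {..<n} \<rightarrow> carrier H" for H :: "letter list set monoid" and h
  proof -
    interpret H: group H using H by (simp add: metabelian_def)
    have hH: "h k \<in> carrier H" if "k < n" for k
      using h that by auto
    \<comment> \<open>The values to prescribe on \<open>y\<close> so that the extension takes the
      values \<open>h\<close> on \<open>z\<close>.\<close>
    define h' where "h' = h(i := h i \<otimes>\<^bsub>H\<^esub> inv\<^bsub>H\<^esub> (h j [^]\<^bsub>H\<^esub> c))"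
    have h'i: "h' i = h i \<otimes>\<^bsub>H\<^esub> inv\<^bsub>H\<^esub> (h j [^]\<^bsub>H\<^esub> c)" and h'k: "\<And>k. k \<noteq> i \<Longrightarrow> h' k = h k"
      by (simp_all add: h'_def)
    have "h' k \<in> carrier H" if "k < n" for k
      using hH[OF that] hH[OF ij(1)] hH[OF ij(2)] h'i h'k by (cases "k = i") simp_all
    then have "h' \<in> {..<n} \<rightarrow> carrier H"
      by blast
    from free_basis_extends[OF y H this]
    obtain f where f: "f \<in> hom ?M H" "\<forall>k<n. f (y k) = h' k"
      by blast
    interpret f: group_hom ?M H f
      by (intro group_hom.intro group_hom_axioms.intro M.is_group H.is_group f)
    have "f (z i) = h' i \<otimes>\<^bsub>H\<^esub> h j [^]\<^bsub>H\<^esub> c"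
      using yM[OF ij(1)] yM[OF ij(2)] ij f(2) h'k by (simp add: zi f.hom_int_pow)
    also have "\<dots> = h i"
      using hH[OF ij(1)] hH[OF ij(2)] by (simp add: h'i H.m_assoc)
    finally have "f (z k) = h k" if "k < n" for k
      using f(2) that zk h'k by (cases "k = i") simp_all
    with f(1) show ?thesis by blast
  qed
  have 3: "z \<in> {..<n} \<rightarrow> carrier ?M"
    using zM by blast
  have "free_basis n z"
    unfolding free_basis_def
    by (intro conjI allI impI ballI 1 3 2)
  then show ?thesis
    by (simp only: z_def)
qed

text \<open>Euclid's algorithm in the form of a minimality argument: in a free basis with least sum
  of absolute values of \<open>\<omega>\<close>, two nonzero values would allow a transvection that
  decreases the sum.\<close>

lemma adapted_free_basis_exists:
  fixes \<omega> :: "letter list set \<Rightarrow> int"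
  assumes \<omega>: "\<And>a b. a \<in> carrier (free_metabelian n) \<Longrightarrow> b \<in> carrier (free_metabelian n) \<Longrightarrow>
      \<omega> (a \<otimes>\<^bsub>free_metabelian n\<^esub> b) = \<omega> a + \<omega> b"
  shows "\<exists>y l. free_basis n y \<and> (\<forall>i<n. i \<noteq> l \<longrightarrow> \<omega> (y i) = 0)"
proof -
  let ?M = "free_metabelian n"
  interpret M: group ?M by (rule group_free_metabelian)
  define m where "m y = (\<Sum>i<n. nat \<bar>\<omega> (y i)\<bar>)" for y
  obtain y where y: "free_basis n y" and min: "\<And>z. free_basis n z \<Longrightarrow> m y \<le> m z"
    using ex_has_least_nat[of "free_basis n", OF free_basis_std_gen, of m] by (elim exE conjE) simp
  have pow: "\<omega> (a [^]\<^bsub>?M\<^esub> c) = c * \<omega> a" if a: "a \<in> carrier ?M" and c: "c = 1 \<or> c = -1" for a and c :: int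
  proof -
    have "\<omega> \<one>\<^bsub>?M\<^esub> = 0"
      using \<omega>[OF M.one_closed M.one_closed] by simp
    then have "\<omega> (inv\<^bsub>?M\<^esub> a) = - \<omega> a"
      using \<omega>[OF a M.inv_closed[OF a]] M.r_inv[OF a] by simp
    then show ?thesis
      using c a by (auto simp: M.int_pow_neg M.int_pow_1)
  qed
  have less: False if ij: "i < n" "j < n" "i \<noteq> j" "\<omega> (y j) \<noteq> 0" "\<bar>\<omega> (y j)\<bar> \<le> \<bar>\<omega> (y i)\<bar>" for i j
  proof -
    \<comment> \<open>The sign for which adding \<open>c * \<omega> (y j)\<close> moves
      \<open>\<omega> (y i)\<close> towards zero. As \<open>\<omega> (y j)\<close> is nonzero and
      not larger in absolute value, the decrease is strict.\<close>
    define c where "c = - (sgn (\<omega> (y i)) * sgn (\<omega> (y j)))"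
    have c: "c = 1 \<or> c = -1"
      using ij(4,5) by (auto simp: c_def sgn_if)
    define z where "z = y(i := y i \<otimes>\<^bsub>?M\<^esub> y j [^]\<^bsub>?M\<^esub> c)"
    have "free_basis n z"
      unfolding z_def by (rule free_basis_transvection[OF y ij(1-3)])
    moreover have "m z < m y"
      unfolding m_def
    proof (rule sum_strict_mono_ex1)
      have yi: "y i \<in> carrier ?M" and yj: "y j \<in> carrier ?M"
        using free_basis_closed[OF y] ij by blast+
      have "\<omega> (z i) = \<omega> (y i) + c * \<omega> (y j)"
        using yi yj pow[OF yj c] by (simp add: z_def \<omega>)
      then have less': "nat \<bar>\<omega> (z i)\<bar> < nat \<bar>\<omega> (y i)\<bar>"
        using ij(4,5) by (auto simp: c_def sgn_if split: if_splits)
      then show "\<exists>k\<in>{..<n}. nat \<bar>\<omega> (z k)\<bar> < nat \<bar>\<omega> (y k)\<bar>"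
        using ij(1) by blast
      have "nat \<bar>\<omega> (z k)\<bar> \<le> nat \<bar>\<omega> (y k)\<bar>" for k
        using less' by (cases "k = i") (auto simp: z_def)
      then show "\<forall>k\<in>{..<n}. nat \<bar>\<omega> (z k)\<bar> \<le> nat \<bar>\<omega> (y k)\<bar>"
        by blast
    qed simp
    ultimately show False
      using min[of z] by simp
  qed
  have *: "i = j" if "i < n" "j < n" "\<omega> (y i) \<noteq> 0" "\<omega> (y j) \<noteq> 0" for i j
  proof (rule ccontr)
    assume "i \<noteq> j"
    then have "\<not> \<bar>\<omega> (y j)\<bar> \<le> \<bar>\<omega> (y i)\<bar>" "\<not> \<bar>\<omega> (y i)\<bar> \<le> \<bar>\<omega> (y j)\<bar>"
      using less[of i j] less[of j i] that by blast+
    then show False by linarith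
  qed
  \<comment> \<open>If every value vanishes, \<open>l\<close> is arbitrary and may lie outside the
    index range, which does no harm to the claim.\<close>
  define l where "l = (SOME l. l < n \<and> \<omega> (y l) \<noteq> 0)"
  have "\<omega> (y i) = 0" if "i < n" "i \<noteq> l" for i
  proof (rule ccontr)
    assume "\<omega> (y i) \<noteq> 0"
    then have "l < n \<and> \<omega> (y l) \<noteq> 0"
      using someI[of "\<lambda>l. l < n \<and> \<omega> (y l) \<noteq> 0" i] that(1) unfolding l_def by blast
    with *[of i l] \<open>\<omega> (y i) \<noteq> 0\<close> that show False by simp
  qed
  then have "\<forall>i<n. i \<noteq> l \<longrightarrow> \<omega> (y i) = 0"
    by (intro allI impI)
  with y show ?thesis by (intro exI[of _ y] exI[of _ l] conjI)
qed

text \<open>Transvections multiply \<open>y k\<close> by powers of the members in \<open>S\<close>.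
  All elements involved act trivially modulo \<open>p\<close>, so \<open>E\<close> turns the product
  into a sum: this realises a linear combination of Fox rows by a member of a free basis.\<close>

lemma free_basis_product:
  fixes \<chi> :: "letter list set \<Rightarrow> int" and E :: "nat \<Rightarrow> letter list set \<Rightarrow> int" and u :: "nat \<Rightarrow> nat"
  assumes \<chi>: "\<And>a b. a \<in> carrier (free_metabelian n) \<Longrightarrow> b \<in> carrier (free_metabelian n) \<Longrightarrow>
      [\<chi> (a \<otimes>\<^bsub>free_metabelian n\<^esub> b) = \<chi> a * \<chi> b] (mod p)"
    and E: "\<And>j a b. a \<in> carrier (free_metabelian n) \<Longrightarrow> b \<in> carrier (free_metabelian n) \<Longrightarrow>
      [E j (a \<otimes>\<^bsub>free_metabelian n\<^esub> b) = E j a + \<chi> a * E j b] (mod p)"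
    and y: "free_basis n y" and k: "k < n" and S: "finite S" "S \<subseteq> {..<n} - {k}"
    and \<chi>y: "\<And>i. i \<in> insert k S \<Longrightarrow> [\<chi> (y i) = 1] (mod p)"
  shows "\<exists>z. free_basis n z \<and> (\<forall>i. i \<noteq> k \<longrightarrow> z i = y i) \<and> [\<chi> (z k) = 1] (mod p) \<and>
    (\<forall>j. [E j (z k) = E j (y k) + (\<Sum>i\<in>S. int (u i) * E j (y i))] (mod p))"
  using S \<chi>y
proof (induction S rule: finite_induct)
  case empty
  have "[\<chi> (y k) = 1] (mod p)"
    by (rule empty.prems(2)) simp
  then show ?case
    by (intro exI[of _ y] conjI allI impI y) simp_all
next
  case (insert s S)
  let ?M = "free_metabelian n"
  interpret M: group ?M by (rule group_free_metabelian)
  have S': "S \<subseteq> {..<n} - {k}"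
    using insert.prems(1) by simp
  have \<chi>S: "[\<chi> (y i) = 1] (mod p)" if "i \<in> insert k S" for i
    by (rule insert.prems(2)) (use that in auto)
  have "\<exists>z. free_basis n z \<and> (\<forall>i. i \<noteq> k \<longrightarrow> z i = y i) \<and> [\<chi> (z k) = 1] (mod p) \<and>
      (\<forall>j. [E j (z k) = E j (y k) + (\<Sum>i\<in>S. int (u i) * E j (y i))] (mod p))"
    by (rule insert.IH[OF S']) (rule \<chi>S)
  then obtain z where z: "free_basis n z \<and> (\<forall>i. i \<noteq> k \<longrightarrow> z i = y i) \<and> [\<chi> (z k) = 1] (mod p) \<and>
      (\<forall>j. [E j (z k) = E j (y k) + (\<Sum>i\<in>S. int (u i) * E j (y i))] (mod p))"
    by (rule exE)
  have z1: "free_basis n z" and z3: "[\<chi> (z k) = 1] (mod p)"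
    using z by simp_all
  have z2: "z i = y i" if "i \<noteq> k" for i
    using z that by blast
  have z4: "[E j (z k) = E j (y k) + (\<Sum>i\<in>S. int (u i) * E j (y i))] (mod p)" for j
    using z by blast
  have s: "s < n" "s \<noteq> k"
    using insert.prems(1) by auto
  have zk: "z k \<in> carrier ?M" and ys: "y s \<in> carrier ?M"
    using free_basis_closed[OF z1 k] free_basis_closed[OF y s(1)] by simp_all
  have \<chi>s: "[\<chi> (y s) = 1] (mod p)"
    using insert.prems(2) by simp
  \<comment> \<open>Multiplicativity alone would admit the value 0 at the identity; the basis
    element \<open>y s\<close> with value 1 excludes it.\<close>
  have \<chi>1: "[\<chi> \<one>\<^bsub>?M\<^esub> = 1] (mod p)"
  proof -
    have "[\<chi> (y s) * \<chi> \<one>\<^bsub>?M\<^esub> = \<chi> (y s)] (mod p)"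
      using cong_sym[OF \<chi>[OF ys M.one_closed]] ys by simp
    moreover have "[\<chi> (y s) * \<chi> \<one>\<^bsub>?M\<^esub> = 1 * \<chi> \<one>\<^bsub>?M\<^esub>] (mod p)"
      using \<chi>s by (rule cong_mult) simp
    ultimately have "[1 * \<chi> \<one>\<^bsub>?M\<^esub> = \<chi> (y s)] (mod p)"
      using cong_sym cong_trans by blast
    from cong_trans[OF this \<chi>s] show ?thesis by simp
  qed
  have E1: "[E j \<one>\<^bsub>?M\<^esub> = 0] (mod p)" for j
  proof -
    have "[E j \<one>\<^bsub>?M\<^esub> = E j \<one>\<^bsub>?M\<^esub> + \<chi> \<one>\<^bsub>?M\<^esub> * E j \<one>\<^bsub>?M\<^esub>] (mod p)"
      using E[OF M.one_closed M.one_closed, of j] by simp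
    also have "[E j \<one>\<^bsub>?M\<^esub> + \<chi> \<one>\<^bsub>?M\<^esub> * E j \<one>\<^bsub>?M\<^esub> = E j \<one>\<^bsub>?M\<^esub> + 1 * E j \<one>\<^bsub>?M\<^esub>] (mod p)"
      by (intro cong_add cong_mult \<chi>1 cong_refl)
    finally show ?thesis
      by (simp add: cong_iff_dvd_diff)
  qed
  have pow: "[\<chi> (y s [^]\<^bsub>?M\<^esub> m) = 1] (mod p) \<and> (\<forall>j. [E j (y s [^]\<^bsub>?M\<^esub> m) = int m * E j (y s)] (mod p))"
    for m :: nat
  proof (induction m)
    case 0
    then show ?case using \<chi>1 E1 by simp
  next
    case (Suc m)
    have ym: "y s [^]\<^bsub>?M\<^esub> m \<in> carrier ?M" using ys by simp
    have "[\<chi> (y s [^]\<^bsub>?M\<^esub> Suc m) = \<chi> (y s [^]\<^bsub>?M\<^esub> m) * \<chi> (y s)] (mod p)"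
      using \<chi>[OF ym ys] by simp
    also have "[\<chi> (y s [^]\<^bsub>?M\<^esub> m) * \<chi> (y s) = 1 * 1] (mod p)"
      using Suc \<chi>s by (intro cong_mult) auto
    finally have 1: "[\<chi> (y s [^]\<^bsub>?M\<^esub> Suc m) = 1] (mod p)" by simp
    have "[E j (y s [^]\<^bsub>?M\<^esub> Suc m) = int (Suc m) * E j (y s)] (mod p)" for j
    proof -
      have "[E j (y s [^]\<^bsub>?M\<^esub> Suc m) = E j (y s [^]\<^bsub>?M\<^esub> m) + \<chi> (y s [^]\<^bsub>?M\<^esub> m) * E j (y s)] (mod p)"
        using E[OF ym ys, of j] by simp
      also have "[E j (y s [^]\<^bsub>?M\<^esub> m) + \<chi> (y s [^]\<^bsub>?M\<^esub> m) * E j (y s) = int m * E j (y s) + 1 * E j (y s)] (mod p)"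
        using Suc by (intro cong_add cong_mult) auto
      finally show ?thesis by (simp add: algebra_simps)
    qed
    with 1 show ?case by blast
  qed
  let ?w = "y s [^]\<^bsub>?M\<^esub> u s"
  have w: "?w \<in> carrier ?M" using ys by simp
  define z' where "z' = z(k := z k \<otimes>\<^bsub>?M\<^esub> z s [^]\<^bsub>?M\<^esub> int (u s))"
  have z'k: "z' k = z k \<otimes>\<^bsub>?M\<^esub> ?w"
    using s z2 by (simp add: z'_def int_pow_int)
  have f1: "free_basis n z'"
    unfolding z'_def using s k by (intro free_basis_transvection z1) simp_all
  have f2: "\<forall>i. i \<noteq> k \<longrightarrow> z' i = y i"
    using z2 by (simp add: z'_def)
  have f3: "[\<chi> (z' k) = 1] (mod p)"
  proof -
    have "[\<chi> (z' k) = \<chi> (z k) * \<chi> ?w] (mod p)"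
      using \<chi>[OF zk w] by (simp add: z'k)
    also have "[\<chi> (z k) * \<chi> ?w = 1 * 1] (mod p)"
      using pow by (intro cong_mult z3) blast
    finally show ?thesis by simp
  qed
  have "[E j (z' k) = E j (y k) + (\<Sum>i\<in>insert s S. int (u i) * E j (y i))] (mod p)" for j
  proof -
    have "[E j (z' k) = E j (z k) + \<chi> (z k) * E j ?w] (mod p)"
      using E[OF zk w, of j] by (simp add: z'k)
    also have "[E j (z k) + \<chi> (z k) * E j ?w =
        (E j (y k) + (\<Sum>i\<in>S. int (u i) * E j (y i))) + 1 * (int (u s) * E j (y s))] (mod p)"
      using pow by (intro cong_add cong_mult z3 z4) blast
    finally show ?thesis
      using insert.hyps by (simp add: algebra_simps)
  qed
  then have f4: "\<forall>j. [E j (z' k) = E j (y k) + (\<Sum>i\<in>insert s S. int (u i) * E j (y i))] (mod p)"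
    by (intro allI)
  show ?case
    by (intro exI[of _ z'] conjI f1 f2 f3 f4)
qed

section \<open>Specialisation modulo a prime\<close>

text \<open>Since \<open>N\<close> is invertible modulo \<open>p\<close>, its powers have period \<open>p - 1\<close>;
  reducing the exponent gives negative powers a meaning without leaving the integers.\<close>

definition int_character :: "nat \<Rightarrow> nat \<Rightarrow> int \<Rightarrow> int" where
  "int_character p N e = int N ^ nat (e mod int (p - 1))"

lemma power_cong_nonneg:
  fixes p N :: nat
  assumes "Factorial_Ring.prime p" "\<not> p dvd N" "0 \<le> e"
  shows "[int_character p N e = int N ^ nat e] (mod int p)"
proof -
  let ?q = "nat e div (p - 1)" and ?r = "nat e mod (p - 1)"
  have "[N ^ (p - 1) = 1] (mod p)"
    using assms(1,2) by (rule fermat_theorem)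
  then have "[(N ^ (p - 1)) ^ ?q * N ^ ?r = 1 ^ ?q * N ^ ?r] (mod p)"
    by (intro cong_mult cong_pow cong_refl)
  moreover have "(N ^ (p - 1)) ^ ?q * N ^ ?r = N ^ nat e"
    by (simp flip: power_mult power_add)
  ultimately have "[N ^ nat e = N ^ ?r] (mod p)" by simp
  then have "[int (N ^ nat e) = int (N ^ ?r)] (mod int p)"
    by (simp only: cong_int_iff)
  moreover have "nat (e mod int (p - 1)) = ?r"
    using assms(3) by (simp add: nat_mod_distrib)
  ultimately show ?thesis
    by (simp add: int_character_def cong_sym)
qed

lemma int_character_add:
  fixes p N :: nat
  assumes "Factorial_Ring.prime p" "\<not> p dvd N"
  shows "[int_character p N (e + e') = int_character p N e * int_character p N e'] (mod int p)"
proof -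
  let ?a = "e mod int (p - 1)" and ?b = "e' mod int (p - 1)"
  have pos: "0 < int (p - 1)" using prime_gt_1_nat[OF assms(1)] by simp
  have a: "0 \<le> ?a" and b: "0 \<le> ?b" using pos by simp_all
  have "int_character p N (e + e') = int_character p N (?a + ?b)"
    by (simp add: int_character_def mod_add_eq)
  also have "[int_character p N (?a + ?b) = int N ^ nat (?a + ?b)] (mod int p)"
    using a b by (intro power_cong_nonneg assms) simp
  also have "int N ^ nat (?a + ?b) = int_character p N e * int_character p N e'"
    using a b by (simp add: int_character_def nat_add_distrib power_add)
  finally show ?thesis .
qed

lemma int_character_zero [simp]: "int_character p N 0 = 1"
  by (simp add: int_character_def)

text \<open>The monomial with exponent \<open>\<alpha>\<close> is specialised to \<open>N\<close> to the power
  \<open>\<Sum>i. \<alpha> i * B ^ i\<close>.\<close>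

definition weight :: "int \<Rightarrow> expo \<Rightarrow> int" where
  "weight B = lin (\<lambda>i. B ^ i)"

lemma weight_add [simp]: "weight B (\<alpha> + \<beta>) = weight B \<alpha> + weight B \<beta>"
  by (simp add: weight_def lin_add)

lemma weight_zero [simp]: "weight B 0 = 0"
  by (simp add: weight_def)

definition spec :: "nat \<Rightarrow> nat \<Rightarrow> int \<Rightarrow> laurent \<Rightarrow> int" where
  "spec p N B = lin (\<lambda>\<alpha>. int_character p N (weight B \<alpha>))"

lemma spec_simps [simp]:
  "spec p N B 0 = 0" "spec p N B 1 = 1"
  "spec p N B (r + s) = spec p N B r + spec p N B s"
  "spec p N B (r - s) = spec p N B r - spec p N B s"
  "spec p N B (Poly_Mapping.single \<alpha> c) = c * int_character p N (weight B \<alpha>)"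
  by (simp_all add: spec_def lin_add lin_diff)

lemma spec_sum: "spec p N B (\<Sum>i\<in>S. f i) = (\<Sum>i\<in>S. spec p N B (f i))"
  by (simp add: spec_def lin_sum)

lemma spec_mult:
  assumes "Factorial_Ring.prime p" "\<not> p dvd N"
  shows "[spec p N B (r * s) = spec p N B r * spec p N B s] (mod int p)"
  unfolding spec_def cong_iff_dvd_diff
  by (rule lin_mult_dvd) (use int_character_add[OF assms] in \<open>simp add: cong_iff_dvd_diff\<close>)

section \<open>Constants, kernel vectors and determinants modulo \<open>p\<close>\<close>

lemma laurent_of_int: "of_int c = (Poly_Mapping.single 0 c :: laurent)"
  by (metis single_of_int of_int_eq_id id_apply)

lemma spec_of_int [simp]: "spec p N B (of_int c) = c"
  by (simp add: laurent_of_int del: single_of_int)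

text \<open>Row vectors of residues form a finite set. If multiplication by the matrix is not
  injective on it, the difference of two vectors with the same image is a kernel vector; otherwise
  it is surjective, and preimages of the unit vectors form a left inverse.\<close>

lemma int_matrix_mod_cases:
  fixes a :: "nat \<Rightarrow> nat \<Rightarrow> int"
  assumes "0 < p"
  obtains (singular) v where "\<exists>i<n. \<not> p dvd v i" "\<And>j. j < n \<Longrightarrow> p dvd (\<Sum>i<n. v i * a i j)"
  | (invertible) c where "\<And>k j. k < n \<Longrightarrow> j < n \<Longrightarrow> [(\<Sum>i<n. c k i * a i j) = (if k = j then 1 else 0)] (mod p)"
proof -
  let ?S = "{..<n} \<rightarrow>\<^sub>E {0..<p}"
  define T where "T u = restrict (\<lambda>j. (\<Sum>i<n. u i * a i j) mod p) {..<n}" for u :: "nat \<Rightarrow> int"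
  have fin: "finite ?S" by (rule finite_PiE) simp_all
  have TS: "T ` ?S \<subseteq> ?S"
    unfolding T_def using assms by (intro image_subsetI restrict_PiE_iff[THEN iffD2]) simp
  show thesis
  proof (cases "inj_on T ?S")
    case False
    then obtain u u' where u: "u \<in> ?S" "u' \<in> ?S" "T u = T u'" "u \<noteq> u'"
      unfolding inj_on_def by blast
    obtain i where i: "i < n" "u i \<noteq> u' i"
      using PiE_ext[OF u(1,2)] u(4) by blast
    have "u i \<in> {0..<p}" "u' i \<in> {0..<p}"
      using PiE_mem[OF u(1)] PiE_mem[OF u(2)] i(1) by simp_all
    then have "\<not> p dvd u i - u' i"
      using i(2) by (simp add: mod_eq_dvd_iff[symmetric])
    then have 1: "\<exists>i<n. \<not> p dvd u i - u' i"
      using i(1) by blast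
    have 2: "p dvd (\<Sum>i<n. (u i - u' i) * a i j)" if "j < n" for j
    proof -
      have "T u j = T u' j" using u(3) by simp
      then have "(\<Sum>i<n. u i * a i j) mod p = (\<Sum>i<n. u' i * a i j) mod p"
        using that by (simp add: T_def)
      then show ?thesis
        by (simp add: mod_eq_dvd_iff sum_subtractf left_diff_distrib)
    qed
    show thesis by (rule singular[OF 1 2])
  next
    case True
    have surj: "T ` ?S = ?S" by (rule endo_inj_surj[OF fin TS True])
    have "\<exists>u. \<forall>j<n. [(\<Sum>i<n. u i * a i j) = (if k = j then 1 else 0)] (mod p)" for k
    proof -
      have "restrict (\<lambda>j. (if k = j then 1 else 0) mod p) {..<n} \<in> ?S"
        using assms by (intro restrict_PiE_iff[THEN iffD2]) simp
      then obtain u where u: "T u = restrict (\<lambda>j. (if k = j then 1 else 0) mod p) {..<n}"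
        using surj by (metis (no_types, lifting) imageE)
      have "(\<Sum>i<n. u i * a i j) mod p = (if k = j then 1 else 0) mod p" if "j < n" for j
        using fun_cong[OF u, of j] that by (simp add: T_def)
      then show ?thesis unfolding cong_def by blast
    qed
    then have "\<forall>k. \<exists>u. \<forall>j<n. [(\<Sum>i<n. u i * a i j) = (if k = j then 1 else 0)] (mod p)"
      by (rule allI)
    then obtain c where c: "\<forall>k. \<forall>j<n. [(\<Sum>i<n. c k i * a i j) = (if k = j then 1 else 0)] (mod p)"
      by (rule choice[THEN exE])
    show thesis by (rule invertible[of c]) (use c in blast)
  qed
qed

lemma spec_prod:
  assumes "Factorial_Ring.prime p" "\<not> p dvd N"
  shows "[spec p N B (\<Prod>i\<in>S. f i) = (\<Prod>i\<in>S. spec p N B (f i))] (mod int p)"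
proof (induction S rule: infinite_finite_induct)
  case (insert x S)
  have "[spec p N B (f x * prod f S) = spec p N B (f x) * spec p N B (prod f S)] (mod int p)"
    by (rule spec_mult[OF assms])
  also have "[spec p N B (f x) * spec p N B (prod f S) = spec p N B (f x) * (\<Prod>i\<in>S. spec p N B (f i))] (mod int p)"
    by (intro cong_mult insert.IH cong_refl)
  finally show ?case using insert.hyps by simp
qed simp_all

text \<open>Since \<open>spec\<close> is a ring homomorphism only up to congruence, the Leibniz
  expansion is compared term by term. The signs are integer constants, which \<open>spec\<close>
  fixes.\<close>

lemma spec_det:
  assumes pN: "Factorial_Ring.prime p" "\<not> p dvd N" and A: "A \<in> carrier_mat n n"
    and E: "\<And>i j. i < n \<Longrightarrow> j < n \<Longrightarrow> [spec p N B (A $$ (i, j)) = e i j] (mod int p)"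
  shows "[spec p N B (det A) = det (mat n n (\<lambda>(i, j). e i j))] (mod int p)"
proof -
  let ?P = "{\<pi>. \<pi> permutes {0..<n}}"
  have 1: "spec p N B (det A) = (\<Sum>\<pi>\<in>?P. spec p N B (signof \<pi> * (\<Prod>i = 0..<n. A $$ (i, \<pi> i))))"
    by (simp only: det_def'[OF A] spec_sum)
  have 2: "det (mat n n (\<lambda>(i, j). e i j)) = (\<Sum>\<pi>\<in>?P. signof \<pi> * (\<Prod>i = 0..<n. mat n n (\<lambda>(i, j). e i j) $$ (i, \<pi> i)))"
    by (rule det_def') simp
  have "[spec p N B (signof \<pi> * (\<Prod>i = 0..<n. A $$ (i, \<pi> i))) =
      signof \<pi> * (\<Prod>i = 0..<n. mat n n (\<lambda>(i, j). e i j) $$ (i, \<pi> i))] (mod int p)" if "\<pi> \<in> ?P" for \<pi>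
  proof -
    have \<pi>: "\<pi> i < n" if "i < n" for i
      using \<open>\<pi> \<in> ?P\<close> that permutes_in_image[of \<pi> "{0..<n}" i] by simp
    have "[spec p N B (\<Prod>i = 0..<n. A $$ (i, \<pi> i)) = (\<Prod>i = 0..<n. spec p N B (A $$ (i, \<pi> i)))] (mod int p)"
      by (rule spec_prod[OF pN])
    also have "[(\<Prod>i = 0..<n. spec p N B (A $$ (i, \<pi> i))) =
        (\<Prod>i = 0..<n. mat n n (\<lambda>(i, j). e i j) $$ (i, \<pi> i))] (mod int p)"
      by (rule cong_prod) (simp add: E \<pi>)
    finally have *: "[spec p N B (\<Prod>i = 0..<n. A $$ (i, \<pi> i)) =
        (\<Prod>i = 0..<n. mat n n (\<lambda>(i, j). e i j) $$ (i, \<pi> i))] (mod int p)" .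
    have "signof \<pi> = (of_int (signof \<pi>) :: laurent)"
      by (simp add: sign_def)
    then have "[spec p N B (signof \<pi> * (\<Prod>i = 0..<n. A $$ (i, \<pi> i))) =
        signof \<pi> * spec p N B (\<Prod>i = 0..<n. A $$ (i, \<pi> i))] (mod int p)"
      using spec_mult[OF pN, of B "of_int (signof \<pi>)" "\<Prod>i = 0..<n. A $$ (i, \<pi> i)"] by simp
    also have "[signof \<pi> * spec p N B (\<Prod>i = 0..<n. A $$ (i, \<pi> i)) =
        signof \<pi> * (\<Prod>i = 0..<n. mat n n (\<lambda>(i, j). e i j) $$ (i, \<pi> i))] (mod int p)"
      by (intro cong_mult * cong_refl)
    finally show ?thesis .
  qed
  then show ?thesis
    unfolding 1 2 by (rule cong_sum)
qed

section \<open>The Jacobian of a primitivity preserving endomorphism\<close>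

abbreviation jacobian :: "nat \<Rightarrow> (letter list set \<Rightarrow> letter list set) \<Rightarrow> laurent mat" where
  "jacobian n \<phi> \<equiv> mat n n (\<lambda>(i, j). fox n j (\<phi> (std_gen n i)))"

lemma spec_det_jacobian_nonzero:
  assumes \<phi>: "\<phi> \<in> hom (free_metabelian n) (free_metabelian n)"
    and prim: "\<And>g. primitive n g \<Longrightarrow> primitive n (\<phi> g)"
    and pN: "Factorial_Ring.prime p" "\<not> p dvd N"
  shows "\<not> int p dvd spec p N B (det (jacobian n \<phi>))"
proof
  assume dvd: "int p dvd spec p N B (det (jacobian n \<phi>))"
  let ?M = "free_metabelian n"
  let ?b = "linear_ext n (\<lambda>i. ab n (\<phi> (std_gen n i)))"
  have p: "Factorial_Ring.prime (int p)" "int p > 0"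
    using pN(1) prime_gt_0_nat[OF pN(1)] by simp_all
  have \<phi>M: "\<phi> w \<in> carrier ?M" if "w \<in> carrier ?M" for w
    using hom_in_carrier[OF \<phi> that] .
  \<comment> \<open>\<open>\<chi>\<close> records how \<open>w\<close> acts through
    \<open>\<phi>\<close> after specialisation, and \<open>E\<close> is the specialised Fox row of
    \<open>\<phi> w\<close>. Modulo \<open>p\<close>, \<open>E j\<close> is crossed over
    \<open>\<chi>\<close>.\<close>
  define \<omega> where "\<omega> w = weight B (ab n (\<phi> w))" for w
  define \<chi> where "\<chi> w = int_character p N (\<omega> w)" for w
  define E where "E j w = spec p N B (fox n j (\<phi> w))" for j w
  have \<omega>: "\<omega> (a \<otimes>\<^bsub>?M\<^esub> b) = \<omega> a + \<omega> b" if "a \<in> carrier ?M" "b \<in> carrier ?M" for a b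
    using that \<phi>M by (simp add: \<omega>_def hom_mult[OF \<phi>])
  have \<chi>: "[\<chi> (a \<otimes>\<^bsub>?M\<^esub> b) = \<chi> a * \<chi> b] (mod int p)" if "a \<in> carrier ?M" "b \<in> carrier ?M" for a b
    unfolding \<chi>_def \<omega>[OF that] by (rule int_character_add[OF pN])
  have E: "[E j (a \<otimes>\<^bsub>?M\<^esub> b) = E j a + \<chi> a * E j b] (mod int p)"
    if ab: "a \<in> carrier ?M" "b \<in> carrier ?M" for j a b
  proof -
    have "E j (a \<otimes>\<^bsub>?M\<^esub> b) = E j a + spec p N B (lmonom (ab n (\<phi> a)) * fox n j (\<phi> b))"
      unfolding E_def hom_mult[OF \<phi> ab] fox_mult[OF \<phi>M[OF ab(1)] \<phi>M[OF ab(2)]] by simp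
    moreover have "[spec p N B (lmonom (ab n (\<phi> a)) * fox n j (\<phi> b)) =
        spec p N B (lmonom (ab n (\<phi> a))) * E j b] (mod int p)"
      unfolding E_def by (rule spec_mult[OF pN])
    moreover have "spec p N B (lmonom (ab n (\<phi> a))) = \<chi> a"
      by (simp add: \<chi>_def \<omega>_def)
    ultimately show ?thesis
      by (simp add: cong_add)
  qed
  have "\<exists>y l. free_basis n y \<and> (\<forall>i<n. i \<noteq> l \<longrightarrow> \<omega> (y i) = 0)"
    by (rule adapted_free_basis_exists) (rule \<omega>)
  then obtain y l where y: "free_basis n y" and \<omega>y': "\<forall>i<n. i \<noteq> l \<longrightarrow> \<omega> (y i) = 0"
    by (elim exE conjE)
  have \<omega>y: "\<omega> (y i) = 0" if "i < n" "i \<noteq> l" for i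
    using \<omega>y' that by blast
  have yM: "y i \<in> carrier ?M" if "i < n" for i
    by (rule free_basis_closed[OF y that])
  define a where "a i j = E j (y i)" for i j
  define J where "J = mat n n (\<lambda>(i, j). fox n j (\<phi> (y i)))"
  define P where "P = mat n n (\<lambda>(i, k). push ?b (fox n k (y i)))"
  have J: "J \<in> carrier_mat n n" and P: "P \<in> carrier_mat n n"
    by (simp_all add: J_def P_def)
  \<comment> \<open>The adapted basis replaces the standard generators by a factor \<open>P\<close>
    on the left, so the vanishing of the specialised determinant passes on to
    \<open>J\<close>.\<close>
  have "J = P * jacobian n \<phi>"
  proof (rule eq_matI)
    fix i j assume "i < dim_row (P * jacobian n \<phi>)" "j < dim_col (P * jacobian n \<phi>)"
    then have ij: "i < n" "j < n" by (simp_all add: P_def)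
    have "(P * jacobian n \<phi>) $$ (i, j) = (\<Sum>k = 0..<n. P $$ (i, k) * jacobian n \<phi> $$ (k, j))"
      using ij P by (simp add: scalar_prod_def)
    also have "\<dots> = (\<Sum>k<n. push ?b (fox n k (y i)) * fox n j (\<phi> (std_gen n k)))"
      using ij by (intro sum.cong) (auto simp: P_def)
    finally show "J $$ (i, j) = (P * jacobian n \<phi>) $$ (i, j)"
      using ij by (simp add: J_def fox_hom[OF \<phi> yM[OF ij(1)]])
  qed (simp_all add: J_def P_def)
  then have "det J = det P * det (jacobian n \<phi>)"
    using det_mult[OF P, of "jacobian n \<phi>"] by simp
  then have dvdJ: "int p dvd spec p N B (det J)"
    using spec_mult[OF pN, of B "det P" "det (jacobian n \<phi>)"] dvd cong_dvd_iff by fastforce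
  show False
    using p(2)
  proof (cases rule: int_matrix_mod_cases[where n = n and a = a])
    case (invertible c)
    \<comment> \<open>an inverse modulo \<open>p\<close>, lifted to constants, makes \<open>det C * det J\<close> specialise to \<open>1\<close>\<close>
    define C :: "laurent mat" where "C = mat n n (\<lambda>(k, i). of_int (c k i))"
    have C: "C \<in> carrier_mat n n" by (simp add: C_def)
    have "[spec p N B ((C * J) $$ (k, j)) = (if k = j then 1 else 0)] (mod int p)" if kj: "k < n" "j < n" for k j
    proof -
      have "(C * J) $$ (k, j) = (\<Sum>i = 0..<n. C $$ (k, i) * J $$ (i, j))"
        using kj C J by (simp add: scalar_prod_def)
      also have "\<dots> = (\<Sum>i<n. of_int (c k i) * fox n j (\<phi> (y i)))"
        using kj by (intro sum.cong) (auto simp: C_def J_def)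
      finally have "spec p N B ((C * J) $$ (k, j)) = (\<Sum>i<n. spec p N B (of_int (c k i) * fox n j (\<phi> (y i))))"
        by (simp only: spec_sum)
      also have "[(\<Sum>i<n. spec p N B (of_int (c k i) * fox n j (\<phi> (y i)))) = (\<Sum>i<n. c k i * a i j)] (mod int p)"
      proof (rule cong_sum)
        fix i
        show "[spec p N B (of_int (c k i) * fox n j (\<phi> (y i))) = c k i * a i j] (mod int p)"
          using spec_mult[OF pN, of B "of_int (c k i)" "fox n j (\<phi> (y i))"]
          by (simp only: spec_of_int a_def E_def)
      qed
      also have "[(\<Sum>i<n. c k i * a i j) = (if k = j then 1 else 0)] (mod int p)"
        by (rule invertible[OF kj])
      finally show ?thesis .
    qed
    from spec_det[OF pN _ this]
    have "[spec p N B (det (C * J)) = det (mat n n (\<lambda>(k, j). if k = j then 1 else 0))] (mod int p)"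
      using C J by simp
    also have "mat n n (\<lambda>(k, j). if k = j then 1 else 0) = (1\<^sub>m n :: int mat)"
      by (rule eq_matI) simp_all
    finally have 1: "[spec p N B (det (C * J)) = 1] (mod int p)" by simp
    have "[spec p N B (det (C * J)) = spec p N B (det C) * spec p N B (det J)] (mod int p)"
      unfolding det_mult[OF C J] by (rule spec_mult[OF pN])
    then have "int p dvd spec p N B (det (C * J))"
      using dvdJ cong_dvd_iff by fastforce
    then have "int p dvd 1"
      using 1 cong_dvd_iff by blast
    then show False using p(1) not_prime_unit by blast
  next
    case (singular v)
    \<comment> \<open>the fundamental formula kills the coefficient of a basis element that acts nontrivially\<close>
    have \<chi>y: "[\<chi> (y i) = 1] (mod int p)" if i: "i < n" "\<not> int p dvd v i" for i
    proof (cases "i = l")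
      case False
      then show ?thesis using \<omega>y[OF i(1)] by (simp add: \<chi>_def)
    next
      case True
      have fund: "[(\<Sum>j<n. a m j * (int_character p N (weight B (unit_expo j)) - 1)) = \<chi> (y m) - 1] (mod int p)"
        if "m < n" for m
      proof -
        have "[(\<Sum>j<n. a m j * (int_character p N (weight B (unit_expo j)) - 1)) =
            (\<Sum>j<n. spec p N B (fox n j (\<phi> (y m)) * (lmonom (unit_expo j) - 1)))] (mod int p)"
        proof (rule cong_sum)
          fix j
          show "[a m j * (int_character p N (weight B (unit_expo j)) - 1) =
              spec p N B (fox n j (\<phi> (y m)) * (lmonom (unit_expo j) - 1))] (mod int p)"
            using cong_sym[OF spec_mult[OF pN, of B "fox n j (\<phi> (y m))" "lmonom (unit_expo j) - 1"]]
            by (simp add: a_def E_def)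
        qed
        also have "(\<Sum>j<n. spec p N B (fox n j (\<phi> (y m)) * (lmonom (unit_expo j) - 1))) = \<chi> (y m) - 1"
          unfolding spec_sum[symmetric] fox_fundamental_formula[OF \<phi>M[OF yM[OF that]]]
          by (simp add: \<chi>_def \<omega>_def)
        finally show ?thesis .
      qed
      let ?t = "\<lambda>j. int_character p N (weight B (unit_expo j)) - 1"
      have 1: "[(\<Sum>m<n. v m * (\<Sum>j<n. a m j * ?t j)) = (\<Sum>m<n. v m * (\<chi> (y m) - 1))] (mod int p)"
        by (intro cong_sum cong_mult cong_refl fund) simp
      have 2: "(\<Sum>m<n. v m * (\<Sum>j<n. a m j * ?t j)) = (\<Sum>j<n. (\<Sum>m<n. v m * a m j) * ?t j)"
        unfolding sum_distrib_left sum_distrib_right by (subst sum.swap) (simp add: mult.assoc)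
      have 3: "int p dvd (\<Sum>j<n. (\<Sum>m<n. v m * a m j) * ?t j)"
        by (rule dvd_sum) (use singular(2) in \<open>simp add: dvd_mult2\<close>)
      \<comment> \<open>Pairing the fundamental formulas with the kernel vector \<open>v\<close>
        makes their left sides vanish modulo \<open>p\<close>. On the right only the term with index
        \<open>l\<close> survives, so \<open>p\<close> divides
        \<open>v l * (\<chi> (y l) - 1)\<close>.\<close>
      have "int p dvd (\<Sum>m<n. v m * (\<chi> (y m) - 1))"
        using cong_dvd_iff[OF 1] 3 unfolding 2 by blast
      also have "(\<Sum>m<n. v m * (\<chi> (y m) - 1)) = (\<Sum>m<n. if m = l then v l * (\<chi> (y l) - 1) else 0)"
        by (rule sum.cong) (simp_all add: \<chi>_def \<omega>y)
      also have "\<dots> = v i * (\<chi> (y i) - 1)"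
        using i(1) True by simp
      finally show ?thesis
        using i(2) prime_dvd_mult_iff[OF p(1)] by (simp add: cong_iff_dvd_diff)
    qed
    obtain k where k: "k < n" "\<not> int p dvd v k" using singular(1) by blast
    have "coprime (v k) (int p)"
      using prime_imp_coprime[OF p(1) k(2)] by (simp add: coprime_commute)
    \<comment> \<open>Scaling by \<open>w\<close> turns the coefficient at \<open>k\<close> into 1,
      as it must be for \<open>y k\<close> to be changed by transvections only.\<close>
    then obtain w where w: "[v k * w = 1] (mod int p)"
      using cong_solve_coprime_int by blast
    define u where "u i = nat ((v i * w) mod int p)" for i
    have u: "[int (u i) = v i * w] (mod int p)" for i
      using p(2) by (simp add: u_def cong_def)
    \<comment> \<open>Indices with coefficient divisible by \<open>p\<close> are left out:
      triviality of \<open>\<chi>\<close> has been shown only for the others, and the omitted terms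
      are zero modulo \<open>p\<close>.\<close>
    let ?S = "{i. i < n \<and> i \<noteq> k \<and> \<not> int p dvd v i}"
    have "\<exists>z. free_basis n z \<and> (\<forall>i. i \<noteq> k \<longrightarrow> z i = y i) \<and> [\<chi> (z k) = 1] (mod int p) \<and>
      (\<forall>j. [E j (z k) = E j (y k) + (\<Sum>i\<in>?S. int (u i) * E j (y i))] (mod int p))"
      by (rule free_basis_product[of n \<chi> "int p" E, OF \<chi> E y k(1)]) (use \<chi>y k in auto)
    then obtain z where z: "free_basis n z"
      and Ez: "\<forall>j. [E j (z k) = E j (y k) + (\<Sum>i\<in>?S. int (u i) * E j (y i))] (mod int p)"
      by (elim exE conjE)
    have E0: "int p dvd E j (z k)" if j: "j < n" for j
    proof -
      have "[E j (z k) = E j (y k) + (\<Sum>i\<in>?S. int (u i) * E j (y i))] (mod int p)"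
        using Ez by (rule spec)
      also have "[E j (y k) + (\<Sum>i\<in>?S. int (u i) * E j (y i)) =
          (v k * w) * a k j + (\<Sum>i\<in>?S. (v i * w) * a i j)] (mod int p)"
      proof (rule cong_add)
        show "[E j (y k) = (v k * w) * a k j] (mod int p)"
          using cong_mult[OF cong_sym[OF w] cong_refl[of "a k j" "int p"]] by (simp add: a_def)
        show "[(\<Sum>i\<in>?S. int (u i) * E j (y i)) = (\<Sum>i\<in>?S. (v i * w) * a i j)] (mod int p)"
          unfolding a_def by (intro cong_sum cong_mult u cong_refl)
      qed
      also have "(v k * w) * a k j + (\<Sum>i\<in>?S. (v i * w) * a i j) = (\<Sum>i\<in>insert k ?S. (v i * w) * a i j)"
        by (subst sum.insert) simp_all
      also have "[(\<Sum>i\<in>insert k ?S. (v i * w) * a i j) = (\<Sum>i<n. (v i * w) * a i j)] (mod int p)"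
      proof -
        have "{..<n} = insert k ?S \<union> {i. i < n \<and> int p dvd v i}"
          using k(1) by auto
        then have "(\<Sum>i<n. (v i * w) * a i j) =
            (\<Sum>i\<in>insert k ?S. (v i * w) * a i j) + (\<Sum>i\<in>{i. i < n \<and> int p dvd v i}. (v i * w) * a i j)"
          using k(2) by (simp only:) (rule sum.union_disjoint, auto)
        moreover have "int p dvd (\<Sum>i\<in>{i. i < n \<and> int p dvd v i}. (v i * w) * a i j)"
          by (rule dvd_sum) simp
        ultimately show ?thesis
          by (simp add: cong_iff_dvd_diff)
      qed
      also have "(\<Sum>i<n. (v i * w) * a i j) = w * (\<Sum>i<n. v i * a i j)"
        by (simp add: sum_distrib_left algebra_simps)
      finally show ?thesis
        using singular(2)[OF j] cong_dvd_iff by fastforce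
    qed
    have "primitive n (z k)"
      unfolding primitive_def using z k(1) by (intro exI[of _ z]) simp
    from primitive_fox_unimodular[OF prim[OF this]]
    obtain r where r: "(\<Sum>j<n. fox n j (\<phi> (z k)) * r j) = 1" .
    have "1 = (\<Sum>j<n. spec p N B (fox n j (\<phi> (z k)) * r j))"
      unfolding spec_sum[symmetric] r by simp
    also have "[(\<Sum>j<n. spec p N B (fox n j (\<phi> (z k)) * r j)) = (\<Sum>j<n. E j (z k) * spec p N B (r j))] (mod int p)"
      unfolding E_def by (intro cong_sum spec_mult[OF pN])
    finally have "[1 = (\<Sum>j<n. E j (z k) * spec p N B (r j))] (mod int p)" .
    moreover have "int p dvd (\<Sum>j<n. E j (z k) * spec p N B (r j))"
      by (rule dvd_sum) (use E0 in \<open>simp add: dvd_mult2\<close>)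
    ultimately have "int p dvd 1"
      using cong_dvd_iff by blast
    then show False using p(1) not_prime_unit by blast
  qed
qed

section \<open>Laurent polynomials without zeros modulo primes\<close>

text \<open>\<open>weight B \<alpha>\<close> is the value at \<open>B\<close> of the polynomial
  whose coefficients are the entries of \<open>\<alpha>\<close>. The differences of these
  polynomials for the pairs in \<open>S\<close> have finitely many roots in total, and any other
  integer serves as \<open>B\<close>.\<close>

lemma weight_separates:
  assumes "finite S"
  obtains B where "inj_on (weight B) S"
proof -
  define P :: "expo \<Rightarrow> int poly" where
    "P \<alpha> = (\<Sum>i\<in>Poly_Mapping.keys \<alpha>. Polynomial.monom (Poly_Mapping.lookup \<alpha> i) i)" for \<alpha>
  have P_poly: "poly (P \<alpha>) B = weight B \<alpha>" for \<alpha> B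
    by (simp add: P_def weight_def lin_def poly_sum poly_monom)
  have P_coeff: "coeff (P \<alpha>) i = Poly_Mapping.lookup \<alpha> i" for \<alpha> i
  proof -
    have "coeff (P \<alpha>) i = (\<Sum>k\<in>Poly_Mapping.keys \<alpha>. if k = i then Poly_Mapping.lookup \<alpha> i else 0)"
      unfolding P_def coeff_sum by (intro sum.cong) simp_all
    then show ?thesis by (simp add: in_keys_iff)
  qed
  have P_inj: "P \<alpha> - P \<beta> \<noteq> 0" if "\<alpha> \<noteq> \<beta>" for \<alpha> \<beta>
  proof
    assume "P \<alpha> - P \<beta> = 0"
    then have "coeff (P \<alpha>) i = coeff (P \<beta>) i" for i by simp
    then have "\<alpha> = \<beta>" unfolding P_coeff by (rule poly_mapping_eqI)
    with that show False by simp
  qed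
  let ?U = "\<Union>(\<alpha>, \<beta>)\<in>{(\<alpha>, \<beta>). \<alpha> \<in> S \<and> \<beta> \<in> S \<and> \<alpha> \<noteq> \<beta>}. {B. poly (P \<alpha> - P \<beta>) B = 0}"
  have "finite {(\<alpha>, \<beta>). \<alpha> \<in> S \<and> \<beta> \<in> S \<and> \<alpha> \<noteq> \<beta>}"
    by (rule finite_subset[of _ "S \<times> S"]) (use assms in auto)
  then have "finite ?U"
  proof (rule finite_UN_I)
    fix x assume "x \<in> {(\<alpha>, \<beta>). \<alpha> \<in> S \<and> \<beta> \<in> S \<and> \<alpha> \<noteq> \<beta>}"
    then obtain \<alpha> \<beta> where x: "x = (\<alpha>, \<beta>)" "\<alpha> \<noteq> \<beta>" by blast
    show "finite (case x of (\<alpha>, \<beta>) \<Rightarrow> {B. poly (P \<alpha> - P \<beta>) B = 0})"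
      unfolding x(1) prod.case by (rule poly_roots_finite[OF P_inj[OF x(2)]])
  qed
  then obtain B where B: "B \<notin> ?U"
    using ex_new_if_finite[OF infinite_UNIV_int] by blast
  have "inj_on (weight B) S"
  proof (rule inj_onI, rule ccontr)
    fix \<alpha> \<beta> assume "\<alpha> \<in> S" "\<beta> \<in> S" "weight B \<alpha> = weight B \<beta>" "\<alpha> \<noteq> \<beta>"
    then have "B \<in> ?U" by (auto simp: P_poly)
    with B show False by blast
  qed
  then show thesis by (rule that)
qed

lemma int_prime_factor:
  fixes q :: int
  assumes "q \<noteq> 0" "\<bar>q\<bar> \<noteq> 1"
  obtains p :: nat where "Factorial_Ring.prime p" "int p dvd q"
proof -
  have "nat \<bar>q\<bar> \<noteq> 1" using assms(2) by simp
  from prime_factor_nat[OF this]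
  obtain p where p: "Factorial_Ring.prime p" "p dvd nat \<bar>q\<bar>" by blast
  then have "int p dvd q" by (simp add: int_dvd_int_iff[symmetric])
  with p(1) show thesis by (rule that)
qed

text \<open>A relative of Euclid's proof that there are infinitely many primes. The argument
  \<open>N\<close> has to be prime to \<open>p\<close> so that negative powers of \<open>N\<close>
  make sense modulo \<open>p\<close>.\<close>

lemma poly_prime_divisor_coprime_argument:
  fixes g :: "int poly"
  assumes deg: "degree g > 0" and c: "coeff g 0 \<noteq> 0"
  obtains p N :: nat where "Factorial_Ring.prime p" "\<not> p dvd N" "int p dvd poly g (int N)"
proof -
  define c where "c = coeff g 0"
  obtain g' where g: "g = pCons c g'"
    by (cases g) (simp add: c_def)
  have c0: "c \<noteq> 0" using c by (simp add: c_def)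
  \<comment> \<open>Avoiding the roots of the three factors keeps \<open>g\<close> away from the
    values \<open>0\<close>, \<open>c\<close> and \<open>- c\<close>, that is, the cofactor
    \<open>q\<close> below away from 0, 1 and -1, so that \<open>q\<close> has a prime
    divisor.\<close>
  define h where "h = g * (g + [:- c:]) * (g + [:c:])"
  have nz: "g + [:d:] \<noteq> 0" for d
  proof
    assume "g + [:d:] = 0"
    then have "g = - [:d:]" by (rule eq_neg_iff_add_eq_0[THEN iffD2])
    then have "degree g = degree (- [:d:])" by (rule arg_cong)
    with deg show False by simp
  qed
  have "h \<noteq> 0"
    using nz[of 0] nz[of "- c"] nz[of c] unfolding h_def by simp
  then have fin: "finite {x. poly h x = 0}" by (rule poly_roots_finite)
  \<comment> \<open>at a multiple of \<open>c\<^sup>2\<close> the value is \<open>c * q\<close> with \<open>q\<close> prime to the argument\<close>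
  have inf: "infinite (range (\<lambda>y :: nat. c * (c * (1 + int y))))"
    by (rule range_inj_infinite) (use c0 in \<open>auto simp: inj_on_def\<close>)
  have "\<not> range (\<lambda>y :: nat. c * (c * (1 + int y))) \<subseteq> {x. poly h x = 0}"
    using inf finite_subset[OF _ fin] by (rule contrapos_nn)
  then obtain y :: nat where "poly h (c * (c * (1 + int y))) \<noteq> 0"
    by blast
  then obtain x where x: "x = c * (c * (1 + int y))" and hx: "poly h x \<noteq> 0"
    by blast
  define q where "q = 1 + c * (1 + int y) * poly g' x"
  have gx: "poly g x = c * q"
    by (simp add: g q_def x algebra_simps)
  have "q \<noteq> 0" "\<bar>q\<bar> \<noteq> 1"
    using hx gx by (auto simp: h_def abs_if split: if_splits)
  then obtain p :: nat where p: "Factorial_Ring.prime p" "int p dvd q"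
    by (rule int_prime_factor)
  have np: "\<not> int p dvd c * (1 + int y)"
  proof
    assume "int p dvd c * (1 + int y)"
    then have "int p dvd c * (1 + int y) * poly g' x" by (rule dvd_mult2)
    then have "int p dvd 1" using p(2) unfolding q_def by (metis dvd_add_left_iff)
    then show False using p(1) by (simp add: prime_nat_iff)
  qed
  \<comment> \<open>The factor \<open>c\<close> occurs twice in \<open>x\<close>, which makes
    \<open>x\<close> nonnegative.\<close>
  have xN: "int (nat x) = x"
    by (simp add: x flip: mult.assoc)
  have pp: "Factorial_Ring.prime (int p)" using p(1) by simp
  have "\<not> int p dvd x"
    unfolding x using np prime_dvd_mult_iff[OF pp] by (meson dvd_mult2)
  then have "\<not> p dvd nat x"
    using xN int_dvd_int_iff[of p "nat x"] by simp
  moreover have "int p dvd poly g (int (nat x))"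
    unfolding xN gx using p(2) by simp
  ultimately show thesis using p(1) by (intro that)
qed

text \<open>Dividing by the power of \<open>N\<close> with exponent \<open>m\<close> clears the
  negative exponents and leaves the value of an ordinary polynomial.\<close>

lemma spec_conv_poly:
  assumes pN: "Factorial_Ring.prime p" "\<not> p dvd N"
    and m: "\<And>\<alpha>. \<alpha> \<in> Poly_Mapping.keys f \<Longrightarrow> m \<le> weight B \<alpha>"
  shows "[spec p N B f = int_character p N m *
    poly (\<Sum>\<alpha>\<in>Poly_Mapping.keys f. Polynomial.monom (Poly_Mapping.lookup f \<alpha>) (nat (weight B \<alpha> - m))) (int N)] (mod int p)"
proof -
  have "[int_character p N (weight B \<alpha>) = int_character p N m * int N ^ nat (weight B \<alpha> - m)] (mod int p)"
    if "\<alpha> \<in> Poly_Mapping.keys f" for \<alpha>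
  proof -
    have "[int_character p N (m + (weight B \<alpha> - m)) =
        int_character p N m * int_character p N (weight B \<alpha> - m)] (mod int p)"
      by (rule int_character_add[OF pN])
    also have "[int_character p N m * int_character p N (weight B \<alpha> - m) =
        int_character p N m * int N ^ nat (weight B \<alpha> - m)] (mod int p)"
      using m[OF that] by (intro cong_mult power_cong_nonneg[OF pN] cong_refl) simp
    finally show ?thesis by simp
  qed
  then have "[(\<Sum>\<alpha>\<in>Poly_Mapping.keys f. of_int (Poly_Mapping.lookup f \<alpha>) * int_character p N (weight B \<alpha>)) =
      (\<Sum>\<alpha>\<in>Poly_Mapping.keys f. of_int (Poly_Mapping.lookup f \<alpha>) * (int_character p N m * int N ^ nat (weight B \<alpha> - m)))] (mod int p)"
    by (intro cong_sum cong_mult cong_refl)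
  then show ?thesis
    by (simp add: spec_def lin_def poly_sum poly_monom sum_distrib_left algebra_simps)
qed

text \<open>With \<open>B\<close> separating the exponents and \<open>m\<close> the least weight,
  the polynomial \<open>g\<close> has the same coefficients as \<open>f\<close> and a nonzero
  constant term. If it were not constant, it would have a zero modulo some \<open>p\<close> at an
  admissible argument; if it is constant, a prime divisor of the coefficient would give one.\<close>

lemma laurent_monomial_if_spec_nonzero:
  assumes spec: "\<And>p N B. Factorial_Ring.prime p \<Longrightarrow> \<not> p dvd N \<Longrightarrow> \<not> int p dvd spec p N B f"
  obtains \<alpha> c where "f = Poly_Mapping.single \<alpha> c" "\<bar>c\<bar> = 1"
proof -
  have "f \<noteq> 0"
    using spec[of 2 1 0] by auto
  then have ne: "Poly_Mapping.keys f \<noteq> {}" by simp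
  obtain B where B: "inj_on (weight B) (Poly_Mapping.keys f)"
    by (rule weight_separates[OF finite_keys])
  define m where "m = Min (weight B ` Poly_Mapping.keys f)"
  have m: "m \<le> weight B \<alpha>" if "\<alpha> \<in> Poly_Mapping.keys f" for \<alpha>
    unfolding m_def using that by (intro Min_le) auto
  have "m \<in> weight B ` Poly_Mapping.keys f"
    unfolding m_def using ne by (intro Min_in) auto
  then obtain \<alpha>0 where \<alpha>0: "\<alpha>0 \<in> Poly_Mapping.keys f" "weight B \<alpha>0 = m" by blast
  define e where "e \<alpha> = nat (weight B \<alpha> - m)" for \<alpha>
  have e_inj: "\<alpha> = \<beta>" if "e \<alpha> = e \<beta>" "\<alpha> \<in> Poly_Mapping.keys f" "\<beta> \<in> Poly_Mapping.keys f" for \<alpha> \<beta>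
  proof -
    have "weight B \<alpha> = weight B \<beta>"
      using that(1) m[OF that(2)] m[OF that(3)] unfolding e_def by linarith
    then show ?thesis using B that(2,3) by (simp add: inj_on_eq_iff)
  qed
  define g where "g = (\<Sum>\<alpha>\<in>Poly_Mapping.keys f. Polynomial.monom (Poly_Mapping.lookup f \<alpha>) (e \<alpha>))"
  have g_coeff: "coeff g (e \<beta>) = Poly_Mapping.lookup f \<beta>" if "\<beta> \<in> Poly_Mapping.keys f" for \<beta>
  proof -
    have "coeff g (e \<beta>) = (\<Sum>\<alpha>\<in>Poly_Mapping.keys f. if \<alpha> = \<beta> then Poly_Mapping.lookup f \<beta> else 0)"
      unfolding g_def coeff_sum using e_inj[OF _ _ that] by (intro sum.cong) auto
    then show ?thesis using that by simp
  qed
  have g_spec: "\<not> int p dvd poly g (int N)" if pN: "Factorial_Ring.prime p" "\<not> p dvd N" for p N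
  proof
    assume "int p dvd poly g (int N)"
    then have "int p dvd int_character p N m * poly g (int N)" by (rule dvd_mult)
    then have "int p dvd spec p N B f"
      using cong_dvd_iff[OF spec_conv_poly[OF pN m]] unfolding g_def e_def by blast
    with spec[OF pN] show False by blast
  qed
  have "e \<alpha>0 = 0" by (simp add: e_def \<alpha>0)
  then have g0: "coeff g 0 = Poly_Mapping.lookup f \<alpha>0" "coeff g 0 \<noteq> 0"
    using g_coeff[OF \<alpha>0(1)] \<alpha>0(1) by (simp_all add: in_keys_iff)
  have deg: "degree g = 0"
  proof (rule ccontr)
    assume "degree g \<noteq> 0"
    then have "degree g > 0" by simp
    from poly_prime_divisor_coprime_argument[OF this g0(2)] g_spec show False by metis
  qed
  have "\<alpha> = \<alpha>0" if "\<alpha> \<in> Poly_Mapping.keys f" for \<alpha>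
  proof -
    have "coeff g (e \<alpha>) \<noteq> 0" using g_coeff[OF that] that by (simp add: in_keys_iff)
    then have "e \<alpha> = 0" using deg le_degree by fastforce
    then show ?thesis using e_inj that \<alpha>0(1) \<open>e \<alpha>0 = 0\<close> by simp
  qed
  then have f: "f = Poly_Mapping.single \<alpha>0 (Poly_Mapping.lookup f \<alpha>0)"
    by (intro poly_mapping_eqI) (auto simp: lookup_single in_keys_iff when_def)
  have "\<bar>Poly_Mapping.lookup f \<alpha>0\<bar> = 1"
  proof (rule ccontr)
    assume "\<bar>Poly_Mapping.lookup f \<alpha>0\<bar> \<noteq> 1"
    then obtain p where p: "Factorial_Ring.prime p" "int p dvd Poly_Mapping.lookup f \<alpha>0"
      using g0 int_prime_factor by metis
    obtain a where a: "g = [:a:]"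
      by (rule degree_eq_zeroE[OF deg])
    \<comment> \<open>A constant \<open>g\<close> has the same value everywhere, so the argument 1,
      prime to every \<open>p\<close>, will do.\<close>
    have "int p dvd poly g (int 1)"
      using p(2) unfolding g0(1)[symmetric] a by simp
    moreover have "\<not> p dvd 1" using p(1) by (simp add: prime_nat_iff)
    ultimately show False using g_spec[OF p(1)] by blast
  qed
  with f show thesis by (rule that)
qed

section \<open>From a unit determinant to an invertible Jacobian\<close>

definition jacobian_invertible :: "nat \<Rightarrow> (letter list set \<Rightarrow> letter list set) \<Rightarrow> bool" where
  "jacobian_invertible n \<phi> \<longleftrightarrow> (\<exists>C \<in> carrier_mat n n. C * jacobian n \<phi> = 1\<^sub>m n \<and> jacobian n \<phi> * C = 1\<^sub>m n)"

lemma mat_invertible_if_det_unit: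
  fixes A :: "'a :: comm_ring_1 mat"
  assumes A: "A \<in> carrier_mat n n" and d: "d * det A = 1"
  shows "\<exists>C \<in> carrier_mat n n. C * A = 1\<^sub>m n \<and> A * C = 1\<^sub>m n"
proof (intro bexI[of _ "d \<cdot>\<^sub>m adj_mat A"] conjI)
  note adj = adj_mat[OF A]
  have 1: "d \<cdot>\<^sub>m (det A \<cdot>\<^sub>m 1\<^sub>m n) = (1\<^sub>m n :: 'a mat)"
    by (rule eq_matI) (use d in \<open>auto simp: mult.assoc[symmetric]\<close>)
  show "d \<cdot>\<^sub>m adj_mat A * A = 1\<^sub>m n"
    using mult_smult_assoc_mat[OF adj(1) A, of d] adj(3) 1 by simp
  show "A * (d \<cdot>\<^sub>m adj_mat A) = 1\<^sub>m n"
    using mult_smult_distrib[OF A adj(1), of d] adj(2) 1 by simp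
qed (use adj_mat[OF A] in simp)

lemma jacobian_invertible_if_primitive_preserving:
  assumes "\<phi> \<in> hom (free_metabelian n) (free_metabelian n)"
    and "\<And>g. primitive n g \<Longrightarrow> primitive n (\<phi> g)"
  shows "jacobian_invertible n \<phi>"
proof -
  obtain \<alpha> c where d: "det (jacobian n \<phi>) = Poly_Mapping.single \<alpha> c" "\<bar>c\<bar> = 1"
    by (rule laurent_monomial_if_spec_nonzero[OF spec_det_jacobian_nonzero[OF assms]])
  have "c * c = 1" using d(2) by (auto simp: abs_if split: if_splits)
  then have "Poly_Mapping.single (- \<alpha>) c * det (jacobian n \<phi>) = 1"
    by (simp add: d(1) mult_single)
  then show ?thesis
    unfolding jacobian_invertible_def by (intro mat_invertible_if_det_unit) simp_all
qed

section \<open>Abelian groups with an action of the Laurent polynomial ring\<close>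

lemma (in comm_group) finprod_endo:
  assumes h: "h \<in> hom G G" and f: "f \<in> A \<rightarrow> carrier G"
  shows "h (finprod G f A) = finprod G (\<lambda>x. h (f x)) A"
proof -
  interpret h: group_hom G G h
    by (intro group_hom.intro group_hom_axioms.intro is_group h)
  show ?thesis
    using f
  proof (induction A rule: infinite_finite_induct)
    case (insert x A)
    then have fA: "f \<in> A \<rightarrow> carrier G" and fx: "f x \<in> carrier G" by auto
    have hf: "(\<lambda>x. h (f x)) \<in> A \<rightarrow> carrier G" "h (f x) \<in> carrier G"
      by (rule Pi_I, rule h.hom_closed, erule funcset_mem[OF fA], rule h.hom_closed[OF fx])
    show ?case
      using insert.hyps insert.IH[OF fA] fA fx hf by (simp add: finprod_insert finprod_closed)
  qed simp_all
qed

lemma (in comm_group) finprod_swap: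
  assumes "finite B" "\<And>a b. a \<in> A \<Longrightarrow> b \<in> B \<Longrightarrow> f a b \<in> carrier G"
  shows "finprod G (\<lambda>a. finprod G (f a) B) A = finprod G (\<lambda>b. finprod G (\<lambda>a. f a b) A) B"
  using assms
proof (induction B rule: finite_induct)
  case empty
  then show ?case by simp
next
  case (insert x B)
  have f: "f a \<in> B \<rightarrow> carrier G" "f a x \<in> carrier G" if "a \<in> A" for a
    using insert.prems that by auto
  have fx: "(\<lambda>a. f a x) \<in> A \<rightarrow> carrier G" and fB: "(\<lambda>a. finprod G (f a) B) \<in> A \<rightarrow> carrier G"
    using f by auto
  have fb: "(\<lambda>b. finprod G (\<lambda>a. f a b) A) \<in> B \<rightarrow> carrier G"
    using insert.prems by (intro Pi_I finprod_closed) auto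
  have "finprod G (\<lambda>a. finprod G (f a) (insert x B)) A = finprod G (\<lambda>a. f a x \<otimes> finprod G (f a) B) A"
    using insert.hyps f by (intro finprod_cong') auto
  also have "\<dots> = finprod G (\<lambda>a. f a x) A \<otimes> finprod G (\<lambda>a. finprod G (f a) B) A"
    by (rule finprod_multf[OF fx fB])
  also have "finprod G (\<lambda>a. finprod G (f a) B) A = finprod G (\<lambda>b. finprod G (\<lambda>a. f a b) A) B"
    using insert.prems by (intro insert.IH) auto
  also have "finprod G (\<lambda>a. f a x) A \<otimes> \<dots> = finprod G (\<lambda>b. finprod G (\<lambda>a. f a b) A) (insert x B)"
    by (rule finprod_insert[symmetric]) (use insert.hyps fb fx in \<open>auto intro: finprod_closed\<close>)
  finally show ?case .
qed

lemma (in comm_group) finprod_subgroup: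
  assumes "subgroup S G" "\<And>x. x \<in> A \<Longrightarrow> f x \<in> S"
  shows "finprod G f A \<in> S"
  using assms(2)
proof (induction A rule: infinite_finite_induct)
  case (insert x A)
  have "f y \<in> carrier G" if "y \<in> insert x A" for y
    using insert.prems[OF that] subgroup.mem_carrier[OF assms(1)] by blast
  then have "finprod G f (insert x A) = f x \<otimes> finprod G f A"
    using insert.hyps by (intro finprod_insert) auto
  moreover have "f x \<otimes> finprod G f A \<in> S"
    using insert by (intro subgroup.m_closed[OF assms(1)]) auto
  ultimately show ?case by simp
qed (simp_all add: subgroup.one_closed[OF assms(1)])

text \<open>A module over the Laurent polynomial ring in multiplicative notation: monomials act
  through \<open>\<tau>\<close>, integer coefficients act as powers, and \<open>act\<close> is the
  scalar multiplication. The multiplicative form fits subgroups of the free metabelian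
  group.\<close>

locale laurent_action = comm_group +
  fixes \<tau> :: "expo \<Rightarrow> 'a \<Rightarrow> 'a"
  assumes \<tau>_hom: "\<tau> \<alpha> \<in> hom G G"
    and \<tau>_add: "m \<in> carrier G \<Longrightarrow> \<tau> (\<alpha> + \<beta>) m = \<tau> \<alpha> (\<tau> \<beta> m)"
    and \<tau>_zero: "m \<in> carrier G \<Longrightarrow> \<tau> 0 m = m"
begin

definition act :: "laurent \<Rightarrow> 'a \<Rightarrow> 'a" where
  "act r m = finprod G (\<lambda>\<alpha>. \<tau> \<alpha> m [^] Poly_Mapping.lookup r \<alpha>) (Poly_Mapping.keys r)"

lemma \<tau>_closed: "m \<in> carrier G \<Longrightarrow> \<tau> \<alpha> m \<in> carrier G"
  using \<tau>_hom by (rule hom_in_carrier)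

lemma term_closed: "m \<in> carrier G \<Longrightarrow> (\<lambda>\<alpha>. \<tau> \<alpha> m [^] (c \<alpha> :: int)) \<in> A \<rightarrow> carrier G"
  by (intro Pi_I int_pow_closed \<tau>_closed)

lemma act_closed: "m \<in> carrier G \<Longrightarrow> act r m \<in> carrier G"
  unfolding act_def by (intro finprod_closed term_closed)

lemma act_superset:
  assumes m: "m \<in> carrier G" and A: "finite A" "Poly_Mapping.keys r \<subseteq> A"
  shows "act r m = finprod G (\<lambda>\<alpha>. \<tau> \<alpha> m [^] Poly_Mapping.lookup r \<alpha>) A"
  unfolding act_def
proof (rule finprod_mono_neutral_cong_left[OF A])
  fix i assume "i \<in> A - Poly_Mapping.keys r"
  then have "Poly_Mapping.lookup r i = 0"
    by (simp add: in_keys_iff)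
  then show "\<tau> i m [^] Poly_Mapping.lookup r i = \<one>"
    by simp
qed (simp_all add: term_closed[OF m])

lemma act_zero [simp]: "act 0 m = \<one>"
  by (simp add: act_def)

lemma act_single: 
  assumes m: "m \<in> carrier G"
  shows "act (Poly_Mapping.single \<alpha> c) m = \<tau> \<alpha> m [^] c"
proof -
  have "act (Poly_Mapping.single \<alpha> c) m = finprod G (\<lambda>\<beta>. \<tau> \<beta> m [^] Poly_Mapping.lookup (Poly_Mapping.single \<alpha> c) \<beta>) {\<alpha>}"
    by (rule act_superset[OF m]) simp_all
  also have "\<dots> = \<tau> \<alpha> m [^] c"
    using \<tau>_closed[OF m] by simp
  finally show ?thesis .
qed

lemma act_one: "m \<in> carrier G \<Longrightarrow> act 1 m = m"
  using act_single[of m 0 1] \<tau>_zero[of m] by simp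

lemma act_add:
  assumes m: "m \<in> carrier G"
  shows "act (r + s) m = act r m \<otimes> act s m"
proof -
  let ?A = "Poly_Mapping.keys r \<union> Poly_Mapping.keys s"
  have "act (r + s) m = finprod G (\<lambda>\<alpha>. \<tau> \<alpha> m [^] Poly_Mapping.lookup (r + s) \<alpha>) ?A"
    by (rule act_superset[OF m]) (use keys_add in simp_all)
  also have "\<dots> = finprod G (\<lambda>\<alpha>. \<tau> \<alpha> m [^] Poly_Mapping.lookup r \<alpha> \<otimes> \<tau> \<alpha> m [^] Poly_Mapping.lookup s \<alpha>) ?A"
    using \<tau>_closed[OF m] by (intro finprod_cong') (auto simp: lookup_add int_pow_mult)
  also have "\<dots> = finprod G (\<lambda>\<alpha>. \<tau> \<alpha> m [^] Poly_Mapping.lookup r \<alpha>) ?A \<otimes>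
      finprod G (\<lambda>\<alpha>. \<tau> \<alpha> m [^] Poly_Mapping.lookup s \<alpha>) ?A"
    by (intro finprod_multf term_closed m)
  also have "\<dots> = act r m \<otimes> act s m"
    using act_superset[OF m, of ?A r] act_superset[OF m, of ?A s] by simp
  finally show ?thesis .
qed

lemma act_hom: "act r \<in> hom G G"
proof (rule homI)
  fix m m' assume m: "m \<in> carrier G" "m' \<in> carrier G"
  let ?f = "\<lambda>m \<alpha>. \<tau> \<alpha> m [^] Poly_Mapping.lookup r \<alpha>"
  have "act r (m \<otimes> m') = finprod G (\<lambda>\<alpha>. ?f m \<alpha> \<otimes> ?f m' \<alpha>) (Poly_Mapping.keys r)"
    unfolding act_def
    using \<tau>_closed[OF m(1)] \<tau>_closed[OF m(2)]
    by (intro finprod_cong') (auto simp: hom_mult[OF \<tau>_hom m] int_pow_distrib)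
  also have "\<dots> = act r m \<otimes> act r m'"
    unfolding act_def by (intro finprod_multf term_closed m)
  finally show "act r (m \<otimes> m') = act r m \<otimes> act r m'" .
qed (rule act_closed)

text \<open>Nested induction splits both factors into monomials, where the claim is
  \<open>\<tau>_add\<close> together with the fact that the endomorphisms \<open>\<tau>\<close>
  commute with powers.\<close>

lemma act_mult:
  assumes m: "m \<in> carrier G"
  shows "act (r * s) m = act r (act s m)"
proof (induction r rule: poly_mapping_single_induct)
  case zero
  then show ?case by simp
next
  case (add \<alpha> c r)
  have single: "act (Poly_Mapping.single \<alpha> c * s) m = \<tau> \<alpha> (act s m) [^] c"
  proof (induction s rule: poly_mapping_single_induct)
    case zero
    have "\<tau> \<alpha> \<one> = \<one>" using hom_one[OF \<tau>_hom is_group is_group] .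
    then show ?case by simp
  next
    case (add \<beta> d s)
    have \<beta>: "\<tau> \<beta> m \<in> carrier G" and s: "act s m \<in> carrier G"
      using m by (rule \<tau>_closed, rule act_closed)
    have "act (Poly_Mapping.single \<alpha> c * (Poly_Mapping.single \<beta> d + s)) m
        = act (Poly_Mapping.single (\<alpha> + \<beta>) (c * d)) m \<otimes> act (Poly_Mapping.single \<alpha> c * s) m"
      by (simp add: distrib_left mult_single act_add[OF m])
    also have "act (Poly_Mapping.single (\<alpha> + \<beta>) (c * d)) m = (\<tau> \<alpha> (\<tau> \<beta> m) [^] d) [^] c"
      using \<tau>_closed[OF \<beta>, of \<alpha>] by (simp add: act_single[OF m] \<tau>_add[OF m] int_pow_pow mult.commute)
    also have "\<tau> \<alpha> (\<tau> \<beta> m) [^] d = \<tau> \<alpha> (\<tau> \<beta> m [^] d)"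
      using group_hom.hom_int_pow[OF group_hom.intro[OF is_group is_group group_hom_axioms.intro[OF \<tau>_hom]] \<beta>]
      by simp
    also have "\<tau> \<alpha> (\<tau> \<beta> m [^] d) [^] c \<otimes> act (Poly_Mapping.single \<alpha> c * s) m =
        (\<tau> \<alpha> (\<tau> \<beta> m [^] d) \<otimes> \<tau> \<alpha> (act s m)) [^] c"
      unfolding add.IH
      by (rule int_pow_distrib[symmetric]) (intro \<tau>_closed int_pow_closed act_closed m)+
    also have "\<tau> \<alpha> (\<tau> \<beta> m [^] d) \<otimes> \<tau> \<alpha> (act s m) = \<tau> \<alpha> (act (Poly_Mapping.single \<beta> d + s) m)"
      using hom_mult[OF \<tau>_hom int_pow_closed[OF \<beta>, of d] s]
      by (simp add: act_add[OF m] act_single[OF m])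
    finally show ?case .
  qed
  have s: "act s m \<in> carrier G" using m by (rule act_closed)
  show ?case
    by (simp add: distrib_right act_add[OF m] act_add[OF s] single act_single[OF s] add.IH)
qed

lemma act_sum:
  assumes m: "m \<in> carrier G" and "finite A"
  shows "act (\<Sum>i\<in>A. r i) m = finprod G (\<lambda>i. act (r i) m) A"
  using assms(2)
proof (induction A rule: finite_induct)
  case empty
  then show ?case by simp
next
  case (insert x A)
  have "(\<lambda>i. act (r i) m) \<in> A \<rightarrow> carrier G" "act (r x) m \<in> carrier G"
    using act_closed[OF m] by blast+
  then show ?case
    using insert by (simp add: act_add[OF m] finprod_insert)
qed

lemma act_subgroup:
  assumes S: "subgroup S G" and \<tau>S: "\<And>\<alpha> m. m \<in> S \<Longrightarrow> \<tau> \<alpha> m \<in> S" and m: "m \<in> S"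
  shows "act r m \<in> S"
  unfolding act_def
  by (intro finprod_subgroup[OF S] subgroup_int_pow_closed[OF S] \<tau>S m)

text \<open>\<open>S\<close> is a submodule. If all entries of \<open>J v\<close> lie in it, so do
  those of \<open>C (J v)\<close>, which is \<open>v\<close>.\<close>

lemma act_matrix_left_inverse:
  assumes C: "C \<in> carrier_mat n n" and J: "J \<in> carrier_mat n n" and CJ: "C * J = 1\<^sub>m n"
    and v: "\<And>j. j < n \<Longrightarrow> v j \<in> carrier G"
    and S: "subgroup S G" "\<And>\<alpha> m. m \<in> S \<Longrightarrow> \<tau> \<alpha> m \<in> S"
    and Jv: "\<And>i. i < n \<Longrightarrow> finprod G (\<lambda>j. act (J $$ (i, j)) (v j)) {..<n} \<in> S"
    and k: "k < n"
  shows "v k \<in> S"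
proof -
  let ?w = "\<lambda>i. finprod G (\<lambda>j. act (J $$ (i, j)) (v j)) {..<n}"
  have Jc: "(\<lambda>j. act (J $$ (i, j)) (v j)) \<in> {..<n} \<rightarrow> carrier G" for i
    using act_closed[OF v] by blast
  have "finprod G (\<lambda>i. act (C $$ (k, i)) (?w i)) {..<n} \<in> S"
    by (intro finprod_subgroup[OF S(1)] act_subgroup[OF S] Jv) simp_all
  also have "finprod G (\<lambda>i. act (C $$ (k, i)) (?w i)) {..<n} =
      finprod G (\<lambda>i. finprod G (\<lambda>j. act (C $$ (k, i) * J $$ (i, j)) (v j)) {..<n}) {..<n}"
  proof (rule finprod_cong')
    show "(\<lambda>i. finprod G (\<lambda>j. act (C $$ (k, i) * J $$ (i, j)) (v j)) {..<n}) \<in> {..<n} \<rightarrow> carrier G"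
      using act_closed[OF v] by (intro Pi_I finprod_closed) blast
    fix i
    have "act (C $$ (k, i)) (?w i) = finprod G (\<lambda>j. act (C $$ (k, i)) (act (J $$ (i, j)) (v j))) {..<n}"
      by (rule finprod_endo[OF act_hom Jc])
    also have "\<dots> = finprod G (\<lambda>j. act (C $$ (k, i) * J $$ (i, j)) (v j)) {..<n}"
      by (intro finprod_cong' Pi_I) (simp_all add: act_closed v act_mult)
    finally show "act (C $$ (k, i)) (?w i) = finprod G (\<lambda>j. act (C $$ (k, i) * J $$ (i, j)) (v j)) {..<n}" .
  qed simp
  also have "\<dots> = finprod G (\<lambda>j. finprod G (\<lambda>i. act (C $$ (k, i) * J $$ (i, j)) (v j)) {..<n}) {..<n}"
    by (intro finprod_swap) (simp_all add: act_closed v)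
  also have "\<dots> = finprod G (\<lambda>j. if k = j then v j else \<one>) {..<n}"
  proof (rule finprod_cong')
    show "(\<lambda>j. if k = j then v j else \<one>) \<in> {..<n} \<rightarrow> carrier G"
      by (rule Pi_I) (simp add: v)
    fix j assume "j \<in> {..<n}"
    then have j: "j < n" by simp
    have "finprod G (\<lambda>i. act (C $$ (k, i) * J $$ (i, j)) (v j)) {..<n} = act (\<Sum>i<n. C $$ (k, i) * J $$ (i, j)) (v j)"
      by (rule act_sum[OF v[OF j], symmetric]) simp
    also have "(\<Sum>i<n. C $$ (k, i) * J $$ (i, j)) = (C * J) $$ (k, j)"
      using C J k j by (simp add: scalar_prod_def atLeast0LessThan)
    also have "\<dots> = (if k = j then 1 else 0)"
      unfolding CJ using k j by simp
    finally show "finprod G (\<lambda>i. act (C $$ (k, i) * J $$ (i, j)) (v j)) {..<n} = (if k = j then v j else \<one>)"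
      using act_one[OF v[OF j]] by simp
  qed simp
  also have "\<dots> = v k"
    by (rule finprod_singleton) (use k in \<open>simp_all add: v\<close>)
  finally show ?thesis .
qed

end

section \<open>Kernel of the abelianisation\<close>

lemma ab_one [simp]: "ab n \<one>\<^bsub>free_metabelian n\<^esub> = 0"
proof -
  interpret M: group "free_metabelian n" by (rule group_free_metabelian)
  show ?thesis using ab_mult[OF M.one_closed M.one_closed] by simp
qed

lemma ab_inv [simp]:
  assumes w: "w \<in> carrier (free_metabelian n)"
  shows "ab n (inv\<^bsub>free_metabelian n\<^esub> w) = - ab n w"
proof -
  interpret M: group "free_metabelian n" by (rule group_free_metabelian)
  have "ab n w + ab n (inv\<^bsub>free_metabelian n\<^esub> w) = 0"
    using ab_mult[OF w M.inv_closed[OF w]] M.r_inv[OF w] by simp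
  then show ?thesis by (metis minus_unique)
qed

lemma ab_nat_pow:
  assumes w: "w \<in> carrier (free_metabelian n)"
  shows "ab n (w [^]\<^bsub>free_metabelian n\<^esub> (m :: nat)) = of_nat m * ab n w"
proof -
  interpret M: group "free_metabelian n" by (rule group_free_metabelian)
  show ?thesis
    by (induction m) (simp_all add: w distrib_right)
qed

lemma ab_int_pow:
  assumes w: "w \<in> carrier (free_metabelian n)"
  shows "ab n (w [^]\<^bsub>free_metabelian n\<^esub> (c :: int)) = of_int c * ab n w"
proof -
  interpret M: group "free_metabelian n" by (rule group_free_metabelian)
  show ?thesis
  proof (cases c rule: int_cases2)
    case (nonneg m)
    then show ?thesis by (simp add: int_pow_int ab_nat_pow[OF w])
  next
    case (nonpos m)
    then show ?thesis
      using w M.nat_pow_closed[OF w, of m] by (simp add: M.int_pow_neg_int ab_nat_pow[OF w])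
  qed
qed

lemma ab_surj:
  assumes "m \<le> n"
  shows "\<exists>w \<in> carrier (free_metabelian n). ab n w = (\<Sum>i<m. of_int (c i) * unit_expo i)"
  using assms
proof (induction m)
  case 0
  interpret M: group "free_metabelian n" by (rule group_free_metabelian)
  show ?case by (rule bexI[OF _ M.one_closed]) simp
next
  case (Suc m)
  interpret M: group "free_metabelian n" by (rule group_free_metabelian)
  from Suc obtain w where w: "w \<in> carrier (free_metabelian n)" "ab n w = (\<Sum>i<m. of_int (c i) * unit_expo i)"
    by auto
  have x: "std_gen n m \<in> carrier (free_metabelian n)"
    using Suc.prems by (intro std_gen_closed) simp
  let ?w = "w \<otimes>\<^bsub>free_metabelian n\<^esub> std_gen n m [^]\<^bsub>free_metabelian n\<^esub> c m"
  have "ab n ?w = (\<Sum>i<Suc m. of_int (c i) * unit_expo i)"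
    using w x Suc.prems by (simp add: ab_int_pow)
  moreover have "?w \<in> carrier (free_metabelian n)"
    using w x by simp
  ultimately show ?case by blast
qed

section \<open>Augmentation and exponent sums\<close>

definition augmentation :: "laurent \<Rightarrow> int" where
  "augmentation = lin (\<lambda>_. 1)"

lemma augmentation_mult: "augmentation (r * s) = augmentation r * augmentation s"
  unfolding augmentation_def by (rule lin_mult) simp

lemma augmentation_simps [simp]:
  "augmentation 0 = 0" "augmentation 1 = 1" "augmentation (r + s) = augmentation r + augmentation s"
  "augmentation (lmonom \<alpha>) = 1"
  by (simp_all add: augmentation_def lin_add)

lemma augmentation_sum: "augmentation (\<Sum>i\<in>S. f i) = (\<Sum>i\<in>S. augmentation (f i))"
  by (simp add: augmentation_def lin_sum)

text \<open>Augmentation turns crossed maps into homomorphisms, so the augmented Fox derivatives are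
  the exponent sums. The augmented Jacobian is therefore the integer matrix of the endomorphism on
  the abelianisation.\<close>

lemma ab_eq_augmentation:
  assumes w: "w \<in> carrier (free_metabelian n)"
  shows "ab n w = (\<Sum>j<n. of_int (augmentation (fox n j w)) * unit_expo j)"
proof (rule crossed_ext(1)[OF ab_crossed _ free_basis_std_gen _ w])
  show "crossed n (\<lambda>w. \<Sum>j<n. of_int (augmentation (fox n j w)) * unit_expo j) (\<lambda>_. 0)"
    unfolding crossed_iff
    by (simp add: fox_mult augmentation_mult distrib_right sum.distrib)
next
  fix i assume i: "i < n"
  have "(\<Sum>j<n. of_int (augmentation (fox n j (std_gen n i))) * unit_expo j) = (\<Sum>j<n. if j = i then unit_expo j else 0)"
    using i by (intro sum.cong) simp_all
  then show "ab n (std_gen n i) = (\<Sum>j<n. of_int (augmentation (fox n j (std_gen n i))) * unit_expo j) \<and> (0 :: laurent) = 0"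
    using i by simp
qed

lemma linear_ext_sum:
  "linear_ext n b (\<Sum>j<n. of_int (c j) * unit_expo j) = (\<Sum>j<n. of_int (c j) * b j)"
proof -
  have "Poly_Mapping.lookup (\<Sum>j<n. of_int (c j) * unit_expo j) i = c i" if "i < n" for i
  proof -
    have "Poly_Mapping.lookup (\<Sum>j<n. of_int (c j) * unit_expo j) i = (\<Sum>j<n. if j = i then c i else 0)"
      unfolding lookup_sum by (intro sum.cong) (auto simp: lookup_single)
    then show ?thesis using that by simp
  qed
  then show ?thesis
    unfolding linear_ext_def by (intro sum.cong) simp_all
qed

lemma linear_ext_unit_ab:
  assumes "w \<in> carrier (free_metabelian n)"
  shows "linear_ext n unit_expo (ab n w) = ab n w"
proof -
  define c where "c j = augmentation (fox n j w)" for j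
  have "ab n w = (\<Sum>j<n. of_int (c j) * unit_expo j)"
    unfolding c_def by (rule ab_eq_augmentation[OF assms])
  then show ?thesis by (simp only: linear_ext_sum)
qed

definition ab_kernel :: "nat \<Rightarrow> letter list set set" where
  "ab_kernel n = {w \<in> carrier (free_metabelian n). ab n w = 0}"

lemma (in comm_group) expo_hom_exists:
  assumes g: "\<And>i. i < n \<Longrightarrow> g i \<in> carrier G"
  obtains F :: "expo \<Rightarrow> 'a" where "\<And>\<alpha>. F \<alpha> \<in> carrier G"
    "\<And>\<alpha> \<beta>. F (\<alpha> + \<beta>) = F \<alpha> \<otimes> F \<beta>" "\<And>i. i < n \<Longrightarrow> F (unit_expo i) = g i"
proof -
  define F where "F \<alpha> = finprod G (\<lambda>i. g i [^] Poly_Mapping.lookup \<alpha> i) {..<n}" for \<alpha> :: expo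
  have F_term: "(\<lambda>i. g i [^] (c i :: int)) \<in> {..<n} \<rightarrow> carrier G" for c
    by (rule Pi_I) (simp add: g)
  have F_closed: "F \<alpha> \<in> carrier G" for \<alpha>
    unfolding F_def by (intro finprod_closed F_term)
  have F_add: "F (\<alpha> + \<beta>) = F \<alpha> \<otimes> F \<beta>" for \<alpha> \<beta>
  proof -
    have "F (\<alpha> + \<beta>) = finprod G (\<lambda>i. g i [^] Poly_Mapping.lookup \<alpha> i \<otimes> g i [^] Poly_Mapping.lookup \<beta> i) {..<n}"
      unfolding F_def by (intro finprod_cong' Pi_I) (simp_all add: g lookup_add int_pow_mult)
    then show ?thesis
      unfolding F_def by (simp only: finprod_multf[OF F_term F_term])
  qed
  have Fx: "F (unit_expo i) = g i" if i: "i < n" for i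
  proof -
    have "F (unit_expo i) = finprod G (\<lambda>k. if i = k then g k else \<one>) {..<n}"
      unfolding F_def by (intro finprod_cong' Pi_I) (simp_all add: g lookup_single int_pow_1)
    also have "\<dots> = g i"
      by (rule finprod_singleton) (use i in \<open>simp_all add: g\<close>)
    finally show ?thesis .
  qed
  show thesis by (rule that[of F]) (fact F_closed F_add Fx)+
qed

text \<open>The quotient by the commutator subgroup is abelian, so its projection factors through
  \<open>ab n\<close>: both maps agree on the standard generators. An element killed by
  \<open>ab n\<close> is thus killed by the projection.\<close>

lemma ab_kernel_subset_derived: "ab_kernel n \<subseteq> derived (free_metabelian n) (carrier (free_metabelian n))"
proof
  let ?M = "free_metabelian n"
  let ?N = "derived ?M (carrier ?M)"
  let ?q = "\<lambda>w. ?N #>\<^bsub>?M\<^esub> w"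
  define Q where "Q = ?M Mod ?N"
  interpret M: group ?M by (rule group_free_metabelian)
  interpret N: normal ?N ?M by (rule M.derived_self_is_normal)
  interpret Q: comm_group Q unfolding Q_def by (rule M.derived_quot_is_comm_group)
  have q: "?q \<in> hom ?M Q" unfolding Q_def by (rule N.r_coset_hom_Mod)
  have qx: "?q (std_gen n i) \<in> carrier Q" if "i < n" for i
    using hom_in_carrier[OF q std_gen_closed[OF that]] .
  obtain F :: "expo \<Rightarrow> letter list set set" where F: "\<And>\<alpha>. F \<alpha> \<in> carrier Q"
    "\<And>\<alpha> \<beta>. F (\<alpha> + \<beta>) = F \<alpha> \<otimes>\<^bsub>Q\<^esub> F \<beta>" "\<And>i. i < n \<Longrightarrow> F (unit_expo i) = ?q (std_gen n i)"
    using Q.expo_hom_exists[of n "\<lambda>i. ?q (std_gen n i)", OF qx] by metis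
  have "F 0 \<otimes>\<^bsub>Q\<^esub> F 0 = F 0"
    using F(2)[of 0 0] by simp
  then have F0: "F 0 = \<one>\<^bsub>Q\<^esub>"
    using F(1)[of 0] by simp
  have "(\<lambda>w. F (ab n w)) \<in> hom ?M Q"
    by (rule homI) (simp_all add: F(1,2))
  then have Fab: "F (ab n w) = ?q w" if "w \<in> carrier ?M" for w
    by (rule hom_eq_on_generate[OF M.is_group Q.is_group _ q, of _ "std_gen n ` {..<n}"])
      (use that in \<open>auto simp: std_gen_closed std_gen_generates F(3)\<close>)
  fix w assume "w \<in> ab_kernel n"
  then have w: "w \<in> carrier ?M" "ab n w = 0" by (simp_all add: ab_kernel_def)
  have "?q w = \<one>\<^bsub>Q\<^esub>"
    using Fab[OF w(1)] F0 w(2) by simp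
  then have "?q w = ?N" by (simp add: Q_def FactGroup_def)
  then show "w \<in> ?N"
    using M.rcos_self[OF w(1) N.subgroup_axioms] by simp
qed

lemma ab_kernel_commute:
  assumes "a \<in> ab_kernel n" "b \<in> ab_kernel n"
  shows "a \<otimes>\<^bsub>free_metabelian n\<^esub> b = b \<otimes>\<^bsub>free_metabelian n\<^esub> a"
proof -
  let ?M = "free_metabelian n"
  interpret M: group ?M by (rule group_free_metabelian)
  have ab: "a \<in> carrier ?M" "b \<in> carrier ?M"
    using assms by (simp_all add: ab_kernel_def)
  have "a \<in> derived ?M (carrier ?M)" "b \<in> derived ?M (carrier ?M)"
    using assms ab_kernel_subset_derived by blast+
  then have "a \<otimes>\<^bsub>?M\<^esub> b \<otimes>\<^bsub>?M\<^esub> inv\<^bsub>?M\<^esub> a \<otimes>\<^bsub>?M\<^esub> inv\<^bsub>?M\<^esub> b \<in> derived ?M (derived ?M (carrier ?M))"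
    unfolding derived_def[of ?M "derived ?M (carrier ?M)"] by (intro generate.incl) blast
  then have "a \<otimes>\<^bsub>?M\<^esub> b \<otimes>\<^bsub>?M\<^esub> inv\<^bsub>?M\<^esub> a \<otimes>\<^bsub>?M\<^esub> inv\<^bsub>?M\<^esub> b = \<one>\<^bsub>?M\<^esub>"
    using metabelian_free_metabelian[of n] unfolding metabelian_def by simp
  then have "(a \<otimes>\<^bsub>?M\<^esub> b) \<otimes>\<^bsub>?M\<^esub> inv\<^bsub>?M\<^esub> (b \<otimes>\<^bsub>?M\<^esub> a) = \<one>\<^bsub>?M\<^esub>"
    using ab by (simp add: M.inv_mult_group M.m_assoc)
  then have "a \<otimes>\<^bsub>?M\<^esub> b = inv\<^bsub>?M\<^esub> (inv\<^bsub>?M\<^esub> (b \<otimes>\<^bsub>?M\<^esub> a))"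
    using ab by (intro M.inv_equality[symmetric]) simp_all
  then show ?thesis using ab by simp
qed

lemma ab_kernel_subgroup: "subgroup (ab_kernel n) (free_metabelian n)"
proof -
  interpret M: group "free_metabelian n" by (rule group_free_metabelian)
  show ?thesis
    by (rule M.subgroupI) (auto simp: ab_kernel_def intro!: exI[of _ "\<one>\<^bsub>free_metabelian n\<^esub>"])
qed

abbreviation kernel_group :: "nat \<Rightarrow> letter list set monoid" where
  "kernel_group n \<equiv> (free_metabelian n)\<lparr>carrier := ab_kernel n\<rparr>"

lemma comm_group_kernel_group: "comm_group (kernel_group n)"
proof -
  interpret M: group "free_metabelian n" by (rule group_free_metabelian)
  interpret K: group "kernel_group n"
    by (rule M.subgroup_imp_group[OF ab_kernel_subgroup])
  show ?thesis
    by (rule K.group_comm_groupI) (simp add: ab_kernel_commute)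
qed

section \<open>Conjugation as an action of exponents on the kernel\<close>

definition conjugate :: "nat \<Rightarrow> letter list set \<Rightarrow> letter list set \<Rightarrow> letter list set" where
  "conjugate n u m = u \<otimes>\<^bsub>free_metabelian n\<^esub> m \<otimes>\<^bsub>free_metabelian n\<^esub> inv\<^bsub>free_metabelian n\<^esub> u"

lemma conjugate_closed:
  assumes "u \<in> carrier (free_metabelian n)" "m \<in> ab_kernel n"
  shows "conjugate n u m \<in> ab_kernel n"
proof -
  interpret M: group "free_metabelian n" by (rule group_free_metabelian)
  show ?thesis using assms by (simp add: conjugate_def ab_kernel_def)
qed

lemma conjugate_mult:
  assumes "u \<in> carrier (free_metabelian n)" "v \<in> carrier (free_metabelian n)" "m \<in> carrier (free_metabelian n)"
  shows "conjugate n (u \<otimes>\<^bsub>free_metabelian n\<^esub> v) m = conjugate n u (conjugate n v m)"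
proof -
  interpret M: group "free_metabelian n" by (rule group_free_metabelian)
  show ?thesis using assms by (simp add: conjugate_def M.inv_mult_group M.m_assoc)
qed

lemma conjugate_hom:
  assumes u: "u \<in> carrier (free_metabelian n)" and m: "m \<in> carrier (free_metabelian n)" "m' \<in> carrier (free_metabelian n)"
  shows "conjugate n u (m \<otimes>\<^bsub>free_metabelian n\<^esub> m') = conjugate n u m \<otimes>\<^bsub>free_metabelian n\<^esub> conjugate n u m'"
proof -
  interpret M: group "free_metabelian n" by (rule group_free_metabelian)
  have "inv\<^bsub>free_metabelian n\<^esub> u \<otimes>\<^bsub>free_metabelian n\<^esub> (u \<otimes>\<^bsub>free_metabelian n\<^esub> x) = x"
    if "x \<in> carrier (free_metabelian n)" for x
    using u that by (simp flip: M.m_assoc)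
  then show ?thesis using u m by (simp add: conjugate_def M.m_assoc)
qed

lemma conjugate_by_kernel:
  assumes "d \<in> ab_kernel n" "m \<in> ab_kernel n"
  shows "conjugate n d m = m"
proof -
  interpret M: group "free_metabelian n" by (rule group_free_metabelian)
  have "d \<in> carrier (free_metabelian n)" "m \<in> carrier (free_metabelian n)"
    using assms by (simp_all add: ab_kernel_def)
  then show ?thesis
    unfolding conjugate_def ab_kernel_commute[OF assms] by (simp add: M.m_assoc)
qed

text \<open>The two conjugating elements differ by an element of the kernel, which is abelian and so
  acts trivially on itself. This is why conjugation depends on exponents only.\<close>

lemma conjugate_cong:
  assumes u: "u \<in> carrier (free_metabelian n)" and v: "v \<in> carrier (free_metabelian n)"
    and ab: "ab n u = ab n v" and m: "m \<in> ab_kernel n"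
  shows "conjugate n u m = conjugate n v m"
proof -
  let ?M = "free_metabelian n"
  interpret M: group ?M by (rule group_free_metabelian)
  have mM: "m \<in> carrier ?M" using m by (simp add: ab_kernel_def)
  let ?d = "u \<otimes>\<^bsub>?M\<^esub> inv\<^bsub>?M\<^esub> v"
  have d: "?d \<in> ab_kernel n" "?d \<in> carrier ?M"
    using u v ab by (simp_all add: ab_kernel_def)
  have "u = ?d \<otimes>\<^bsub>?M\<^esub> v" using u v by (simp add: M.m_assoc)
  then have "conjugate n u m = conjugate n ?d (conjugate n v m)"
    using conjugate_mult[OF d(2) v mM] by simp
  then show ?thesis
    using conjugate_by_kernel[OF d(1) conjugate_closed[OF v m]] by simp
qed

text \<open>Exponents outside \<open>{..<n}\<close> are ignored.\<close>

definition lift_expo :: "nat \<Rightarrow> expo \<Rightarrow> letter list set" where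
  "lift_expo n \<alpha> = (SOME w. w \<in> carrier (free_metabelian n) \<and> ab n w = linear_ext n unit_expo \<alpha>)"

lemma lift_expo_closed: "lift_expo n \<alpha> \<in> carrier (free_metabelian n)"
  and ab_lift_expo: "ab n (lift_expo n \<alpha>) = linear_ext n unit_expo \<alpha>"
proof -
  have "\<exists>w. w \<in> carrier (free_metabelian n) \<and> ab n w = linear_ext n unit_expo \<alpha>"
    using ab_surj[OF order_refl, of n "\<lambda>i. Poly_Mapping.lookup \<alpha> i"] unfolding linear_ext_def by blast
  from someI_ex[OF this]
  show "lift_expo n \<alpha> \<in> carrier (free_metabelian n)" "ab n (lift_expo n \<alpha>) = linear_ext n unit_expo \<alpha>"
    unfolding lift_expo_def by blast+
qed

abbreviation kernel_action :: "nat \<Rightarrow> expo \<Rightarrow> letter list set \<Rightarrow> letter list set" where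
  "kernel_action n \<alpha> \<equiv> conjugate n (lift_expo n \<alpha>)"

lemma kernel_action_ab:
  assumes "u \<in> carrier (free_metabelian n)" "m \<in> ab_kernel n"
  shows "kernel_action n (ab n u) m = conjugate n u m"
  by (rule conjugate_cong[OF lift_expo_closed assms(1) _ assms(2)])
    (simp add: ab_lift_expo linear_ext_unit_ab[OF assms(1)])

lemma laurent_action_kernel: "laurent_action (kernel_group n) (kernel_action n)"
proof -
  let ?M = "free_metabelian n"
  interpret M: group ?M by (rule group_free_metabelian)
  have car: "m \<in> carrier ?M" if "m \<in> ab_kernel n" for m
    using that by (simp add: ab_kernel_def)
  show ?thesis
  proof (intro laurent_action.intro comm_group_kernel_group laurent_action_axioms.intro)
    show "kernel_action n \<alpha> \<in> hom (kernel_group n) (kernel_group n)" for \<alpha>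
      by (rule homI) (simp_all add: conjugate_closed conjugate_hom lift_expo_closed car)
    show "kernel_action n (\<alpha> + \<beta>) m = kernel_action n \<alpha> (kernel_action n \<beta> m)"
      if "m \<in> carrier (kernel_group n)" for \<alpha> \<beta> m
    proof -
      have m: "m \<in> ab_kernel n" using that by simp
      have "kernel_action n (\<alpha> + \<beta>) m = conjugate n (lift_expo n \<alpha> \<otimes>\<^bsub>?M\<^esub> lift_expo n \<beta>) m"
        by (rule conjugate_cong[OF lift_expo_closed _ _ m])
          (simp_all add: lift_expo_closed ab_lift_expo linear_ext_add)
      then show ?thesis
        by (simp add: conjugate_mult lift_expo_closed car[OF m])
    qed
    show "kernel_action n 0 m = m" if "m \<in> carrier (kernel_group n)" for m
    proof -
      have m: "m \<in> ab_kernel n" using that by simp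
      have "lift_expo n 0 \<in> ab_kernel n"
        by (simp add: ab_kernel_def lift_expo_closed ab_lift_expo linear_ext_def)
      from conjugate_by_kernel[OF this m] show ?thesis .
    qed
  qed
qed

section \<open>Endomorphisms with invertible Jacobian\<close>

text \<open>The rule for products determines the value at an inverse, so the elements where both
  maps agree form a subgroup. The order of the factors is the one that arises for
  \<open>w \<mapsto> w (f w)\<inverse>\<close> with \<open>f\<close> a homomorphism.\<close>

lemma kernel_crossed_ext:
  assumes \<delta>: "\<And>w. w \<in> carrier (free_metabelian n) \<Longrightarrow> \<delta> w \<in> ab_kernel n"
      "\<And>u v. u \<in> carrier (free_metabelian n) \<Longrightarrow> v \<in> carrier (free_metabelian n) \<Longrightarrow>
        \<delta> (u \<otimes>\<^bsub>free_metabelian n\<^esub> v) = conjugate n u (\<delta> v) \<otimes>\<^bsub>free_metabelian n\<^esub> \<delta> u"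
    and \<delta>': "\<And>w. w \<in> carrier (free_metabelian n) \<Longrightarrow> \<delta>' w \<in> ab_kernel n"
      "\<And>u v. u \<in> carrier (free_metabelian n) \<Longrightarrow> v \<in> carrier (free_metabelian n) \<Longrightarrow>
        \<delta>' (u \<otimes>\<^bsub>free_metabelian n\<^esub> v) = conjugate n u (\<delta>' v) \<otimes>\<^bsub>free_metabelian n\<^esub> \<delta>' u"
    and gen: "\<And>i. i < n \<Longrightarrow> \<delta> (std_gen n i) = \<delta>' (std_gen n i)"
    and w: "w \<in> carrier (free_metabelian n)"
  shows "\<delta> w = \<delta>' w"
proof -
  let ?M = "free_metabelian n"
  interpret M: group ?M by (rule group_free_metabelian)
  have car: "m \<in> carrier ?M" if "m \<in> ab_kernel n" for m
    using that by (simp add: ab_kernel_def)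
  have one: "d \<one>\<^bsub>?M\<^esub> = \<one>\<^bsub>?M\<^esub>" and inv: "d (inv\<^bsub>?M\<^esub> u) = inv\<^bsub>?M\<^esub> (conjugate n (inv\<^bsub>?M\<^esub> u) (d u))"
    if d: "\<And>w. w \<in> carrier ?M \<Longrightarrow> d w \<in> ab_kernel n"
      "\<And>u v. u \<in> carrier ?M \<Longrightarrow> v \<in> carrier ?M \<Longrightarrow> d (u \<otimes>\<^bsub>?M\<^esub> v) = conjugate n u (d v) \<otimes>\<^bsub>?M\<^esub> d u"
      and u: "u \<in> carrier ?M" for d u
  proof -
    have d1: "d \<one>\<^bsub>?M\<^esub> \<in> carrier ?M" by (intro car d(1) M.one_closed)
    have "d \<one>\<^bsub>?M\<^esub> = d \<one>\<^bsub>?M\<^esub> \<otimes>\<^bsub>?M\<^esub> d \<one>\<^bsub>?M\<^esub>"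
      using d(2)[OF M.one_closed M.one_closed] d1 by (simp add: conjugate_def)
    then show one: "d \<one>\<^bsub>?M\<^esub> = \<one>\<^bsub>?M\<^esub>"
      using d1 by simp
    have c: "conjugate n (inv\<^bsub>?M\<^esub> u) (d u) \<in> carrier ?M"
      by (intro car conjugate_closed M.inv_closed d(1) u)
    have du: "d (inv\<^bsub>?M\<^esub> u) \<in> carrier ?M"
      by (intro car d(1) M.inv_closed u)
    have "conjugate n (inv\<^bsub>?M\<^esub> u) (d u) \<otimes>\<^bsub>?M\<^esub> d (inv\<^bsub>?M\<^esub> u) = \<one>\<^bsub>?M\<^esub>"
      using d(2)[OF M.inv_closed[OF u] u] one u by simp
    then show "d (inv\<^bsub>?M\<^esub> u) = inv\<^bsub>?M\<^esub> (conjugate n (inv\<^bsub>?M\<^esub> u) (d u))"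
      using M.inv_equality[OF _ du c] M.inv_comm[OF _ c du] M.inv_equality[OF _ c du] by (metis M.inv_inv du)
  qed
  define E where "E = {u \<in> carrier ?M. \<delta> u = \<delta>' u}"
  have "subgroup E ?M"
  proof (rule M.subgroupI)
    show "E \<subseteq> carrier ?M" by (simp add: E_def)
    show "E \<noteq> {}"
      using one[OF \<delta> M.one_closed] one[OF \<delta>' M.one_closed] M.one_closed unfolding E_def by auto
    show "inv\<^bsub>?M\<^esub> u \<in> E" if "u \<in> E" for u
    proof -
      have u: "u \<in> carrier ?M" "\<delta> u = \<delta>' u" using that by (simp_all add: E_def)
      show ?thesis
        using inv[OF \<delta> u(1)] inv[OF \<delta>' u(1)] u by (simp add: E_def)
    qed
    show "u \<otimes>\<^bsub>?M\<^esub> v \<in> E" if "u \<in> E" "v \<in> E" for u v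
      using that by (simp add: E_def \<delta>(2) \<delta>'(2))
  qed
  moreover have "std_gen n ` {..<n} \<subseteq> E"
    using gen std_gen_closed by (auto simp: E_def)
  ultimately have "carrier ?M \<subseteq> E"
    using M.generate_subgroup_incl[of "std_gen n ` {..<n}" E] std_gen_generates[of n] by simp
  with w show ?thesis by (auto simp: E_def)
qed

text \<open>The counterpart of \<open>fox_chain_rule\<close> with values in the module
  \<open>ab_kernel n\<close>: the right side is crossed because the Fox derivatives are, and it has
  the same values on the standard generators.\<close>

lemma kernel_chain_rule:
  fixes n
  defines "act \<equiv> laurent_action.act (kernel_group n) (kernel_action n)"
  assumes \<delta>: "\<And>w. w \<in> carrier (free_metabelian n) \<Longrightarrow> \<delta> w \<in> ab_kernel n"
      "\<And>u v. u \<in> carrier (free_metabelian n) \<Longrightarrow> v \<in> carrier (free_metabelian n) \<Longrightarrow>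
        \<delta> (u \<otimes>\<^bsub>free_metabelian n\<^esub> v) = conjugate n u (\<delta> v) \<otimes>\<^bsub>free_metabelian n\<^esub> \<delta> u"
    and w: "w \<in> carrier (free_metabelian n)"
  shows "\<delta> w = finprod (kernel_group n) (\<lambda>k. act (fox n k w) (\<delta> (std_gen n k))) {..<n}"
proof (rule kernel_crossed_ext[OF \<delta> _ _ _ w])
  let ?M = "free_metabelian n" and ?K = "kernel_group n"
  interpret M: group ?M by (rule group_free_metabelian)
  interpret K: laurent_action ?K "kernel_action n" by (rule laurent_action_kernel)
  have \<delta>x: "\<delta> (std_gen n k) \<in> carrier ?K" if "k < n" for k
    using \<delta>(1)[OF std_gen_closed[OF that]] by simp
  have closed: "(\<lambda>k. act (f k) (\<delta> (std_gen n k))) \<in> {..<n} \<rightarrow> carrier ?K" for f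
    unfolding act_def by (intro Pi_I K.act_closed \<delta>x) simp
  show "finprod ?K (\<lambda>k. act (fox n k u) (\<delta> (std_gen n k))) {..<n} \<in> ab_kernel n" for u
    using K.finprod_closed[OF closed] by simp
  show "finprod ?K (\<lambda>k. act (fox n k (u \<otimes>\<^bsub>?M\<^esub> v)) (\<delta> (std_gen n k))) {..<n} =
      conjugate n u (finprod ?K (\<lambda>k. act (fox n k v) (\<delta> (std_gen n k))) {..<n}) \<otimes>\<^bsub>?M\<^esub>
      finprod ?K (\<lambda>k. act (fox n k u) (\<delta> (std_gen n k))) {..<n}"
    if u: "u \<in> carrier ?M" and v: "v \<in> carrier ?M" for u v
  proof -
    let ?f = "\<lambda>w k. act (fox n k w) (\<delta> (std_gen n k))"
    have \<tau>v: "(\<lambda>k. kernel_action n (ab n u) (?f v k)) \<in> {..<n} \<rightarrow> carrier ?K"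
      using closed[of "\<lambda>k. fox n k v"] by (intro Pi_I K.\<tau>_closed) (erule funcset_mem)
    have "finprod ?K (?f (u \<otimes>\<^bsub>?M\<^esub> v)) {..<n} =
        finprod ?K (\<lambda>k. kernel_action n (ab n u) (?f v k) \<otimes>\<^bsub>?K\<^esub> ?f u k) {..<n}"
    proof (rule K.finprod_cong')
      show "(\<lambda>k. kernel_action n (ab n u) (?f v k) \<otimes>\<^bsub>?K\<^esub> ?f u k) \<in> {..<n} \<rightarrow> carrier ?K"
        by (intro Pi_I K.m_closed funcset_mem[OF \<tau>v] funcset_mem[OF closed])
      fix k assume "k \<in> {..<n}"
      then have x: "\<delta> (std_gen n k) \<in> carrier ?K" using \<delta>x by simp
      let ?x = "\<delta> (std_gen n k)"
      have "act (lmonom (ab n u) * fox n k v) ?x = act (lmonom (ab n u)) (act (fox n k v) ?x)"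
        unfolding act_def by (rule K.act_mult[OF x])
      also have "\<dots> = kernel_action n (ab n u) (act (fox n k v) ?x) [^]\<^bsub>?K\<^esub> (1 :: int)"
        unfolding act_def by (rule K.act_single[OF K.act_closed[OF x]])
      also have "\<dots> = kernel_action n (ab n u) (act (fox n k v) ?x)"
        unfolding act_def by (rule K.int_pow_1[OF K.\<tau>_closed[OF K.act_closed[OF x]]])
      finally have *: "act (lmonom (ab n u) * fox n k v) ?x = kernel_action n (ab n u) (act (fox n k v) ?x)" .
      have "?f (u \<otimes>\<^bsub>?M\<^esub> v) k = act (fox n k u) ?x \<otimes>\<^bsub>?K\<^esub> act (lmonom (ab n u) * fox n k v) ?x"
        unfolding fox_mult[OF u v] act_def by (rule K.act_add[OF x])
      also have "\<dots> = act (lmonom (ab n u) * fox n k v) ?x \<otimes>\<^bsub>?K\<^esub> act (fox n k u) ?x"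
        unfolding act_def by (intro K.m_comm K.act_closed x)
      finally show "?f (u \<otimes>\<^bsub>?M\<^esub> v) k = kernel_action n (ab n u) (?f v k) \<otimes>\<^bsub>?K\<^esub> ?f u k"
        unfolding * .
    qed simp
    also have "\<dots> = finprod ?K (\<lambda>k. kernel_action n (ab n u) (?f v k)) {..<n} \<otimes>\<^bsub>?K\<^esub> finprod ?K (?f u) {..<n}"
      by (rule K.finprod_multf[OF \<tau>v closed])
    also have "finprod ?K (\<lambda>k. kernel_action n (ab n u) (?f v k)) {..<n} =
        kernel_action n (ab n u) (finprod ?K (?f v) {..<n})"
      by (rule K.finprod_endo[OF K.\<tau>_hom closed, symmetric])
    also have "\<dots> = conjugate n u (finprod ?K (?f v) {..<n})"
      using K.finprod_closed[OF closed] by (intro kernel_action_ab[OF u]) simp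
    finally show ?thesis by simp
  qed
  fix i assume i: "i < n"
  have "finprod ?K (\<lambda>k. act (fox n k (std_gen n i)) (\<delta> (std_gen n k))) {..<n} =
      finprod ?K (\<lambda>k. if i = k then \<delta> (std_gen n k) else \<one>\<^bsub>?K\<^esub>) {..<n}"
  proof (rule K.finprod_cong')
    show "(\<lambda>k. if i = k then \<delta> (std_gen n k) else \<one>\<^bsub>?K\<^esub>) \<in> {..<n} \<rightarrow> carrier ?K"
      by (rule Pi_I) (use \<delta>x K.one_closed in \<open>simp split: if_split del: K.one_closed\<close>)
    fix k assume "k \<in> {..<n}"
    then show "act (fox n k (std_gen n i)) (\<delta> (std_gen n k)) = (if i = k then \<delta> (std_gen n k) else \<one>\<^bsub>?K\<^esub>)"
      using i K.act_one[OF \<delta>x, of k] K.act_zero unfolding act_def by (simp split: if_split)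
  qed simp
  also have "\<dots> = \<delta> (std_gen n i)"
    by (rule K.finprod_singleton) (use i \<delta>x in \<open>simp_all\<close>)
  finally show "\<delta> (std_gen n i) = finprod ?K (\<lambda>k. act (fox n k (std_gen n i)) (\<delta> (std_gen n k))) {..<n}"
    by simp
qed

section \<open>Inverting an endomorphism on the abelianisation\<close>

lemma augmentation_matrix_inverse:
  fixes A B :: "laurent mat"
  assumes A: "A \<in> carrier_mat n n" and B: "B \<in> carrier_mat n n" and AB: "A * B = 1\<^sub>m n" and i: "i < n"
  shows "(\<Sum>j<n. of_int (augmentation (A $$ (i, j))) *
      (\<Sum>k<n. of_int (augmentation (B $$ (j, k))) * unit_expo k)) = unit_expo i"
proof -
  have *: "(\<Sum>j<n. augmentation (A $$ (i, j)) * augmentation (B $$ (j, k))) = (if i = k then 1 else 0)" if k: "k < n" for k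
  proof -
    have "(\<Sum>j<n. augmentation (A $$ (i, j)) * augmentation (B $$ (j, k))) = augmentation ((A * B) $$ (i, k))"
      using A B i k by (simp add: scalar_prod_def augmentation_sum augmentation_mult atLeast0LessThan)
    then show ?thesis unfolding AB using i k by simp
  qed
  have "(\<Sum>j<n. of_int (augmentation (A $$ (i, j))) * (\<Sum>k<n. of_int (augmentation (B $$ (j, k))) * unit_expo k)) =
      (\<Sum>k<n. of_int (\<Sum>j<n. augmentation (A $$ (i, j)) * augmentation (B $$ (j, k))) * unit_expo k)"
    unfolding sum_distrib_left of_int_sum sum_distrib_right by (subst sum.swap) (simp add: mult.assoc)
  also have "\<dots> = (\<Sum>k<n. if i = k then unit_expo k else 0)"
    by (intro sum.cong) (simp_all add: *)
  also have "\<dots> = unit_expo i"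
    using i by simp
  finally show ?thesis .
qed

lemma ab_eq_on_generators:
  assumes L: "\<And>u v. u \<in> carrier (free_metabelian n) \<Longrightarrow> v \<in> carrier (free_metabelian n) \<Longrightarrow>
      L (u \<otimes>\<^bsub>free_metabelian n\<^esub> v) = L u + L v"
    and gen: "\<And>i. i < n \<Longrightarrow> L (std_gen n i) = unit_expo i"
    and w: "w \<in> carrier (free_metabelian n)"
  shows "L w = ab n w"
proof (rule crossed_ext(1)[OF _ ab_crossed free_basis_std_gen _ w])
  show "crossed n L (\<lambda>_. 0)"
    unfolding crossed_iff by (simp add: L)
qed (simp add: gen)

text \<open>The rows of the augmented matrix \<open>C\<close> are lifted to group elements, which
  become the images of the generators under \<open>\<rho>\<close>. Both compositions matter later:
  one puts the discrepancy into the kernel, the other handles its values on the image of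
  \<open>\<phi>\<close>.\<close>

lemma ab_section_exists:
  assumes \<phi>: "\<phi> \<in> hom (free_metabelian n) (free_metabelian n)"
    and C: "C \<in> carrier_mat n n" "C * jacobian n \<phi> = 1\<^sub>m n" "jacobian n \<phi> * C = 1\<^sub>m n"
  obtains \<rho> where "\<rho> \<in> hom (free_metabelian n) (free_metabelian n)"
    "\<And>w. w \<in> carrier (free_metabelian n) \<Longrightarrow> ab n (\<phi> (\<rho> w)) = ab n w"
    "\<And>w. w \<in> carrier (free_metabelian n) \<Longrightarrow> ab n (\<rho> (\<phi> w)) = ab n w"
proof -
  let ?M = "free_metabelian n"
  have "\<exists>w. w \<in> carrier ?M \<and> ab n w = (\<Sum>k<n. of_int (augmentation (C $$ (i, k))) * unit_expo k)" for i
    using ab_surj[OF order_refl, of n "\<lambda>k. augmentation (C $$ (i, k))"] by blast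
  then have "\<forall>i. \<exists>w. w \<in> carrier ?M \<and> ab n w = (\<Sum>k<n. of_int (augmentation (C $$ (i, k))) * unit_expo k)"
    by (rule allI)
  then obtain x where x: "\<forall>i. x i \<in> carrier ?M \<and> ab n (x i) = (\<Sum>k<n. of_int (augmentation (C $$ (i, k))) * unit_expo k)"
    by (rule choice[THEN exE])
  have "x \<in> {..<n} \<rightarrow> carrier ?M" using x by blast
  from std_gen_extends[OF metabelian_free_metabelian this]
  obtain \<rho> where \<rho>: "\<rho> \<in> hom ?M ?M" "\<forall>i<n. \<rho> (std_gen n i) = x i" by blast
  have ab\<rho>: "ab n (\<rho> (std_gen n i)) = (\<Sum>k<n. of_int (augmentation (C $$ (i, k))) * unit_expo k)" if "i < n" for i
    using \<rho>(2) x that by simp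
  have ab\<phi>: "ab n (\<phi> (std_gen n i)) = (\<Sum>k<n. of_int (augmentation (jacobian n \<phi> $$ (i, k))) * unit_expo k)"
    if "i < n" for i
  proof -
    have "ab n (\<phi> (std_gen n i)) = (\<Sum>k<n. of_int (augmentation (fox n k (\<phi> (std_gen n i)))) * unit_expo k)"
      by (rule ab_eq_augmentation) (rule hom_in_carrier[OF \<phi> std_gen_closed[OF that]])
    also have "\<dots> = (\<Sum>k<n. of_int (augmentation (jacobian n \<phi> $$ (i, k))) * unit_expo k)"
      using that by (intro sum.cong) simp_all
    finally show ?thesis .
  qed
  \<comment> \<open>One computation for both orders of composition. Rows are images of generators,
    so \<open>f \<circ> g\<close> belongs to the product \<open>A * B\<close> with the matrix of
    \<open>g\<close> on the left.\<close>
  have comp: "ab n (f (g w)) = ab n w"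
    if f: "f \<in> hom ?M ?M" "\<And>i. i < n \<Longrightarrow> ab n (f (std_gen n i)) = (\<Sum>k<n. of_int (augmentation (B $$ (i, k))) * unit_expo k)"
      and g: "g \<in> hom ?M ?M" "\<And>i. i < n \<Longrightarrow> ab n (g (std_gen n i)) = (\<Sum>k<n. of_int (augmentation (A $$ (i, k))) * unit_expo k)"
      and A: "A \<in> carrier_mat n n" and B: "B \<in> carrier_mat n n" and AB: "A * B = 1\<^sub>m n" and w: "w \<in> carrier ?M"
    for f g w and A B :: "laurent mat"
  proof (rule ab_eq_on_generators[where L = "\<lambda>w. ab n (f (g w))", OF _ _ w])
    fix u v assume uv: "u \<in> carrier ?M" "v \<in> carrier ?M"
    show "ab n (f (g (u \<otimes>\<^bsub>?M\<^esub> v))) = ab n (f (g u)) + ab n (f (g v))"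
      using uv by (simp add: hom_mult[OF g(1)] hom_mult[OF f(1)] hom_in_carrier[OF g(1)] hom_in_carrier[OF f(1)])
  next
    fix i assume i: "i < n"
    let ?b = "\<lambda>j. ab n (f (std_gen n j))"
    have "ab n (f (g (std_gen n i))) = linear_ext n ?b (ab n (g (std_gen n i)))"
      by (rule ab_hom[OF f(1)]) (rule hom_in_carrier[OF g(1) std_gen_closed[OF i]])
    also have "\<dots> = (\<Sum>j<n. of_int (augmentation (A $$ (i, j))) * ?b j)"
      unfolding g(2)[OF i] by (rule linear_ext_sum)
    also have "\<dots> = (\<Sum>j<n. of_int (augmentation (A $$ (i, j))) *
        (\<Sum>k<n. of_int (augmentation (B $$ (j, k))) * unit_expo k))"
      by (intro sum.cong) (simp_all add: f(2))
    also have "\<dots> = unit_expo i"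
      by (rule augmentation_matrix_inverse[OF A B AB i])
    finally show "ab n (f (g (std_gen n i))) = unit_expo i" .
  qed
  have J: "jacobian n \<phi> \<in> carrier_mat n n" by simp
  show thesis
  proof (rule that[OF \<rho>(1)])
    show "ab n (\<phi> (\<rho> w)) = ab n w" if "w \<in> carrier ?M" for w
      by (rule comp[OF \<phi> ab\<phi> \<rho>(1) ab\<rho> C(1) J C(2) that])
    show "ab n (\<rho> (\<phi> w)) = ab n w" if "w \<in> carrier ?M" for w
      by (rule comp[OF \<rho>(1) ab\<rho> \<phi> ab\<phi> J C(1) C(3) that])
  qed
qed

text \<open>Both conclusions rest on the same \<open>\<rho>\<close>. The second, injectivity on the
  abelianisation, serves to show that a right inverse of \<open>\<phi>\<close> is also a left
  inverse modulo the kernel of \<open>ab n\<close>.\<close>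

lemma
  assumes \<phi>: "\<phi> \<in> hom (free_metabelian n) (free_metabelian n)" and inv: "jacobian_invertible n \<phi>"
  shows surj_if_jacobian_invertible: "carrier (free_metabelian n) \<subseteq> \<phi> ` carrier (free_metabelian n)"
    and ab_zero_if_jacobian_invertible:
      "u \<in> carrier (free_metabelian n) \<Longrightarrow> ab n (\<phi> u) = 0 \<Longrightarrow> ab n u = 0"
proof -
  let ?M = "free_metabelian n" and ?K = "kernel_group n"
  let ?act = "laurent_action.act ?K (kernel_action n)"
  interpret M: group ?M by (rule group_free_metabelian)
  interpret K: laurent_action ?K "kernel_action n" by (rule laurent_action_kernel)
  obtain C where C: "C \<in> carrier_mat n n" "C * jacobian n \<phi> = 1\<^sub>m n" "jacobian n \<phi> * C = 1\<^sub>m n"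
    using inv unfolding jacobian_invertible_def by blast
  obtain \<rho> where \<rho>: "\<rho> \<in> hom ?M ?M"
    and \<phi>\<rho>: "\<And>w. w \<in> carrier ?M \<Longrightarrow> ab n (\<phi> (\<rho> w)) = ab n w"
    and \<rho>\<phi>: "\<And>w. w \<in> carrier ?M \<Longrightarrow> ab n (\<rho> (\<phi> w)) = ab n w"
    by (rule ab_section_exists[OF \<phi> C]) blast
  have \<phi>M: "\<phi> w \<in> carrier ?M" and \<rho>M: "\<rho> w \<in> carrier ?M" if "w \<in> carrier ?M" for w
    using hom_in_carrier[OF \<phi> that] hom_in_carrier[OF \<rho> that] .
  interpret \<phi>: group_hom ?M ?M \<phi>
    by (intro group_hom.intro group_hom_axioms.intro M.is_group \<phi>)
  interpret \<rho>: group_hom ?M ?M \<rho>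
    by (intro group_hom.intro group_hom_axioms.intro M.is_group \<rho>)
  have ab\<rho>0: "ab n (\<rho> w) = 0" if "w \<in> carrier ?M" "ab n w = 0" for w
    by (simp add: ab_hom[OF \<rho> that(1)] that(2) linear_ext_def)
  have ab\<phi>0: "ab n (\<phi> w) = 0" if "w \<in> carrier ?M" "ab n w = 0" for w
    by (simp add: ab_hom[OF \<phi> that(1)] that(2) linear_ext_def)
  show "ab n u = 0" if "u \<in> carrier ?M" "ab n (\<phi> u) = 0"
    using ab\<rho>0[OF \<phi>M[OF that(1)] that(2)] \<rho>\<phi>[OF that(1)] by simp
  have car: "m \<in> carrier ?M" if "m \<in> ab_kernel n" for m
    using that by (simp add: ab_kernel_def)
  define S where "S = \<phi> ` ab_kernel n"
  have SK: "S \<subseteq> ab_kernel n"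
    unfolding S_def ab_kernel_def using \<phi>M ab\<phi>0 by blast
  have SM: "subgroup S ?M"
    unfolding S_def by (rule \<phi>.subgroup_img_is_subgroup[OF ab_kernel_subgroup])
  have S: "subgroup S ?K"
    by (rule M.subgroup_incl[OF SM ab_kernel_subgroup SK])
  \<comment> \<open>\<open>\<delta>\<close> is crossed and maps the image of \<open>\<phi>\<close> into \<open>S\<close>; inverting the Jacobian puts all its values there\<close>
  define \<delta> where "\<delta> w = w \<otimes>\<^bsub>?M\<^esub> inv\<^bsub>?M\<^esub> (\<phi> (\<rho> w))" for w
  have \<delta>K: "\<delta> w \<in> ab_kernel n" if "w \<in> carrier ?M" for w
    using that \<phi>\<rho>[OF that] by (simp add: \<delta>_def ab_kernel_def)
  have \<delta>_mult: "\<delta> (u \<otimes>\<^bsub>?M\<^esub> v) = conjugate n u (\<delta> v) \<otimes>\<^bsub>?M\<^esub> \<delta> u"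
    if u: "u \<in> carrier ?M" and v: "v \<in> carrier ?M" for u v
  proof -
    have "inv\<^bsub>?M\<^esub> u \<otimes>\<^bsub>?M\<^esub> (u \<otimes>\<^bsub>?M\<^esub> inv\<^bsub>?M\<^esub> (\<phi> (\<rho> u))) = inv\<^bsub>?M\<^esub> (\<phi> (\<rho> u))"
      using u by (simp flip: M.m_assoc)
    then show ?thesis
      using u v by (simp add: \<delta>_def conjugate_def M.m_assoc M.inv_mult_group)
  qed
  have decomp: "w = \<delta> w \<otimes>\<^bsub>?M\<^esub> \<phi> (\<rho> w)" if "w \<in> carrier ?M" for w
    using that by (simp add: \<delta>_def M.m_assoc)
  \<comment> \<open>Every exponent is also the exponent of an element in the image of
    \<open>\<phi>\<close>, because \<open>\<phi> \<circ> \<rho>\<close> is the identity on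
    exponents; conjugation by such an element preserves \<open>S\<close>.\<close>
  have S_action: "kernel_action n \<alpha> m \<in> S" if "m \<in> S" for \<alpha> m
  proof -
    obtain d where d: "d \<in> ab_kernel n" "m = \<phi> d" using \<open>m \<in> S\<close> unfolding S_def by blast
    let ?g = "\<rho> (lift_expo n \<alpha>)"
    have g: "?g \<in> carrier ?M" by (rule \<rho>M[OF lift_expo_closed])
    have "kernel_action n \<alpha> m = conjugate n (\<phi> ?g) m"
      using \<phi>\<rho>[OF lift_expo_closed, of \<alpha>] SK that
      by (intro conjugate_cong lift_expo_closed \<phi>M g) auto
    also have "\<dots> = \<phi> (conjugate n ?g d)"
      unfolding d(2) conjugate_def using g car[OF d(1)] by simp
    also have "\<dots> \<in> S"
      unfolding S_def by (intro imageI conjugate_closed g d(1))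
    finally show ?thesis .
  qed
  have J\<delta>: "finprod ?K (\<lambda>j. ?act (jacobian n \<phi> $$ (i, j)) (\<delta> (std_gen n j))) {..<n} \<in> S" if i: "i < n" for i
  proof -
    let ?x = "std_gen n i"
    have x: "?x \<in> carrier ?M" by (rule std_gen_closed[OF i])
    have "finprod ?K (\<lambda>j. ?act (jacobian n \<phi> $$ (i, j)) (\<delta> (std_gen n j))) {..<n} =
        finprod ?K (\<lambda>j. ?act (fox n j (\<phi> ?x)) (\<delta> (std_gen n j))) {..<n}"
    proof (rule K.finprod_cong')
      show "(\<lambda>j. ?act (fox n j (\<phi> ?x)) (\<delta> (std_gen n j))) \<in> {..<n} \<rightarrow> carrier ?K"
        by (intro Pi_I K.act_closed) (simp add: \<delta>K std_gen_closed)
    qed (use i in simp_all)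
    also have "\<dots> = \<delta> (\<phi> ?x)"
      by (rule kernel_chain_rule[OF \<delta>K \<delta>_mult \<phi>M[OF x], symmetric])
    \<comment> \<open>\<open>\<phi>\<close> can be pulled out of \<open>\<delta> (\<phi> x)\<close>,
      and the remaining argument lies in the kernel since \<open>\<rho> \<circ> \<phi>\<close> is
      the identity on exponents.\<close>
    also have "\<dots> = \<phi> (?x \<otimes>\<^bsub>?M\<^esub> inv\<^bsub>?M\<^esub> (\<rho> (\<phi> ?x)))"
      using x by (simp add: \<delta>_def)
    also have "\<dots> \<in> S"
      unfolding S_def using x \<rho>\<phi>[OF x] by (intro imageI) (simp add: ab_kernel_def)
    finally show ?thesis .
  qed
  have \<delta>S: "\<delta> (std_gen n k) \<in> S" if "k < n" for k
    by (rule K.act_matrix_left_inverse[OF C(1) _ C(2) _ S S_action J\<delta> that])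
      (simp_all add: \<delta>K std_gen_closed)
  have sub: "subgroup (\<phi> ` carrier ?M) ?M"
    by (rule \<phi>.img_is_subgroup)
  have "std_gen n k \<in> \<phi> ` carrier ?M" if k: "k < n" for k
  proof -
    have "\<delta> (std_gen n k) \<in> \<phi> ` carrier ?M"
      using \<delta>S[OF k] car unfolding S_def by blast
    moreover have "\<phi> (\<rho> (std_gen n k)) \<in> \<phi> ` carrier ?M"
      by (intro imageI \<rho>M std_gen_closed k)
    ultimately have "\<delta> (std_gen n k) \<otimes>\<^bsub>?M\<^esub> \<phi> (\<rho> (std_gen n k)) \<in> \<phi> ` carrier ?M"
      by (rule subgroup.m_closed[OF sub])
    then show ?thesis
      using decomp[OF std_gen_closed[OF k]] by simp
  qed
  then have "std_gen n ` {..<n} \<subseteq> \<phi> ` carrier ?M" by blast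
  from M.generate_subgroup_incl[OF this sub]
  show "carrier ?M \<subseteq> \<phi> ` carrier ?M"
    by (simp only: std_gen_generates)
qed

section \<open>Right inverses and their Jacobians\<close>

lemma right_inverse_on_generators:
  assumes \<phi>: "\<phi> \<in> hom (free_metabelian n) (free_metabelian n)"
    and \<psi>: "\<psi> \<in> hom (free_metabelian n) (free_metabelian n)"
    and gen: "\<And>i. i < n \<Longrightarrow> \<phi> (\<psi> (std_gen n i)) = std_gen n i"
    and w: "w \<in> carrier (free_metabelian n)"
  shows "\<phi> (\<psi> w) = w"
proof -
  have "(\<phi> \<circ> \<psi>) w = id w"
    by (rule hom_eq_on_generate[OF group_free_metabelian group_free_metabelian
          Group.hom_compose[OF \<psi> \<phi>] _, of id "std_gen n ` {..<n}"])
      (use gen w std_gen_closed in \<open>auto simp: hom_def std_gen_generates\<close>)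
  then show ?thesis by simp
qed

text \<open>Fox derivatives with index below \<open>n\<close> involve only the first
  \<open>n\<close> variables, so truncation fixes them. The chain rule with truncation as
  \<open>\<beta>\<close> shows this without inspecting words.\<close>

lemma push_unit_fox:
  assumes w: "w \<in> carrier (free_metabelian n)" and j: "j < n"
  shows "push (linear_ext n unit_expo) (fox n j w) = fox n j w"
proof -
  have "fox n j w = (\<Sum>k<n. push (linear_ext n unit_expo) (fox n k w) * fox n j (std_gen n k))"
    by (rule fox_chain_rule[OF linear_ext_add _ fox_crossed w]) (simp add: linear_ext_unit_ab)
  also have "\<dots> = (\<Sum>k<n. if k = j then push (linear_ext n unit_expo) (fox n k w) else 0)"
    by (intro sum.cong) simp_all
  also have "\<dots> = push (linear_ext n unit_expo) (fox n j w)"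
    using j by simp
  finally show ?thesis by simp
qed

lemma push_mat_inverse:
  fixes A B :: "laurent mat"
  assumes \<beta>: "\<And>\<alpha> \<gamma>. \<beta> (\<alpha> + \<gamma>) = \<beta> \<alpha> + \<beta> \<gamma>"
    and A: "A \<in> carrier_mat n n" and B: "B \<in> carrier_mat n n" and AB: "A * B = 1\<^sub>m n"
  shows "map_mat (push \<beta>) A * map_mat (push \<beta>) B = 1\<^sub>m n"
proof (rule eq_matI)
  fix i j assume "i < dim_row (1\<^sub>m n :: laurent mat)" "j < dim_col (1\<^sub>m n :: laurent mat)"
  then have ij: "i < n" "j < n" by simp_all
  have "(map_mat (push \<beta>) A * map_mat (push \<beta>) B) $$ (i, j) = push \<beta> ((A * B) $$ (i, j))"
    using A B ij by (simp add: scalar_prod_def push_sum push_mult[OF \<beta>])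
  also have "\<dots> = (1\<^sub>m n :: laurent mat) $$ (i, j)"
    unfolding AB using ij by (simp add: push_one[OF \<beta>])
  finally show "(map_mat (push \<beta>) A * map_mat (push \<beta>) B) $$ (i, j) = (1\<^sub>m n :: laurent mat) $$ (i, j)" .
qed (use A B in simp_all)

text \<open>The chain rule for \<open>\<phi> \<circ> \<psi>\<close> shows that the Jacobian of
  \<open>\<psi>\<close>, twisted by the exponent map \<open>\<beta>\<close> of
  \<open>\<phi>\<close>, inverts the Jacobian of \<open>\<phi>\<close>. Applying the exponent map
  \<open>\<gamma>\<close> of \<open>\<psi>\<close> removes the twist, since
  \<open>\<gamma> \<circ> \<beta>\<close> is only a truncation.\<close>

lemma jacobian_invertible_right_inverse:
  assumes \<phi>: "\<phi> \<in> hom (free_metabelian n) (free_metabelian n)" and inv: "jacobian_invertible n \<phi>"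
    and \<psi>: "\<psi> \<in> hom (free_metabelian n) (free_metabelian n)"
    and \<phi>\<psi>: "\<And>i. i < n \<Longrightarrow> \<phi> (\<psi> (std_gen n i)) = std_gen n i"
  shows "jacobian_invertible n \<psi>"
proof -
  let ?M = "free_metabelian n"
  interpret M: group ?M by (rule group_free_metabelian)
  interpret \<phi>: group_hom ?M ?M \<phi>
    by (intro group_hom.intro group_hom_axioms.intro M.is_group \<phi>)
  interpret \<psi>: group_hom ?M ?M \<psi>
    by (intro group_hom.intro group_hom_axioms.intro M.is_group \<psi>)
  have x: "std_gen n i \<in> carrier ?M" if "i < n" for i
    by (rule std_gen_closed[OF that])
  define \<beta> where "\<beta> = linear_ext n (\<lambda>i. ab n (\<phi> (std_gen n i)))"
  define \<gamma> where "\<gamma> = linear_ext n (\<lambda>i. ab n (\<psi> (std_gen n i)))"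
  obtain C where C: "C \<in> carrier_mat n n" "C * jacobian n \<phi> = 1\<^sub>m n" "jacobian n \<phi> * C = 1\<^sub>m n"
    using inv unfolding jacobian_invertible_def by blast
  have \<phi>\<psi>M: "\<phi> (\<psi> w) = w" if "w \<in> carrier ?M" for w
    by (rule right_inverse_on_generators[OF \<phi> \<psi> \<phi>\<psi> that])
  \<comment> \<open>\<open>\<phi>\<close> sends the quotient of \<open>\<psi> (\<phi> w)\<close> by
    \<open>w\<close> to the identity, and \<open>\<phi>\<close> is injective on the
    abelianisation.\<close>
  have ab\<psi>\<phi>: "ab n (\<psi> (\<phi> w)) = ab n w" if w: "w \<in> carrier ?M" for w
  proof -
    let ?u = "\<psi> (\<phi> w) \<otimes>\<^bsub>?M\<^esub> inv\<^bsub>?M\<^esub> w"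
    have u: "?u \<in> carrier ?M" using w by simp
    have "\<phi> ?u = \<one>\<^bsub>?M\<^esub>"
      using w by (simp add: \<phi>\<psi>M)
    then have "ab n (\<phi> ?u) = 0" by (simp only: ab_one)
    from ab_zero_if_jacobian_invertible[OF \<phi> inv u this]
    show ?thesis using w by simp
  qed
  have \<gamma>\<beta>: "\<gamma> (\<beta> \<alpha>) = linear_ext n unit_expo \<alpha>" for \<alpha>
  proof -
    have \<gamma>_sum: "\<gamma> (\<Sum>i\<in>I. of_int (c i) * b i) = (\<Sum>i\<in>I. of_int (c i) * \<gamma> (b i))" for I :: "nat set" and c b
    proof (induction I rule: infinite_finite_induct)
      case (insert i I)
      have "\<gamma> (of_int (c i) * b i) = of_int (c i) * \<gamma> (b i)"
        by (simp add: \<gamma>_def linear_ext_def sum_distrib_left mult.assoc)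
      then show ?case
        using insert by (simp add: \<gamma>_def linear_ext_add)
    qed (simp_all add: \<gamma>_def linear_ext_def)
    have "\<gamma> (ab n (\<phi> (std_gen n i))) = unit_expo i" if "i < n" for i
      using ab_hom[OF \<psi>, of "\<phi> (std_gen n i)"] ab\<psi>\<phi>[OF x[OF that]] x[OF that] that
      by (simp add: \<gamma>_def)
    then show ?thesis
      unfolding \<beta>_def linear_ext_def[of n "\<lambda>i. ab n (\<phi> (std_gen n i))"] \<gamma>_sum
      unfolding linear_ext_def by (intro sum.cong) simp_all
  qed
  define P where "P = mat n n (\<lambda>(i, k). push \<beta> (fox n k (\<psi> (std_gen n i))))"
  have P: "P \<in> carrier_mat n n" and J: "jacobian n \<phi> \<in> carrier_mat n n"
    by (simp_all add: P_def)
  have PJ: "P * jacobian n \<phi> = 1\<^sub>m n"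
  proof (rule eq_matI)
    fix i j assume "i < dim_row (1\<^sub>m n :: laurent mat)" "j < dim_col (1\<^sub>m n :: laurent mat)"
    then have ij: "i < n" "j < n" by simp_all
    have "(P * jacobian n \<phi>) $$ (i, j) = (\<Sum>k = 0..<n. P $$ (i, k) * jacobian n \<phi> $$ (k, j))"
      using ij P by (simp add: scalar_prod_def)
    also have "\<dots> = (\<Sum>k<n. push \<beta> (fox n k (\<psi> (std_gen n i))) * fox n j (\<phi> (std_gen n k)))"
      using ij by (intro sum.cong) (auto simp: P_def)
    also have "\<dots> = fox n j (\<phi> (\<psi> (std_gen n i)))"
      unfolding \<beta>_def by (rule fox_hom[OF \<phi>, symmetric]) (simp add: x ij)
    also have "\<dots> = (1\<^sub>m n :: laurent mat) $$ (i, j)"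
      using ij by (simp add: \<phi>\<psi>)
    finally show "(P * jacobian n \<phi>) $$ (i, j) = (1\<^sub>m n :: laurent mat) $$ (i, j)" .
  qed (simp_all add: P_def)
  \<comment> \<open>The left inverse \<open>P\<close> equals the two-sided inverse \<open>C\<close>,
    so it is a right inverse too.\<close>
  have "P = P * (jacobian n \<phi> * C)"
    using P by (simp add: C(3))
  also have "\<dots> = C"
    using assoc_mult_mat[OF P J C(1)] PJ C(1) by simp
  finally have JP: "jacobian n \<phi> * P = 1\<^sub>m n"
    using C(3) by simp
  have \<gamma>: "\<gamma> (\<alpha> + \<alpha>') = \<gamma> \<alpha> + \<gamma> \<alpha>'" for \<alpha> \<alpha>'
    by (simp add: \<gamma>_def linear_ext_add)
  have "map_mat (push \<gamma>) P = jacobian n \<psi>"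
  proof (rule eq_matI)
    fix i j assume "i < dim_row (jacobian n \<psi>)" "j < dim_col (jacobian n \<psi>)"
    then have ij: "i < n" "j < n" by simp_all
    have "push \<gamma> (push \<beta> (fox n j (\<psi> (std_gen n i)))) = fox n j (\<psi> (std_gen n i))"
      unfolding push_push \<gamma>\<beta> by (rule push_unit_fox) (simp_all add: x ij)
    then show "map_mat (push \<gamma>) P $$ (i, j) = jacobian n \<psi> $$ (i, j)"
      using ij by (simp add: P_def)
  qed (simp_all add: P_def)
  then show ?thesis
    unfolding jacobian_invertible_def
    using push_mat_inverse[OF \<gamma> P J PJ] push_mat_inverse[OF \<gamma> J P JP]
    by (intro bexI[of _ "map_mat (push \<gamma>) (jacobian n \<phi>)"]) simp_all
qed

theorem mainTheorem1:
  fixes n :: nat and \<phi> :: "letter list set \<Rightarrow> letter list set"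
  assumes "n \<ge> 1"
    and "\<phi> \<in> hom (free_metabelian n) (free_metabelian n)"
    and "\<And>g. primitive n g \<Longrightarrow> primitive n (\<phi> g)"
  shows "\<phi> \<in> iso (free_metabelian n) (free_metabelian n)"
proof -
  let ?M = "free_metabelian n"
  note \<phi> = assms(2)
  interpret M: group ?M by (rule group_free_metabelian)
  have inv: "jacobian_invertible n \<phi>"
    by (rule jacobian_invertible_if_primitive_preserving[OF \<phi> assms(3)])
  note surj = surj_if_jacobian_invertible[OF \<phi> inv]
  have "\<exists>z. z \<in> carrier ?M \<and> (i < n \<longrightarrow> \<phi> z = std_gen n i)" for i
    using surj std_gen_closed[of i n] M.one_closed by (cases "i < n") blast+
  then have "\<forall>i. \<exists>z. z \<in> carrier ?M \<and> (i < n \<longrightarrow> \<phi> z = std_gen n i)"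
    by (rule allI)
  then obtain z where z: "\<forall>i. z i \<in> carrier ?M \<and> (i < n \<longrightarrow> \<phi> (z i) = std_gen n i)"
    by (rule choice[THEN exE])
  have "z \<in> {..<n} \<rightarrow> carrier ?M" using z by blast
  from std_gen_extends[OF metabelian_free_metabelian this]
  obtain \<psi> where \<psi>: "\<psi> \<in> hom ?M ?M" "\<forall>i<n. \<psi> (std_gen n i) = z i" by blast
  have \<phi>\<psi>x: "\<phi> (\<psi> (std_gen n i)) = std_gen n i" if "i < n" for i
    using z \<psi>(2) that by simp
  have \<phi>\<psi>: "\<phi> (\<psi> w) = w" if "w \<in> carrier ?M" for w
    by (rule right_inverse_on_generators[OF \<phi> \<psi>(1) \<phi>\<psi>x that])
  have "carrier ?M \<subseteq> \<psi> ` carrier ?M"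
    by (rule surj_if_jacobian_invertible[OF \<psi>(1) jacobian_invertible_right_inverse[OF \<phi> inv \<psi>(1) \<phi>\<psi>x]])
  \<comment> \<open>Writing \<open>w\<close> as \<open>\<psi> v\<close> gives \<open>\<psi> (\<phi>
    w) = \<psi> (\<phi> (\<psi> v)) = \<psi> v = w\<close>.\<close>
  then have \<psi>\<phi>: "\<psi> (\<phi> w) = w" if "w \<in> carrier ?M" for w
    using that \<phi>\<psi> by (metis (no_types, lifting) imageE subsetD)
  have "bij_betw \<phi> (carrier ?M) (carrier ?M)"
    by (rule bij_betw_byWitness[where f' = \<psi>])
      (use \<psi>\<phi> \<phi>\<psi> hom_in_carrier[OF \<phi>] hom_in_carrier[OF \<psi>(1)] in auto)
  with \<phi> show ?thesis by (simp add: iso_def)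
qed

end
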